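(* There are absolute constants $C$ and $n_0$ such that for all integers $n\ge n_0$ $$\left|\frac{S_2(n)}{\pi(\sqrt n)^3}-\frac23\right|\le C\,\frac{\log\log n}{\sqrt{\log n}}.$$ In particular, as $n\to\infty$, $$S(n)\sim\tfrac23\,\pi(\sqrt n)^3\sim\frac{16}{3}\cdot\frac{n^{3/2}}{\log^3 n},$$ and consequently $$C_n=\binom{\pi(n)+1}{2}+\Bigl(\tfrac{16}{3}+o(1)\Bigr)\frac{n^{3/2}}{\log^3 n}.$$ In particular the upper bound $S(n)\le n(\pi(\sqrt n)-1)$ overshoots by a factor $\asymp\log^2 n$, i.e. $n(\pi(\sqrt n)-1)/S(n)\asymp\log^2 n$ as $n\to\infty$.
   Context: $p_1=2<p_2=3<\cdots$ are the primes, $\pi(x)$ is the number of primes $\le x$, $\operatorname{lpf}(x)$ is the least prime factor of an integer $x>1$, and $\Omega(x)$ is the number of prime factors of $x$ counted with multiplicity. $K$ is a field containing $\mathbb{Q}$. For a positive integer $n$ put $r=\pi(n)$ and $S=K[x_1,\dots,x_r]$. The weight of a monomial $m=x_1^{a_1}\cdots x_r^{a_r}$ is $w(m)=\prod_i p_i^{a_i}$. $I_n\subset S$ is the monomial ideal generated by all monomials of weight $>n$, $G(I_n)$ is its minimal monomial generating set, and $C_n=\#G(I_n)$. The function $S(n)$ (not to be confused with the ring $S$) is $$S(n)=C_n-\binom{\pi(n)+1}{2}=\sum_{x\le n,\ x\text{ composite}}\bigl(\pi(\operatorname{lpf}x)-1\bigr),$$ and $S_2(n)=\sum_{x\le n,\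 \Omega(x)=2}\bigl(\pi(\operatorname{lpf}x)-1\bigr)$ is the part of this sum coming from $x$ with $\Omega(x)=2$. *)

theory Defs
  imports
    Complex_Main
    "HOL-Computational_Algebra.Primes"
    "HOL-Library.Infinite_Set"
    "HOL-Library.Poly_Mapping"
    "HOL-Library.Landau_Symbols"
    "HOL-Algebra.Ideal"
begin

definition prime_pi :: "real \<Rightarrow> nat" where
  "prime_pi x = card {p :: nat. prime p \<and> real p \<le> x}"

text \<open>The library enumeration starts at 0; here \<open>nth_prime 1 = 2\<close>.\<close>

definition nth_prime :: "nat \<Rightarrow> nat" where
  "nth_prime i = enumerate {p. prime p} (i - 1)"

definition lpf :: "nat \<Rightarrow> nat" where
  "lpf x = Min (prime_factors x)"

definition big_Omega :: "nat \<Rightarrow> nat" where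
  "big_Omega x = size (prime_factorization x)"

text \<open>
  An exponent vector is a finitely supported function \<open>nat \<Rightarrow>\<^sub>0 nat\<close>, and a polynomial is a
  finitely supported function from exponent vectors to coefficients. The polynomial ring in the
  variables with indices \<open>1, \<dots>, r\<close> is the subring of those polynomials in which no other
  variable occurs.
\<close>

definition exponents :: "nat \<Rightarrow> (nat \<Rightarrow>\<^sub>0 nat) set" where
  "exponents r = {a. Poly_Mapping.keys a \<subseteq> {1..r}}"

definition poly_ring :: "nat \<Rightarrow> ((nat \<Rightarrow>\<^sub>0 nat) \<Rightarrow>\<^sub>0 'k :: field_char_0) ring" where
  "poly_ring r = \<lparr>carrier = {f. Poly_Mapping.keys f \<subseteq> exponents r},
     mult = (*), one = 1, zero = 0, add = (+)\<rparr>"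

definition monom :: "(nat \<Rightarrow>\<^sub>0 nat) \<Rightarrow> ((nat \<Rightarrow>\<^sub>0 nat) \<Rightarrow>\<^sub>0 'k :: field_char_0)" where
  "monom a = Poly_Mapping.single a 1"

definition monomials :: "nat \<Rightarrow> ((nat \<Rightarrow>\<^sub>0 nat) \<Rightarrow>\<^sub>0 'k :: field_char_0) set" where
  "monomials r = monom ` exponents r"

definition weight :: "(nat \<Rightarrow>\<^sub>0 nat) \<Rightarrow> nat" where
  "weight a = (\<Prod>i\<in>Poly_Mapping.keys a. nth_prime i ^ Poly_Mapping.lookup a i)"

definition weight_ideal :: "nat \<Rightarrow> ((nat \<Rightarrow>\<^sub>0 nat) \<Rightarrow>\<^sub>0 'k :: field_char_0) set" where
  "weight_ideal n =
     Idl\<^bsub>poly_ring (prime_pi (real n))\<^esub>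
       (monom ` {a \<in> exponents (prime_pi (real n)). weight a > n})"

definition is_min_monomial_gens ::
  "nat \<Rightarrow> ((nat \<Rightarrow>\<^sub>0 nat) \<Rightarrow>\<^sub>0 'k :: field_char_0) set \<Rightarrow>
    ((nat \<Rightarrow>\<^sub>0 nat) \<Rightarrow>\<^sub>0 'k) set \<Rightarrow> bool" where
  "is_min_monomial_gens r I G \<longleftrightarrow>
     G \<subseteq> monomials r \<and> Idl\<^bsub>poly_ring r\<^esub> G = I \<and> (\<forall>G'. G' \<subset> G \<longrightarrow> Idl\<^bsub>poly_ring r\<^esub> G' \<noteq> I)"

definition min_monomial_gens ::
  "nat \<Rightarrow> ((nat \<Rightarrow>\<^sub>0 nat) \<Rightarrow>\<^sub>0 'k :: field_char_0) set \<Rightarrow>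
    ((nat \<Rightarrow>\<^sub>0 nat) \<Rightarrow>\<^sub>0 'k) set" where
  "min_monomial_gens r I = (THE G. is_min_monomial_gens r I G)"

text \<open>The argument of type \<open>'k itself\<close> selects the coefficient field.\<close>

definition num_gens :: "'k :: field_char_0 itself \<Rightarrow> nat \<Rightarrow> nat" where
  "num_gens K n =
     card (min_monomial_gens (prime_pi (real n))
       (weight_ideal n :: ((nat \<Rightarrow>\<^sub>0 nat) \<Rightarrow>\<^sub>0 'k) set))"

definition S_fun :: "'k :: field_char_0 itself \<Rightarrow> nat \<Rightarrow> int" where
  "S_fun K n = int (num_gens K n) - int ((prime_pi (real n) + 1) choose 2)"

definition S2_fun :: "nat \<Rightarrow> int" where
  "S2_fun n = (\<Sum>x \<in> {x \<in> {1..n}. big_Omega x = 2}. int (prime_pi (real (lpf x))) - 1)"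

text \<open>
  The generated ideal \<open>Idl\<^bsub>R\<^esub> A\<close> is meaningful only if \<open>R\<close> satisfies the ring axioms, and the
  description of the minimal monomial generating set needs existence and uniqueness. Both are
  established here.
\<close>

lemma exponents_zero [simp]: "0 \<in> exponents r"
  by (simp add: exponents_def)

lemma exponents_add: "a \<in> exponents r \<Longrightarrow> b \<in> exponents r \<Longrightarrow> a + b \<in> exponents r"
  unfolding exponents_def using Poly_Mapping.keys_add[of a b] by auto

lemma exponents_diff: "a \<in> exponents r \<Longrightarrow> a - b \<in> exponents r"
  unfolding exponents_def by (auto simp: in_keys_iff lookup_minus)

lemma poly_ring_simps [simp]:
  "carrier (poly_ring r) = {f. Poly_Mapping.keys f \<subseteq> exponents r}"
  "mult (poly_ring r) = (*)" "one (poly_ring r) = 1"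
  "zero (poly_ring r) = 0" "add (poly_ring r) = (+)"
  by (simp_all add: poly_ring_def)

lemma keys_times_exponents:
  assumes "Poly_Mapping.keys f \<subseteq> exponents r" "Poly_Mapping.keys g \<subseteq> exponents r"
  shows "Poly_Mapping.keys (f * g) \<subseteq> exponents r"
  using Poly_Mapping.keys_mult[of f g] assms exponents_add by fastforce

lemma keys_plus_exponents:
  assumes "Poly_Mapping.keys f \<subseteq> exponents r" "Poly_Mapping.keys g \<subseteq> exponents r"
  shows "Poly_Mapping.keys (f + g) \<subseteq> exponents r"
  using Poly_Mapping.keys_add[of f g] assms by blast

lemma cring_poly_ring: "cring (poly_ring r :: ((nat \<Rightarrow>\<^sub>0 nat) \<Rightarrow>\<^sub>0 'k :: field_char_0) ring)"
proof (rule cringI)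
  show "abelian_group (poly_ring r :: ((nat \<Rightarrow>\<^sub>0 nat) \<Rightarrow>\<^sub>0 'k) ring)"
  proof (rule abelian_groupI)
    fix x :: "(nat \<Rightarrow>\<^sub>0 nat) \<Rightarrow>\<^sub>0 'k"
    assume "x \<in> carrier (poly_ring r)"
    then show "\<exists>y\<in>carrier (poly_ring r). y \<oplus>\<^bsub>poly_ring r\<^esub> x = \<zero>\<^bsub>poly_ring r\<^esub>"
      by (intro bexI[of _ "- x"]) simp_all
  qed (simp_all add: keys_plus_exponents add.assoc add.commute)
  show "comm_monoid (poly_ring r :: ((nat \<Rightarrow>\<^sub>0 nat) \<Rightarrow>\<^sub>0 'k) ring)"
    by (rule comm_monoidI) (simp_all add: keys_times_exponents mult.assoc mult.commute)
qed (simp add: distrib_right)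

definition divides_exp :: "(nat \<Rightarrow>\<^sub>0 nat) \<Rightarrow> (nat \<Rightarrow>\<^sub>0 nat) \<Rightarrow> bool" where
  "divides_exp a b \<longleftrightarrow> (\<exists>c. b = a + c)"

lemma divides_exp_diff: "divides_exp a b \<Longrightarrow> b = (b - a) + a"
  unfolding divides_exp_def by (auto simp: ac_simps)

lemma divides_exp_refl: "divides_exp a a"
  unfolding divides_exp_def by (metis add.right_neutral)

lemma divides_exp_trans: "divides_exp a b \<Longrightarrow> divides_exp b c \<Longrightarrow> divides_exp a c"
  unfolding divides_exp_def by (metis add.assoc)

lemma divides_exp_antisym:
  assumes "divides_exp a b" "divides_exp b a"
  shows "a = b"
proof (rule poly_mapping_eqI)
  fix i
  from assms obtain c d where "b = a + c" "a = b + d" unfolding divides_exp_def by blast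
  then have "Poly_Mapping.lookup b i = Poly_Mapping.lookup a i + Poly_Mapping.lookup c i"
    "Poly_Mapping.lookup a i = Poly_Mapping.lookup b i + Poly_Mapping.lookup d i"
    by (metis lookup_add)+
  then show "Poly_Mapping.lookup a i = Poly_Mapping.lookup b i" by linarith
qed

lemma poly_as_sum: "f = (\<Sum>m\<in>Poly_Mapping.keys f. Poly_Mapping.single m (Poly_Mapping.lookup f m))"
  by (rule poly_mapping_eqI)
    (auto simp: lookup_sum lookup_single when_def in_keys_iff sum.delta)

lemma ideal_sum:
  assumes "ideal J (poly_ring r)" "finite M" "\<And>m. m \<in> M \<Longrightarrow> g m \<in> J"
  shows "(\<Sum>m\<in>M. g m) \<in> J"
proof -
  interpret ideal J "poly_ring r" by (rule assms(1))
  show ?thesis using assms(2,3)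
  proof (induction M rule: finite_induct)
    case empty
    then show ?case using additive_subgroup.zero_closed[OF is_additive_subgroup] by simp
  next
    case (insert x F)
    then show ?case using additive_subgroup.a_closed[OF is_additive_subgroup, of "g x" "sum g F"]
      by simp
  qed
qed

lemma genideal_monom:
  assumes A: "A \<subseteq> exponents r"
  shows "Idl\<^bsub>poly_ring r\<^esub> (monom ` A :: ((nat \<Rightarrow>\<^sub>0 nat) \<Rightarrow>\<^sub>0 'k :: field_char_0) set) =
    {f. Poly_Mapping.keys f \<subseteq> exponents r \<and> (\<forall>m\<in>Poly_Mapping.keys f. \<exists>a\<in>A. divides_exp a m)}"
    (is "?L = ?R")
proof
  interpret R: cring "poly_ring r :: ((nat \<Rightarrow>\<^sub>0 nat) \<Rightarrow>\<^sub>0 'k) ring" by (rule cring_poly_ring)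
  have mult_R: "x * f \<in> ?R" if f: "f \<in> ?R" and x: "Poly_Mapping.keys x \<subseteq> exponents r" for f x
  proof -
    have "\<exists>a\<in>A. divides_exp a m" if m: "m \<in> Poly_Mapping.keys (x * f)" for m
    proof -
      from m obtain b c where bc: "m = b + c" "c \<in> Poly_Mapping.keys f"
        using Poly_Mapping.keys_mult[of x f] by blast
      then obtain a where "a \<in> A" "divides_exp a c" using f by blast
      then show ?thesis using bc divides_exp_trans[of a c m]
        by (metis add.commute divides_exp_def)
    qed
    then show ?thesis using f x keys_times_exponents[of x r f] by blast
  qed
  have sub: "additive_subgroup ?R (poly_ring r)"
  proof (rule additive_subgroup.intro, rule group.subgroupI)
    show "group (add_monoid (poly_ring r :: ((nat \<Rightarrow>\<^sub>0 nat) \<Rightarrow>\<^sub>0 'k) ring))"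
      by (rule R.a_group)
    show "inv\<^bsub>add_monoid (poly_ring r)\<^esub> f \<in> ?R" if f: "f \<in> ?R" for f
    proof -
      have "inv\<^bsub>add_monoid (poly_ring r)\<^esub> f = - f"
        using f by (intro R.add.inv_equality[unfolded a_inv_def]) auto
      then show ?thesis using f by simp
    qed
    show "f \<otimes>\<^bsub>add_monoid (poly_ring r)\<^esub> g \<in> ?R" if "f \<in> ?R" "g \<in> ?R" for f g
      using that Poly_Mapping.keys_add[of f g] by fastforce
  qed (auto intro: exI[of _ 0])
  have "ideal ?R (poly_ring r)"
    using sub mult_R by (intro idealI R.ring_axioms)
      (auto simp: mult.commute additive_subgroup_def)
  moreover have "monom ` A \<subseteq> ?R"
    using A by (auto simp: monom_def intro: divides_exp_refl)
  ultimately show "?L \<subseteq> ?R" by (intro R.genideal_minimal)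
next
  show "?R \<subseteq> ?L"
  proof
    fix f :: "(nat \<Rightarrow>\<^sub>0 nat) \<Rightarrow>\<^sub>0 'k"
    assume f: "f \<in> ?R"
    show "f \<in> ?L" unfolding genideal_def
    proof (rule InterI, clarify)
      fix J assume J: "ideal J (poly_ring r)" "monom ` A \<subseteq> (J :: ((nat \<Rightarrow>\<^sub>0 nat) \<Rightarrow>\<^sub>0 'k) set)"
      interpret ideal J "poly_ring r" by (rule J)
      have "Poly_Mapping.single m (Poly_Mapping.lookup f m) \<in> J" if m: "m \<in> Poly_Mapping.keys f" for m
      proof -
        obtain a where a: "a \<in> A" "divides_exp a m" using f m by blast
        have "m \<in> exponents r" using f m by blast
        then have c: "m - a \<in> exponents r" by (rule exponents_diff)
        have "Poly_Mapping.single m (Poly_Mapping.lookup f m)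
            = Poly_Mapping.single (m - a) (Poly_Mapping.lookup f m) * monom a"
          using divides_exp_diff[OF a(2)] by (simp add: monom_def mult_single)
        also have "\<dots> \<in> J"
          using I_l_closed[of "monom a" "Poly_Mapping.single (m - a) (Poly_Mapping.lookup f m)"] J(2) a(1) c
          by auto
        finally show ?thesis .
      qed
      then have "(\<Sum>m\<in>Poly_Mapping.keys f. Poly_Mapping.single m (Poly_Mapping.lookup f m)) \<in> J"
        by (intro ideal_sum[OF J(1)]) auto
      then show "f \<in> J" using poly_as_sum[of f] by simp
    qed
  qed
qed

definition min_exps :: "(nat \<Rightarrow>\<^sub>0 nat) set \<Rightarrow> (nat \<Rightarrow>\<^sub>0 nat) set" where
  "min_exps A = {a \<in> A. \<forall>b\<in>A. divides_exp b a \<longrightarrow> b = a}"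

lemma min_exps_below:
  assumes "a \<in> A"
  shows "\<exists>b\<in>min_exps A. divides_exp b a"
  using assms
proof (induction "\<Sum>i\<in>Poly_Mapping.keys a. Poly_Mapping.lookup a i" arbitrary: a rule: less_induct)
  case less
  show ?case
  proof (cases "a \<in> min_exps A")
    case True
    then show ?thesis using divides_exp_refl by blast
  next
    case False
    then obtain b where b: "b \<in> A" "divides_exp b a" "b \<noteq> a"
      using less.prems by (auto simp: min_exps_def)
    then obtain c where c: "a = b + c" by (auto simp: divides_exp_def)
    have deg: "(\<Sum>i\<in>Poly_Mapping.keys x. Poly_Mapping.lookup x i)
        = (\<Sum>i\<in>Poly_Mapping.keys a \<union> Poly_Mapping.keys b \<union> Poly_Mapping.keys c. Poly_Mapping.lookup x i)"
      if "x \<in> {a, b, c}" for x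
      using that by (intro sum.mono_neutral_left) (auto simp: in_keys_iff)
    have "c \<noteq> 0" using b c by auto
    then obtain i where "i \<in> Poly_Mapping.keys c" by fastforce
    then have "(\<Sum>i\<in>Poly_Mapping.keys c. Poly_Mapping.lookup c i) > 0"
      by (intro sum_pos2[of _ i]) (auto simp: in_keys_iff)
    moreover have "(\<Sum>i\<in>Poly_Mapping.keys a. Poly_Mapping.lookup a i) =
        (\<Sum>i\<in>Poly_Mapping.keys b. Poly_Mapping.lookup b i) +
        (\<Sum>i\<in>Poly_Mapping.keys c. Poly_Mapping.lookup c i)"
      unfolding deg[of a, simplified] deg[of b, simplified] deg[of c, simplified]
      by (subst sum.distrib[symmetric]) (simp add: c lookup_add)
    ultimately obtain d where "d \<in> min_exps A" "divides_exp d b"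
      using less.hyps[OF _ b(1)] by auto
    then show ?thesis using b(2) divides_exp_trans by blast
  qed
qed

lemma genideal_monom_eq_iff:
  assumes "A \<subseteq> exponents r" "B \<subseteq> exponents r"
  shows "Idl\<^bsub>poly_ring r\<^esub> (monom ` A) =
      Idl\<^bsub>poly_ring r\<^esub> (monom ` B :: ((nat \<Rightarrow>\<^sub>0 nat) \<Rightarrow>\<^sub>0 'k :: field_char_0) set) \<longleftrightarrow>
    (\<forall>a\<in>A. \<exists>b\<in>B. divides_exp b a) \<and> (\<forall>b\<in>B. \<exists>a\<in>A. divides_exp a b)"
    (is "?L \<longleftrightarrow> ?R")
proof
  assume eq: ?L
  have "(monom a :: (nat \<Rightarrow>\<^sub>0 nat) \<Rightarrow>\<^sub>0 'k) \<in> Idl\<^bsub>poly_ring r\<^esub> (monom ` A)" if "a \<in> A" for a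
    using that assms divides_exp_refl unfolding genideal_monom[OF assms(1)] by (auto simp: monom_def)
  moreover have "(monom a :: (nat \<Rightarrow>\<^sub>0 nat) \<Rightarrow>\<^sub>0 'k) \<in> Idl\<^bsub>poly_ring r\<^esub> (monom ` B)" if "a \<in> B" for a
    using that assms divides_exp_refl unfolding genideal_monom[OF assms(2)] by (auto simp: monom_def)
  ultimately have "\<forall>a\<in>A. (monom a :: (nat \<Rightarrow>\<^sub>0 nat) \<Rightarrow>\<^sub>0 'k) \<in> Idl\<^bsub>poly_ring r\<^esub> (monom ` B)"
    "\<forall>a\<in>B. (monom a :: (nat \<Rightarrow>\<^sub>0 nat) \<Rightarrow>\<^sub>0 'k) \<in> Idl\<^bsub>poly_ring r\<^esub> (monom ` A)"
    using eq by auto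
  then show ?R
    unfolding genideal_monom[OF assms(1)] genideal_monom[OF assms(2)] by (auto simp: monom_def)
next
  assume ?R
  then show ?L
    unfolding genideal_monom[OF assms(1)] genideal_monom[OF assms(2)]
    by (intro Collect_cong) (meson divides_exp_trans)
qed

lemma is_min_monomial_gens_iff:
  fixes G :: "((nat \<Rightarrow>\<^sub>0 nat) \<Rightarrow>\<^sub>0 'k :: field_char_0) set"
  assumes A: "A \<subseteq> exponents r"
  shows "is_min_monomial_gens r (Idl\<^bsub>poly_ring r\<^esub> (monom ` A)) G \<longleftrightarrow> G = monom ` min_exps A"
proof
  assume "is_min_monomial_gens r (Idl\<^bsub>poly_ring r\<^esub> (monom ` A)) G"
  then obtain B where B: "B \<subseteq> exponents r" "G = monom ` B"
    and eq: "Idl\<^bsub>poly_ring r\<^esub> G = Idl\<^bsub>poly_ring r\<^esub> (monom ` A)"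
    and least: "\<And>G'. G' \<subset> G \<Longrightarrow> Idl\<^bsub>poly_ring r\<^esub> G' \<noteq> Idl\<^bsub>poly_ring r\<^esub> (monom ` A)"
    unfolding is_min_monomial_gens_def monomials_def by (metis subset_imageE)
  have cov: "\<forall>a\<in>B. \<exists>b\<in>A. divides_exp b a" "\<forall>a\<in>A. \<exists>b\<in>B. divides_exp b a"
    using eq unfolding B(2) genideal_monom_eq_iff[OF B(1) A] by auto
  have M: "min_exps A \<subseteq> B"
    using cov unfolding min_exps_def by (fastforce dest: divides_exp_trans divides_exp_antisym)
  have "min_exps A \<subseteq> exponents r" using A by (auto simp: min_exps_def)
  from genideal_monom_eq_iff[OF this A, where 'k = 'k]
  have "Idl\<^bsub>poly_ring r\<^esub> (monom ` min_exps A :: ((nat \<Rightarrow>\<^sub>0 nat) \<Rightarrow>\<^sub>0 'k) set)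
      = Idl\<^bsub>poly_ring r\<^esub> (monom ` A)"
    using min_exps_below[of _ A] divides_exp_refl by (auto simp: min_exps_def)
  with least[of "monom ` min_exps A"] M B(2) show "G = monom ` min_exps A" by blast
next
  assume G: "G = monom ` min_exps A"
  have ME: "min_exps A \<subseteq> exponents r" using A by (auto simp: min_exps_def)
  have gen: "Idl\<^bsub>poly_ring r\<^esub> G = Idl\<^bsub>poly_ring r\<^esub> (monom ` A)"
    unfolding G genideal_monom_eq_iff[OF ME A]
    using min_exps_below[of _ A] divides_exp_refl by (auto simp: min_exps_def)
  have False if G': "G' \<subset> G" "Idl\<^bsub>poly_ring r\<^esub> G' = Idl\<^bsub>poly_ring r\<^esub> (monom ` A)" for G'
  proof -
    from G' G obtain B where B: "B \<subseteq> min_exps A" "G' = monom ` B"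
      by (metis psubset_imp_subset subset_imageE)
    have BE: "B \<subseteq> exponents r" using B(1) ME by blast
    have "\<forall>a\<in>A. \<exists>b\<in>B. divides_exp b a"
      using G'(2) unfolding B(2) genideal_monom_eq_iff[OF BE A] by auto
    then have "min_exps A \<subseteq> B" using B(1) unfolding min_exps_def by fastforce
    then show False using B G G'(1) by blast
  qed
  then show "is_min_monomial_gens r (Idl\<^bsub>poly_ring r\<^esub> (monom ` A)) G"
    using gen ME G unfolding is_min_monomial_gens_def monomials_def by blast
qed

lemma min_monomial_gens_eq:
  assumes "A \<subseteq> exponents r"
  shows "min_monomial_gens r (Idl\<^bsub>poly_ring r\<^esub> (monom ` A)) =
    (monom ` min_exps A :: ((nat \<Rightarrow>\<^sub>0 nat) \<Rightarrow>\<^sub>0 'k :: field_char_0) set)"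
  unfolding min_monomial_gens_def
  by (rule the_equality) (simp_all only: is_min_monomial_gens_iff[OF assms])

end

theory Submission
  imports
    "HOL-Probability.Probability"
    "HOL-Number_Theory.Prime_Powers"
    "HOL-Real_Asymp.Real_Asymp"
    Defs
begin

text \<open>
  An element of the minimal generating set corresponds to an integer \<open>p x > n\<close> with \<open>x \<le> n\<close> and \<open>p \<le> lpf x\<close>,
  which gives the formula for \<open>S(n)\<close> as a sum over composite numbers. The composites with at least three
  prime factors contribute at most \<open>n powr (4/3)\<close>, and
  \<open>S\<^sub>2(n)\<close> is the sum of \<open>(\<pi>(p) - 1) (\<pi>(n / p) - \<pi>(p) + 1)\<close> over the primes \<open>p \<le> sqrt n\<close>, which is dominated by
  the \<open>p\<close> close to \<open>sqrt n\<close>. What is needed is therefore the prime number theorem in the form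
  \<open>\<pi>(x) = x / ln x (1 + O(1 / sqrt (ln x)))\<close>.

  This form follows from bounds that are uniform for \<open>Re s > 1\<close>, without analytic continuation. The series
  \<open>F(s)\<close> with coefficients \<open>(\<Lambda>(n) - 1) ln n\<close> equals \<open>\<zeta>''/\<zeta> - (\<zeta>'/\<zeta>)\<^sup>2 + \<zeta>'\<close>. Comparing sums with integrals bounds \<open>\<zeta>\<close> and its
  derivatives by small powers of \<open>|t|\<close>, the 3-4-1 inequality does so for \<open>1/\<zeta>\<close>, and
  the poles at \<open>1\<close> cancel, whence \<open>F(\<sigma> + i t) = O(sqrt (1 + |t|))\<close>. Levy's inversion formula for the exponential
  distribution of rate \<open>\<sigma> = 1 + 1 / ln x\<close> turns this into a bound for the sum of \<open>(\<Lambda>(n) - 1) ln n\<close> over \<open>n \<le> x\<close>,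
  smoothed at the edge.
\<close>

subsection \<open>Dirichlet series\<close>

text \<open>The Fourier bound is taken with absolute values inside the integral, at
  \<open>\<sigma> = 1 + 1 / ln x\<close>, where \<open>x powr \<sigma>\<close> is just
  \<open>e\<close> times \<open>x\<close>. It yields a multiple of \<open>x / h\<close> and no decay
  at all. For the coefficients \<open>\<Lambda>(n) - 1\<close> alone this would not beat the size
  \<open>x\<close> of the main term. The extra factor \<open>ln n\<close> lifts the main term to
  \<open>x ln x\<close> and leaves the bound at \<open>x / h\<close>, and this one logarithm is the
  whole gain; smoothing at the edge then costs half of it. The price of the factor is a second
  derivative and a squared quotient, whose poles at \<open>1\<close> must be removed before anything
  uniform in \<open>\<sigma>\<close> can hold. In the imaginary direction a crude bound is enough:
  the inversion kernel and the characteristic function decay like \<open>1 / |t|\<close> each, so a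
  growth of \<open>sqrt |t|\<close> still leaves an integrable function. Hence the large powers lost
  in the 3-4-1 argument do no harm once zeta itself is bounded by a sufficiently small power of
  \<open>|t|\<close>.\<close>

text \<open>
  The term \<open>n\<^sup>-\<^sup>s\<close>. It has the junk value \<open>1\<close> at \<open>n = 0\<close>, so all series range over \<open>{1..}\<close>.
\<close>

definition dterm :: "complex \<Rightarrow> nat \<Rightarrow> complex" where
  "dterm s n = exp (- s * of_real (ln (real n)))"

text \<open>With unordered sums, summability over the complex numbers is absolute, so products of
  series can be regrouped along divisors.\<close>

definition dser :: "(nat \<Rightarrow> real) \<Rightarrow> complex \<Rightarrow> complex" where
  "dser f s = (\<Sum>\<^sub>\<infinity>n\<in>{1..}. of_real (f n) * dterm s n)"

definition dconv :: "(nat \<Rightarrow> real) \<Rightarrow> complex \<Rightarrow> bool" where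
  "dconv f s \<longleftrightarrow> (\<lambda>n. of_real (f n) * dterm s n) summable_on {1..}"

lemma dterm_mult: "m \<ge> 1 \<Longrightarrow> n \<ge> 1 \<Longrightarrow> dterm s (m * n) = dterm s m * dterm s n"
  by (simp add: dterm_def ln_mult exp_add[symmetric] algebra_simps)

lemma norm_dterm: "n \<ge> 1 \<Longrightarrow> norm (dterm s n) = real n powr (- Re s)"
  by (simp add: dterm_def powr_def)

lemma dterm_one [simp]: "dterm s 1 = 1" "dterm s (Suc 0) = 1"
  by (simp_all add: dterm_def)

lemma summable_log_power:
  fixes \<sigma> :: real
  assumes "\<sigma> > 1"
  shows "summable (\<lambda>n. ln (real n) ^ k * real n powr (- \<sigma>))"
proof (rule summable_comparison_test_bigo)
  show "summable (\<lambda>n. norm (real n powr (- ((1 + \<sigma>) / 2))))"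
    using assms by (simp add: summable_real_powr_iff)
  \<comment> \<open>Half of the excess \<open>\<sigma> - 1\<close> pays for the power of the
    logarithm, the other half keeps the exponent below \<open>-1\<close>.\<close>
  define \<delta> where "\<delta> = (\<sigma> - 1) / 2"
  have d: "\<delta> > 0" "- \<sigma> = - ((1 + \<sigma>) / 2) - \<delta>" using assms by (simp_all add: \<delta>_def field_simps)
  have "(\<lambda>n. ln (real n) ^ k) \<in> O(\<lambda>n. real n powr \<delta>)" using d(1) by real_asymp
  then have "(\<lambda>n. ln (real n) ^ k * real n powr (- \<sigma>)) \<in> O(\<lambda>n. real n powr \<delta> * real n powr (- \<sigma>))"
    by (rule landau_o.big.mult_right)
  also have "(\<lambda>n. real n powr \<delta> * real n powr (- \<sigma>)) = (\<lambda>n. real n powr (- ((1 + \<sigma>) / 2)))"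
    by (simp add: powr_add[symmetric] d(2))
  finally show "(\<lambda>n. ln (real n) ^ k * real n powr (- \<sigma>)) \<in> O(\<lambda>n. real n powr (- ((1 + \<sigma>) / 2)))" .
qed

lemma summable_on_log_power:
  assumes "\<sigma> > (1 :: real)"
  shows "(\<lambda>n. ln (real n) ^ k * real n powr (- \<sigma>)) summable_on {1..}"
proof -
  have "(\<lambda>n. ln (real n) ^ k * real n powr (- \<sigma>)) summable_on UNIV"
  proof (subst summable_on_UNIV_nonneg_real_iff)
    show "0 \<le> ln (real n) ^ k * real n powr (- \<sigma>)" for n
      by (cases "n = 0") auto
  qed (rule summable_log_power[OF assms])
  then show ?thesis by (rule summable_on_subset_banach) auto
qed

lemma dconv_bound:
  assumes "Re s > 1" "\<And>n. n \<ge> 1 \<Longrightarrow> \<bar>f n\<bar> \<le> ln (real n) ^ k"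
  shows "dconv f s"
  unfolding dconv_def
proof (rule abs_summable_summable, rule Infinite_Sum.abs_summable_on_comparison_test'[OF summable_on_log_power[OF assms(1), of k]])
  fix n :: nat assume "n \<in> {1..}"
  then show "norm (of_real (f n) * dterm s n) \<le> ln (real n) ^ k * real n powr - Re s"
    using assms(2)[of n] by (auto simp: norm_mult norm_dterm intro!: mult_right_mono)
qed

lemma dser_diff:
  assumes "dconv f s" "dconv g s"
  shows "dser (\<lambda>n. f n - g n) s = dser f s - dser g s"
proof -
  from has_sum_add[OF has_sum_infsum[OF assms(1)[unfolded dconv_def]]
      has_sum_uminusI[OF has_sum_infsum[OF assms(2)[unfolded dconv_def]]]]
  show ?thesis unfolding dser_def by (intro infsumI) (simp add: left_diff_distrib)
qed

lemma dser_add: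
  assumes "dconv f s" "dconv g s"
  shows "dser (\<lambda>n. f n + g n) s = dser f s + dser g s"
  using assms unfolding dconv_def dser_def
  by (subst infsum_add[symmetric]) (simp_all add: algebra_simps)

text \<open>Dirichlet convolution: the absolutely summable family over pairs \<open>(x, y)\<close>
  is regrouped by \<open>(n, d) = (x * y, x)\<close>, where \<open>d\<close> runs through the
  divisors of \<open>n\<close>. Convergence is recorded as well so that two such products can be
  added.\<close>

lemma dser_mult:
  assumes f: "dconv f s" and g: "dconv g s"
  shows "dser f s * dser g s = dser (\<lambda>n. \<Sum>d | d dvd n. f d * g (n div d)) s"
    and "dconv (\<lambda>n. \<Sum>d | d dvd n. f d * g (n div d)) s"
proof -
  let ?F = "\<lambda>n. of_real (f n) * dterm s n" and ?G = "\<lambda>n. of_real (g n) * dterm s n"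
  have F: "(?F has_sum dser f s) {1..}" "(\<lambda>n. norm (?F n)) summable_on {1..}"
    using f unfolding dconv_def dser_def by (simp_all add: summable_on_iff_abs_summable_on_complex[symmetric])
  have G: "(?G has_sum dser g s) {1..}" "(\<lambda>n. norm (?G n)) summable_on {1..}"
    using g unfolding dconv_def dser_def by (simp_all add: summable_on_iff_abs_summable_on_complex[symmetric])
  have "(\<lambda>(x, y). ?F x * ?G y) summable_on {1..} \<times> {1..}"
  proof (rule abs_summable_summable, subst Infinite_Sum.abs_summable_on_Sigma_iff, intro conjI ballI)
    fix x :: nat
    show "(\<lambda>y. norm (case (x, y) of (x, y) \<Rightarrow> ?F x * ?G y)) summable_on {1..}"
      using summable_on_cmult_right[OF G(2), of "norm (?F x)"] by (simp add: norm_mult)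
  next
    have "(\<lambda>x. \<Sum>\<^sub>\<infinity>y\<in>{1..}. norm (?F x * ?G y)) = (\<lambda>x. norm (?F x) * (\<Sum>\<^sub>\<infinity>y\<in>{1..}. norm (?G y)))"
      unfolding norm_mult[of "?F x" for x] by (subst infsum_cmult_right') simp
    moreover have "(\<lambda>x. norm (?F x) * (\<Sum>\<^sub>\<infinity>y\<in>{1..}. norm (?G y))) summable_on {1..}"
      by (rule summable_on_cmult_left[OF F(2)])
    ultimately have "(\<lambda>x. \<Sum>\<^sub>\<infinity>y\<in>{1..}. norm (?F x * ?G y)) summable_on {1..}"
      by (simp only:)
    moreover have "norm (\<Sum>\<^sub>\<infinity>y\<in>{1..}. norm (?F x * ?G y)) = (\<Sum>\<^sub>\<infinity>y\<in>{1..}. norm (?F x * ?G y))" for x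
      unfolding real_norm_def by (intro abs_of_nonneg infsum_nonneg) simp
    ultimately show "(\<lambda>x. norm (\<Sum>\<^sub>\<infinity>y\<in>{1..}. norm (case (x, y) of (x, y) \<Rightarrow> ?F x * ?G y))) summable_on {1..}"
      by (simp only: prod.case)
  qed
  then have "((\<lambda>(x, y). ?F x * ?G y) has_sum (dser f s * dser g s)) ({1..} \<times> {1..})"
    by (rule has_sum_SigmaI[rotated 2, where g = "\<lambda>x. ?F x * dser g s"])
      (use F(1) G(1) in \<open>auto intro!: has_sum_cmult_right has_sum_cmult_left\<close>)
  also have "?this \<longleftrightarrow> ((\<lambda>(n, d). of_real (f d * g (n div d)) * dterm s n) has_sum (dser f s * dser g s))
      (SIGMA n:{1..}. {d. d dvd n})"
    by (rule has_sum_reindex_bij_witness[of _ "\<lambda>(n, d). (d, n div d)" "\<lambda>(x, y). (x * y, x)"])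
      (auto simp: dterm_mult elim!: dvdE)
  finally have "((\<lambda>n. \<Sum>d | d dvd n. of_real (f d * g (n div d)) * dterm s n) has_sum (dser f s * dser g s)) {1..}"
    by (rule has_sum_SigmaD) (auto intro!: has_sum_finite finite_divisors_nat)
  also have "(\<lambda>n. \<Sum>d | d dvd n. of_real (f d * g (n div d)) * dterm s n)
      = (\<lambda>n. of_real (\<Sum>d | d dvd n. f d * g (n div d)) * dterm s n)"
    by (simp add: sum_distrib_right)
  finally show "dser f s * dser g s = dser (\<lambda>n. \<Sum>d | d dvd n. f d * g (n div d)) s"
      "dconv (\<lambda>n. \<Sum>d | d dvd n. f d * g (n div d)) s"
    unfolding dser_def dconv_def by (auto simp: infsumI has_sum_imp_summable)
qed

text \<open>This is \<open>(-1)^k\<close> times the \<open>k\<close>-th derivative of zeta; in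
  particular \<open>zlog 1\<close> is \<open>- \<zeta>'\<close>, which explains the signs
  below.\<close>

abbreviation zlog :: "nat \<Rightarrow> complex \<Rightarrow> complex" where
  "zlog k \<equiv> dser (\<lambda>n. ln (real n) ^ k)"

lemma dconv_log: "Re s > 1 \<Longrightarrow> dconv (\<lambda>n. ln (real n) ^ k) s"
  by (rule dconv_bound[where k = k]) auto

lemma dconv_mangoldt: "Re s > 1 \<Longrightarrow> dconv mangoldt s"
  by (rule dconv_bound[where k = 1]) (auto simp: mangoldt_le)

lemma dconv_mangoldt_log: "Re s > 1 \<Longrightarrow> dconv (\<lambda>n. mangoldt n * ln (real n)) s"
  by (rule dconv_bound[where k = 2])
    (auto simp: mangoldt_le power2_eq_square abs_mult intro!: mult_right_mono)

lemma dser_cong: "(\<And>n. n \<ge> 1 \<Longrightarrow> f n = g n) \<Longrightarrow> dser f s = dser g s"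
  unfolding dser_def by (intro infsum_cong) auto

text \<open>Both identities are checked coefficient by coefficient. The first is the divisor sum of
  \<open>mangoldt\<close> being \<open>ln n\<close>; multiplying that by
  \<open>ln n = ln d + ln (n / d)\<close> gives the second, which takes the place of differentiating
  the first.\<close>

lemma zlog_mangoldt:
  assumes s: "Re s > 1"
  shows "dser mangoldt s * zlog 0 s = zlog 1 s"
    and "dser (\<lambda>n. mangoldt n * ln (real n)) s * zlog 0 s + dser mangoldt s * zlog 1 s = zlog 2 s"
proof -
  show "dser mangoldt s * zlog 0 s = zlog 1 s"
    unfolding dser_mult(1)[OF dconv_mangoldt[OF s] dconv_log[OF s, of 0]]
    by (rule dser_cong) (simp add: mangoldt_sum)
  note m = dser_mult[OF dconv_mangoldt_log[OF s] dconv_log[OF s, of 0]]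
    dser_mult[OF dconv_mangoldt[OF s] dconv_log[OF s, of 1]]
  show "dser (\<lambda>n. mangoldt n * ln (real n)) s * zlog 0 s + dser mangoldt s * zlog 1 s = zlog 2 s"
    unfolding m(1) m(3) dser_add[OF m(2) m(4), symmetric]
  proof (rule dser_cong)
    fix n :: nat assume n: "n \<ge> 1"
    have "(\<Sum>d | d dvd n. mangoldt d * ln (real d) * ln (real (n div d)) ^ 0) +
        (\<Sum>d | d dvd n. mangoldt d * ln (real (n div d)) ^ 1) = (\<Sum>d | d dvd n. mangoldt d * ln (real n))"
      unfolding sum.distrib[symmetric]
    proof (rule sum.cong)
      fix d assume "d \<in> {d. d dvd n}"
      then obtain e where "n = d * e" by auto
      then show "mangoldt d * ln (real d) * ln (real (n div d)) ^ 0 + mangoldt d * ln (real (n div d)) ^ 1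
          = mangoldt d * ln (real n)"
        using n by (simp add: ln_mult algebra_simps)
    qed simp
    also have "\<dots> = ln (real n) ^ 2"
      using n by (simp add: sum_distrib_right[symmetric] mangoldt_sum power2_eq_square)
    finally show "(\<Sum>d | d dvd n. mangoldt d * ln (real d) * ln (real (n div d)) ^ 0) +
        (\<Sum>d | d dvd n. mangoldt d * ln (real (n div d)) ^ 1) = ln (real n) ^ 2" .
  qed
qed

subsection \<open>Euler product and the 3-4-1 inequality\<close>

text \<open>After taking logarithms, \<open>ln (norm (1 - q * cis \<phi>))\<close> is minus the sum
  of \<open>q^n cos (n \<phi>) / n\<close>, and the combination is nonpositive term by term because
  \<open>3 + 4 c + (2 c^2 - 1) = 2 (1 + c)^2\<close> for
  \<open>c = cos (n \<theta>)\<close>.\<close>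

lemma zeta_mertens_factor:
  fixes q \<theta> :: real
  assumes "0 \<le> q" "q < 1"
  shows "(1 - q) ^ 3 * norm (1 - of_real q * cis \<theta>) ^ 4 * norm (1 - of_real q * cis (2 * \<theta>)) \<le> 1"
proof -
  have S: "(\<lambda>n. - (q ^ n * cos (real n * \<phi>) / real n)) sums ln (norm (1 - of_real q * cis \<phi>))"
    and nz: "norm (1 - of_real q * cis \<phi>) > 0" for \<phi>
  proof -
    have n: "norm (- (of_real q * cis \<phi>)) < 1" using assms by (simp add: norm_mult)
    then have "1 - of_real q * cis \<phi> \<noteq> 0"
      by (metis eq_iff_diff_eq_0 less_irrefl norm_minus_cancel norm_one)
    then show "norm (1 - of_real q * cis \<phi>) > 0" by simp
    \<comment> \<open>The series is indexed from \<open>0\<close>; its first term vanishes since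
      division by zero gives zero.\<close>
    have "(\<lambda>n. - ((of_real q * cis \<phi>) ^ n) / of_nat n) sums ln (1 - of_real q * cis \<phi>)"
      using Ln_series'[OF n] by simp
    then have "(\<lambda>n. Re (- ((of_real q * cis \<phi>) ^ n) / of_nat n)) sums Re (ln (1 - of_real q * cis \<phi>))"
      by (rule sums_Re)
    also have "Re (ln (1 - of_real q * cis \<phi>)) = ln (norm (1 - of_real q * cis \<phi>))"
      using \<open>1 - of_real q * cis \<phi> \<noteq> 0\<close> by simp
    also have "(\<lambda>n. Re (- ((of_real q * cis \<phi>) ^ n) / of_nat n)) = (\<lambda>n. - (q ^ n * cos (real n * \<phi>) / real n))"
      by (simp add: power_mult_distrib Complex.DeMoivre flip: of_real_power)
    finally show "(\<lambda>n. - (q ^ n * cos (real n * \<phi>) / real n)) sums ln (norm (1 - of_real q * cis \<phi>))" .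
  qed
  have S0: "(\<lambda>n. - (q ^ n / real n)) sums ln (1 - q)"
  proof -
    have "norm (1 - complex_of_real q) = norm (complex_of_real (1 - q))" by simp
    also have "\<dots> = 1 - q" using assms by (subst norm_of_real) simp
    finally show ?thesis using S[of 0] by simp
  qed
  have S1: "(\<lambda>n. 3 * - (q ^ n / real n) + 4 * - (q ^ n * cos (real n * \<theta>) / real n)
      + - (q ^ n * cos (real n * (2 * \<theta>)) / real n)) sums
      (3 * ln (1 - q) + 4 * ln (norm (1 - of_real q * cis \<theta>)) + ln (norm (1 - of_real q * cis (2 * \<theta>))))"
    by (intro sums_add sums_mult S S0)
  have neg: "3 * - (q ^ n / real n) + 4 * - (q ^ n * cos (real n * \<theta>) / real n)
      + - (q ^ n * cos (real n * (2 * \<theta>)) / real n) \<le> 0" for n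
  proof -
    define a where "a = q ^ n / real n"
    define c where "c = cos (real n * \<theta>)"
    have c2: "cos (real n * (2 * \<theta>)) = 2 * c ^ 2 - 1"
      using cos_double_cos[of "real n * \<theta>"] by (simp add: mult_ac c_def)
    have "3 * - (q ^ n / real n) + 4 * - (q ^ n * cos (real n * \<theta>) / real n)
      + - (q ^ n * cos (real n * (2 * \<theta>)) / real n) = 3 * - a + 4 * - (a * c) + - (a * (2 * c ^ 2 - 1))"
      unfolding c2 unfolding a_def c_def by simp
    also have "\<dots> = - (2 * a * (1 + c) ^ 2)"
      by (simp add: algebra_simps power2_eq_square)
    also have "\<dots> \<le> 0" using assms by (simp add: a_def)
    finally show ?thesis .
  qed
  have le: "3 * ln (1 - q) + 4 * ln (norm (1 - of_real q * cis \<theta>)) + ln (norm (1 - of_real q * cis (2 * \<theta>))) \<le> 0"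
    by (rule sums_le[OF neg S1 sums_zero])
  have T: "3 * ln x + 4 * ln y + ln z \<le> 0 \<longleftrightarrow> x ^ 3 * y ^ 4 * z \<le> 1" if "x > 0" "y > 0" "z > 0" for x y z :: real
  proof -
    have "ln (x ^ 3 * y ^ 4 * z) = 3 * ln x + 4 * ln y + ln z"
      using that by (simp add: ln_mult ln_realpow)
    moreover have "ln (x ^ 3 * y ^ 4 * z) \<le> 0 \<longleftrightarrow> x ^ 3 * y ^ 4 * z \<le> 1"
      using that by (intro ln_le_zero_iff) auto
    ultimately show ?thesis by simp
  qed
  show ?thesis
    using le T[of "1 - q" "norm (1 - of_real q * cis \<theta>)" "norm (1 - of_real q * cis (2 * \<theta>))"]
      nz[of \<theta>] nz[of "2 * \<theta>"] assms by argo
qed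

text \<open>Every \<open>n\<close> with \<open>2 \<le> n \<le> k\<close> has a prime factor at most
  \<open>k\<close>, so apart from \<open>1\<close> the set \<open>A k\<close> lies in the tail
  \<open>n > k\<close> of an absolutely convergent series.\<close>

lemma dser_restrict_tendsto:
  assumes s: "Re s > 1"
  defines "A \<equiv> \<lambda>k. {n::nat. n \<ge> 1 \<and> (\<forall>p. prime p \<and> p \<le> k \<longrightarrow> \<not> p dvd n)}"
  shows "(\<lambda>k. \<Sum>\<^sub>\<infinity>n\<in>A k. dterm s n) \<longlonglongrightarrow> 1"
proof -
  have summ: "(\<lambda>n. dterm s n) summable_on {1..}"
    using dconv_log[OF s, of 0] by (simp add: dconv_def)
  then have nsum: "(\<lambda>n. norm (dterm s n)) summable_on {1..}"
    by (simp only: summable_on_iff_abs_summable_on_complex)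
  have sub: "A k \<subseteq> {1..}" for k by (auto simp: A_def)
  have one: "1 \<in> A k" for k by (auto simp: A_def)
  have tail: "A k - {1} \<subseteq> {Suc k..}" for k
  proof
    fix n assume n: "n \<in> A k - {1}"
    show "n \<in> {Suc k..}"
    proof (rule ccontr)
      assume "n \<notin> {Suc k..}"
      then have "n \<le> k" by simp
      moreover obtain p where "prime p" "p dvd n" using n prime_factor_nat[of n] by auto
      moreover have "p \<le> n" using \<open>p dvd n\<close> n by (intro dvd_imp_le) (auto simp: A_def)
      ultimately show False using n by (auto simp: A_def)
    qed
  qed
  have bd: "norm ((\<Sum>\<^sub>\<infinity>n\<in>A k. dterm s n) - 1) \<le> (\<Sum>\<^sub>\<infinity>n\<in>{1..}. norm (dterm s n)) - (\<Sum>n\<in>{1..k}. norm (dterm s n))" for k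
  proof -
    have "(\<Sum>\<^sub>\<infinity>n\<in>A k. dterm s n) = (\<Sum>\<^sub>\<infinity>n\<in>A k - {1}. dterm s n) + dterm s 1"
    proof -
      have "A k = (A k - {1}) \<union> {1}" using one by auto
      then have "(\<Sum>\<^sub>\<infinity>n\<in>A k. dterm s n) = (\<Sum>\<^sub>\<infinity>n\<in>(A k - {1}) \<union> {1}. dterm s n)" by simp
      also have "\<dots> = (\<Sum>\<^sub>\<infinity>n\<in>A k - {1}. dterm s n) + (\<Sum>\<^sub>\<infinity>n\<in>{1}. dterm s n)"
        by (rule infsum_Un_disjoint) (use summable_on_subset_banach[OF summ, of "A k - {1}"] sub in auto)
      finally show ?thesis by simp
    qed
    then have "norm ((\<Sum>\<^sub>\<infinity>n\<in>A k. dterm s n) - 1) = norm (\<Sum>\<^sub>\<infinity>n\<in>A k - {1}. dterm s n)" by simp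
    also have "\<dots> \<le> (\<Sum>\<^sub>\<infinity>n\<in>A k - {1}. norm (dterm s n))"
      by (rule norm_infsum_bound, rule summable_on_subset_banach[OF nsum]) (use sub in blast)
    also have "\<dots> \<le> (\<Sum>\<^sub>\<infinity>n\<in>{Suc k..}. norm (dterm s n))"
    proof (rule infsum_mono2)
      show "(\<lambda>n. norm (dterm s n)) summable_on A k - {1}"
        by (rule summable_on_subset_banach[OF nsum]) (use sub in blast)
      show "(\<lambda>n. norm (dterm s n)) summable_on {Suc k..}"
        by (rule summable_on_subset_banach[OF nsum]) auto
    qed (use tail in auto)
    also have "\<dots> = (\<Sum>\<^sub>\<infinity>n\<in>{1..}. norm (dterm s n)) - (\<Sum>n\<in>{1..k}. norm (dterm s n))"
    proof -
      have eq: "{1..} = {1..k} \<union> {Suc k..}" by auto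
      have "(\<Sum>\<^sub>\<infinity>n\<in>{1..}. norm (dterm s n)) = (\<Sum>\<^sub>\<infinity>n\<in>{1..k}. norm (dterm s n)) + (\<Sum>\<^sub>\<infinity>n\<in>{Suc k..}. norm (dterm s n))"
        unfolding eq by (rule infsum_Un_disjoint) (auto intro!: summable_on_subset_banach[OF nsum])
      then show ?thesis by simp
    qed
    finally show ?thesis .
  qed
  have lim: "(\<lambda>k. (\<Sum>\<^sub>\<infinity>n\<in>{1..}. norm (dterm s n)) - (\<Sum>n\<in>{1..k}. norm (dterm s n))) \<longlonglongrightarrow> 0"
  proof -
    have "((\<lambda>F. sum (\<lambda>n. norm (dterm s n)) F) \<longlongrightarrow> (\<Sum>\<^sub>\<infinity>n\<in>{1..}. norm (dterm s n))) (finite_subsets_at_top {1..})"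
      by (rule infsum_tendsto[OF nsum])
    moreover have "filterlim (\<lambda>k. {1..k}) (finite_subsets_at_top {1::nat..}) sequentially"
      unfolding filterlim_finite_subsets_at_top
    proof (intro allI impI)
      fix X :: "nat set" assume X: "finite X \<and> X \<subseteq> {1..}"
      show "\<forall>\<^sub>F k in sequentially. finite {1..k} \<and> X \<subseteq> {1..k} \<and> {1..k} \<subseteq> {1..}"
        using eventually_ge_at_top[of "Max (insert 0 X)"]
      proof eventually_elim
        case (elim k)
        then have "\<And>x. x \<in> X \<Longrightarrow> x \<le> k" using X by (meson Max_ge dual_order.trans finite_insert insertCI)
        then show ?case using X by auto
      qed
    qed
    ultimately have "(\<lambda>k. \<Sum>n\<in>{1..k}. norm (dterm s n)) \<longlonglongrightarrow> (\<Sum>\<^sub>\<infinity>n\<in>{1..}. norm (dterm s n))"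
      by (rule filterlim_compose)
    from tendsto_diff[OF tendsto_const[of "\<Sum>\<^sub>\<infinity>n\<in>{1..}. norm (dterm s n)"] this]
    show ?thesis by (simp only: diff_self)
  qed
  have "(\<lambda>k. (\<Sum>\<^sub>\<infinity>n\<in>A k. dterm s n) - 1) \<longlonglongrightarrow> 0"
    by (rule Lim_null_comparison[OF always_eventually lim]) (use bd in blast)
  then show ?thesis by (rule LIM_zero_cancel)
qed

text \<open>
  The partial products sieve out the multiples of the primes up to \<open>k\<close>, so that the partial product times
  \<open>\<zeta>(s)\<close> is the sum of \<open>n\<^sup>-\<^sup>s\<close> over the \<open>n\<close> that survive, and only \<open>1\<close> and some \<open>n > k\<close> do.
\<close>

lemma dser_euler_product:
  assumes s: "Re s > 1"
  shows "(\<lambda>k. (\<Prod>p | prime p \<and> p \<le> k. 1 - dterm s p) * zlog 0 s) \<longlonglongrightarrow> 1"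
proof -
  define A where "A = (\<lambda>k. {n::nat. n \<ge> 1 \<and> (\<forall>p. prime p \<and> p \<le> k \<longrightarrow> \<not> p dvd n)})"
  have summ: "(\<lambda>n. dterm s n) summable_on {1..}"
    using dconv_log[OF s, of 0] by (simp add: dconv_def)
  have sub: "A k \<subseteq> {1..}" for k by (auto simp: A_def)
  have summA: "dterm s summable_on B" if "B \<subseteq> A k" for B k
    using summable_on_subset_banach[OF summ, of B] that sub[of k] by auto
  have fin: "finite {p::nat. prime p \<and> p \<le> k}" for k
    by (rule finite_subset[of _ "{..k}"]) auto
  have "(\<Sum>\<^sub>\<infinity>n\<in>A k. dterm s n) = (\<Prod>p | prime p \<and> p \<le> k. 1 - dterm s p) * zlog 0 s" for k
  proof (induction k)
    case 0
    have e: "{p::nat. prime p \<and> p \<le> 0} = {}" by auto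
    have "A 0 = {1..}" unfolding A_def using e by blast
    then show ?case unfolding e dser_def by simp
  next
    case (Suc k)
    show ?case
    proof (cases "prime (Suc k)")
      case False
      have "A (Suc k) = A k" using False by (auto simp: A_def le_Suc_eq)
      moreover have "{p::nat. prime p \<and> p \<le> Suc k} = {p. prime p \<and> p \<le> k}"
        using False by (auto simp: le_Suc_eq)
      ultimately show ?thesis using Suc by simp
    next
      case True
      define p where "p = Suc k"
      have p: "prime p" "p > 0" using True by (simp_all add: p_def)
      have ps: "{q::nat. prime q \<and> q \<le> Suc k} = insert p {p. prime p \<and> p \<le> k}"
        using True by (auto simp: le_Suc_eq p_def)
      have Ap: "A (Suc k) = A p" by (simp add: p_def)
      have Ap': "n \<in> A p \<longleftrightarrow> n \<in> A k \<and> \<not> p dvd n" for n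
        using p by (auto simp: A_def p_def le_Suc_eq)
      have split: "A k = A p \<union> (\<lambda>m. p * m) ` A k"
      proof (intro equalityI subsetI)
        fix n assume n: "n \<in> A k"
        show "n \<in> A p \<union> (\<lambda>m. p * m) ` A k"
        proof (cases "p dvd n")
          case False
          then show ?thesis using n by (simp add: Ap')
        next
          case True
          then obtain m where "n = p * m" by (auto elim: dvdE)
          moreover from this n have "m \<in> A k" by (auto simp: A_def intro: Suc_leI)
          ultimately show ?thesis by blast
        qed
      next
        fix n assume "n \<in> A p \<union> (\<lambda>m. p * m) ` A k"
        then show "n \<in> A k"
        proof
          assume "n \<in> (\<lambda>m. p * m) ` A k"
          then obtain m where m: "n = p * m" "m \<in> A k" by auto
          have "\<not> q dvd n" if q: "prime q" "q \<le> k" for q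
          proof
            assume "q dvd n"
            then have "q dvd p \<or> q dvd m" using m(1) q(1) prime_dvd_multD by blast
            then show False using m(2) q p primes_dvd_imp_eq[of q p] by (auto simp: A_def p_def)
          qed
          then show ?thesis using m p by (auto simp: A_def intro: Suc_leI)
        qed (simp add: Ap')
      qed
      have disj: "A p \<inter> (\<lambda>m. p * m) ` A k = {}" by (auto simp: Ap')
      have subs: "(\<lambda>m. p * m) ` A k \<subseteq> A k" "A p \<subseteq> A k" using split by auto
      have "(\<Sum>\<^sub>\<infinity>n\<in>A k. dterm s n) = (\<Sum>\<^sub>\<infinity>n\<in>A p. dterm s n) + (\<Sum>\<^sub>\<infinity>n\<in>(\<lambda>m. p * m) ` A k. dterm s n)"
        by (subst split, rule infsum_Un_disjoint[OF summA[OF subs(2)] summA[OF subs(1)] disj])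
      also have "(\<Sum>\<^sub>\<infinity>n\<in>(\<lambda>m. p * m) ` A k. dterm s n) = (\<Sum>\<^sub>\<infinity>m\<in>A k. dterm s (p * m))"
        using p by (subst infsum_reindex) (auto simp: inj_on_def o_def)
      also have "\<dots> = (\<Sum>\<^sub>\<infinity>m\<in>A k. dterm s p * dterm s m)"
        using p by (intro infsum_cong dterm_mult) (auto simp: A_def)
      also have "\<dots> = dterm s p * (\<Sum>\<^sub>\<infinity>m\<in>A k. dterm s m)"
        by (rule infsum_cmult_right')
      finally have "(\<Sum>\<^sub>\<infinity>n\<in>A p. dterm s n) = (1 - dterm s p) * (\<Sum>\<^sub>\<infinity>m\<in>A k. dterm s m)"
        by (simp add: algebra_simps)
      then show ?thesis unfolding ps Ap Suc using fin[of k] by (subst prod.insert) (auto simp: mult_ac p_def)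
    qed
  qed
  then show ?thesis using dser_restrict_tendsto[OF s] unfolding A_def by simp
qed

lemma ge_one_of_tendsto:
  fixes z :: real
  assumes lim: "(\<lambda>k::nat. f k * z) \<longlonglongrightarrow> 1" and f: "\<And>k. f k \<le> 1" and z: "z \<ge> 0"
  shows "z \<ge> 1"
proof (rule LIMSEQ_le_const2[OF lim])
  show "\<exists>N. \<forall>k\<ge>N. f k * z \<le> z"
    using f z by (auto intro!: exI[of _ 0] simp: mult_le_cancel_right2)
qed

text \<open>The inequality for single factors is multiplied over the primes up to \<open>k\<close>,
  which bounds the finite products \<open>?N k\<close> by \<open>1\<close>. Since partial product
  times zeta tends to \<open>1\<close> at each of the three points, the zeta values must compensate
  in the limit.\<close>

lemma zeta_341:
  assumes "\<sigma> > (1::real)"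
  shows "norm (zlog 0 (of_real \<sigma>)) ^ 3 * norm (zlog 0 (Complex \<sigma> t)) ^ 4 * norm (zlog 0 (Complex \<sigma> (2 * t))) \<ge> 1"
proof -
  let ?P = "\<lambda>k s. (\<Prod>p | prime p \<and> p \<le> k. 1 - dterm s p)"
  let ?z = "\<lambda>s. zlog 0 s"
  let ?N = "\<lambda>k. norm (?P k (of_real \<sigma>)) ^ 3 * norm (?P k (Complex \<sigma> t)) ^ 4 * norm (?P k (Complex \<sigma> (2 * t)))"
  let ?Z = "norm (zlog 0 (of_real \<sigma>)) ^ 3 * norm (zlog 0 (Complex \<sigma> t)) ^ 4 * norm (zlog 0 (Complex \<sigma> (2 * t)))"
  have "(\<lambda>k. norm (?P k (of_real \<sigma>) * ?z (of_real \<sigma>)) ^ 3 * norm (?P k (Complex \<sigma> t) * ?z (Complex \<sigma> t)) ^ 4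
      * norm (?P k (Complex \<sigma> (2 * t)) * ?z (Complex \<sigma> (2 * t)))) \<longlonglongrightarrow> norm (1::complex) ^ 3 * norm (1::complex) ^ 4 * norm (1::complex)"
    using assms by (intro tendsto_mult tendsto_power tendsto_norm dser_euler_product) auto
  also have "(\<lambda>k. norm (?P k (of_real \<sigma>) * ?z (of_real \<sigma>)) ^ 3 * norm (?P k (Complex \<sigma> t) * ?z (Complex \<sigma> t)) ^ 4
      * norm (?P k (Complex \<sigma> (2 * t)) * ?z (Complex \<sigma> (2 * t)))) = (\<lambda>k. ?N k * ?Z)"
    by (simp only: norm_mult power_mult_distrib mult_ac)
  finally have lim: "(\<lambda>k. ?N k * ?Z) \<longlonglongrightarrow> 1" by simp
  define F where "F = (\<lambda>p. norm (1 - dterm (of_real \<sigma>) p) ^ 3 * norm (1 - dterm (Complex \<sigma> t) p) ^ 4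
        * norm (1 - dterm (Complex \<sigma> (2 * t)) p))"
  have F: "F p \<le> 1" if "prime p" for p
  proof -
    have p1: "real p > 1" using that prime_gt_1_nat[of p] by auto
    define q where "q = real p powr - \<sigma>"
    define \<theta> where "\<theta> = - t * ln (real p)"
    have q: "0 \<le> q" "q < 1" using p1 assms by (auto simp: q_def powr_less_one)
    have "dterm (Complex \<sigma> u) p = of_real q * cis (- u * ln (real p))" for u
      using p1 by (simp add: dterm_def exp_eq_polar q_def powr_def)
    note dt = this
    have s0: "complex_of_real \<sigma> = Complex \<sigma> 0" by (simp add: complex_eq_iff)
    have d0: "dterm (of_real \<sigma>) p = of_real q" unfolding s0 dt by simp
    have d1: "dterm (Complex \<sigma> t) p = of_real q * cis \<theta>" unfolding dt \<theta>_def by simp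
    have d2: "dterm (Complex \<sigma> (2 * t)) p = of_real q * cis (2 * \<theta>)"
      unfolding dt \<theta>_def by (simp add: mult.assoc)
    have "norm (1 - complex_of_real q) = norm (complex_of_real (1 - q))" by simp
    also have "\<dots> = 1 - q" using q by (subst norm_of_real) simp
    finally have n: "norm (1 - complex_of_real q) = 1 - q" .
    show ?thesis
      unfolding F_def d0 d1 d2 n by (rule zeta_mertens_factor[OF q])
  qed
  have F0: "F p \<ge> 0" for p
    unfolding F_def by (intro mult_nonneg_nonneg zero_le_power norm_ge_zero)
  have "?N k \<le> 1" for k
  proof -
    have "?N k = (\<Prod>p | prime p \<and> p \<le> k. F p)"
      unfolding F_def prod.distrib prod_power_distrib[symmetric] prod_norm ..
    also have "\<dots> \<le> 1"
      by (rule prod_le_1) (use F F0 in blast)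
    finally show ?thesis .
  qed
  then show ?thesis
    by (rule ge_one_of_tendsto[OF lim]) (intro mult_nonneg_nonneg zero_le_power norm_ge_zero)
qed

subsection \<open>Zeta and its derivatives to the right of 1\<close>

definition lterm :: "nat \<Rightarrow> complex \<Rightarrow> real \<Rightarrow> complex" where
  "lterm k s x = of_real (ln x ^ k) * exp (- s * of_real (ln x))"

text \<open>
  Integration by parts yields this antiderivative of \<open>lterm k s\<close>, which vanishes at infinity for \<open>Re s > 1\<close>.
\<close>

fun lprim :: "nat \<Rightarrow> complex \<Rightarrow> real \<Rightarrow> complex" where
  "lprim 0 s x = exp ((1 - s) * of_real (ln x)) / (1 - s)"
| "lprim (Suc k) s x = (of_real (ln x ^ Suc k) * exp ((1 - s) * of_real (ln x)) - of_nat (Suc k) * lprim k s x) / (1 - s)"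

text \<open>The factor \<open>1 / x\<close> from the chain rule is absorbed as
  \<open>exp (- ln x)\<close>, so all derivatives stay of the form power of \<open>ln x\<close>
  times one exponential.\<close>

lemma exp_ln_has_vector_derivative:
  assumes "x > 0"
  shows "((\<lambda>x. exp (w * complex_of_real (ln x))) has_vector_derivative w * exp ((w - 1) * of_real (ln x))) (at x)"
proof -
  have "((\<lambda>x. complex_of_real (ln x)) has_vector_derivative of_real (1 / x)) (at x)"
    using assms by (auto intro!: has_vector_derivative_of_real derivative_eq_intros simp: has_real_derivative_iff_has_vector_derivative[symmetric])
  moreover have "((\<lambda>z. exp (w * z)) has_field_derivative w * exp (w * of_real (ln x))) (at (of_real (ln x)))"
    by (auto intro!: derivative_eq_intros)
  ultimately have "((\<lambda>z. exp (w * z)) \<circ> (\<lambda>x. complex_of_real (ln x)) has_vector_derivative of_real (1 / x) * (w * exp (w * of_real (ln x)))) (at x)"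
    by (rule field_vector_diff_chain_at)
  moreover have "of_real (1 / x) = exp (- complex_of_real (ln x))"
    using assms by (simp add: exp_minus exp_of_real divide_inverse)
  ultimately show ?thesis
    by (simp add: o_def algebra_simps exp_diff exp_minus divide_inverse)
qed

lemma ln_power_has_vector_derivative:
  assumes "x > 0"
  shows "((\<lambda>x. complex_of_real (ln x ^ Suc k)) has_vector_derivative of_nat (Suc k) * of_real (ln x ^ k) * exp (- complex_of_real (ln x))) (at x)"
proof -
  have "((\<lambda>x. ln x ^ Suc k) has_real_derivative real (Suc k) * ln x ^ k * (1 / x)) (at x)"
    using assms by (auto intro!: derivative_eq_intros simp del: power_Suc)
  then have "((\<lambda>x. complex_of_real (ln x ^ Suc k)) has_vector_derivative of_real (real (Suc k) * ln x ^ k * (1 / x))) (at x)"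
    by (intro has_vector_derivative_of_real) (simp add: has_real_derivative_iff_has_vector_derivative)
  moreover have "complex_of_real (1 / x) = exp (- complex_of_real (ln x))"
    using assms by (simp add: exp_minus exp_of_real divide_inverse)
  ultimately show ?thesis by (simp only: of_real_mult of_real_of_nat_eq)
qed

lemma lprim_has_vector_derivative:
  assumes "x > 0" "s \<noteq> 1"
  shows "(lprim k s has_vector_derivative lterm k s x) (at x)"
proof (induction k)
  case 0
  have "((\<lambda>x. exp ((1 - s) * of_real (ln x)) / (1 - s)) has_vector_derivative
      ((1 - s) * exp ((1 - s - 1) * of_real (ln x))) / (1 - s)) (at x)"
    by (rule has_vector_derivative_divide[OF exp_ln_has_vector_derivative[OF assms(1)]])
  then show ?case using assms(2) by (simp add: lterm_def)
next
  case (Suc k)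
  let ?e = "exp ((1 - s) * complex_of_real (ln x))"
  have "((\<lambda>x. (of_real (ln x ^ Suc k) * exp ((1 - s) * of_real (ln x)) - of_nat (Suc k) * lprim k s x) / (1 - s))
      has_vector_derivative
      ((of_real (ln x ^ Suc k) * ((1 - s) * exp ((1 - s - 1) * of_real (ln x))) +
        (of_nat (Suc k) * of_real (ln x ^ k) * exp (- complex_of_real (ln x))) * ?e)
        - of_nat (Suc k) * lterm k s x) / (1 - s)) (at x)"
    by (intro has_vector_derivative_divide has_vector_derivative_diff has_vector_derivative_mult
        has_vector_derivative_mult_right exp_ln_has_vector_derivative ln_power_has_vector_derivative Suc assms)
  moreover have "exp (- complex_of_real (ln x)) * ?e = exp (- s * of_real (ln x))"
    by (simp add: exp_add[symmetric] algebra_simps)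
  then have "((of_real (ln x ^ Suc k) * ((1 - s) * exp ((1 - s - 1) * of_real (ln x))) +
        (of_nat (Suc k) * of_real (ln x ^ k) * exp (- complex_of_real (ln x))) * ?e)
        - of_nat (Suc k) * lterm k s x) / (1 - s) = lterm (Suc k) s x"
    using assms(2) by (simp add: lterm_def mult.assoc)
  ultimately show ?case by (simp only: lprim.simps fun_eq_iff[symmetric]) (simp add: o_def)?
qed

text \<open>Since \<open>lprim\<close> vanishes at infinity, \<open>- lprim k s 1\<close> is the
  integral of \<open>lterm k s\<close> over \<open>[1, \<infinity>)\<close>; it is the polar part of
  \<open>zlog k\<close> at \<open>1\<close>.\<close>

lemma lprim_one: "s \<noteq> 1 \<Longrightarrow> lprim k s 1 = - fact k / (s - 1) ^ Suc k"
proof (induction k)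
  case 0
  then show ?case by (simp add: field_simps)
next
  case (Suc k)
  have "lprim (Suc k) s 1 = - of_nat (Suc k) * lprim k s 1 / (1 - s)"
    unfolding lprim.simps by (simp only: ln_one power_0_Suc of_real_0 mult_zero_left diff_0 minus_mult_left)
  also have "\<dots> = - fact (Suc k) / (s - 1) ^ Suc (Suc k)"
    unfolding Suc.IH[OF Suc.prems] using Suc.prems by (simp add: divide_simps) (simp add: algebra_simps)?
  finally show ?case .
qed

lemma lprim_tendsto_0:
  assumes "Re s > 1"
  shows "(\<lambda>n. lprim k s (real (Suc n))) \<longlonglongrightarrow> 0"
proof -
  have e: "(\<lambda>n. of_real (ln (real (Suc n)) ^ k) * exp ((1 - s) * of_real (ln (real (Suc n))))) \<longlonglongrightarrow> 0" for k
  proof (rule tendsto_norm_zero_cancel)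
    have "(\<lambda>n. ln (real (Suc n)) ^ k * exp ((1 - Re s) * ln (real (Suc n)))) \<longlonglongrightarrow> 0"
    proof -
      define a where "a = Re s - 1"
      have "a > 0" using assms by (simp add: a_def)
      then have "(\<lambda>n. ln (real (Suc n)) ^ k * exp ((- a) * ln (real (Suc n)))) \<longlonglongrightarrow> 0" by real_asymp
      then show ?thesis by (simp add: a_def)
    qed
    then show "(\<lambda>n. norm (of_real (ln (real (Suc n)) ^ k) * exp ((1 - s) * of_real (ln (real (Suc n)))))) \<longlonglongrightarrow> 0"
      by (simp add: norm_mult norm_power)
  qed
  show ?thesis
  proof (induction k)
    case 0
    have "s \<noteq> 1" using assms by auto
    then show ?case using tendsto_divide[OF e[of 0] tendsto_const[of "1 - s"]] by simp
  next
    case (Suc k)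
    have "s \<noteq> 1" using assms by auto
    then have "(\<lambda>n. (of_real (ln (real (Suc n)) ^ Suc k) * exp ((1 - s) * of_real (ln (real (Suc n))))
        - of_nat (Suc k) * lprim k s (real (Suc n))) / (1 - s)) \<longlonglongrightarrow> (0 - of_nat (Suc k) * 0) / (1 - s)"
      by (intro tendsto_intros e Suc) simp
    then show ?case by simp
  qed
qed

lemma norm_lterm: "x \<ge> 1 \<Longrightarrow> norm (lterm k s x) = ln x ^ k * x powr (- Re s)"
  by (simp add: lterm_def norm_mult norm_power powr_def)

text \<open>Differentiation gains a factor \<open>1 / x\<close> and costs \<open>k + norm s\<close>;
  the power \<open>(1 + ln x) ^ k\<close> dominates both \<open>ln x ^ k\<close> and the lower power
  that the product rule produces.\<close>

lemma lterm_has_vector_derivative: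
  assumes "x > 0"
  shows "\<exists>d. (lterm k s has_vector_derivative d) (at x) \<and>
    (x \<ge> 1 \<longrightarrow> norm d \<le> (real k + norm s) * (1 + ln x) ^ k * x powr (- Re s - 1))"
proof -
  have e: "((\<lambda>x. exp (- s * complex_of_real (ln x))) has_vector_derivative - s * exp ((- s - 1) * of_real (ln x))) (at x)"
    by (rule exp_ln_has_vector_derivative[OF assms])
  have ne: "norm (exp ((- s - 1) * complex_of_real (ln x))) = x powr (- Re s - 1)"
    using assms by (simp add: powr_def)
  show ?thesis
  proof (cases k)
    case 0
    then have "(lterm k s has_vector_derivative - s * exp ((- s - 1) * of_real (ln x))) (at x)"
      using e by (simp add: lterm_def[abs_def])
    then show ?thesis using ne 0 by (auto simp: norm_mult)
  next
    case (Suc j)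
    let ?d = "of_real (ln x ^ Suc j) * (- s * exp ((- s - 1) * of_real (ln x))) +
      of_nat (Suc j) * of_real (ln x ^ j) * exp (- complex_of_real (ln x)) * exp (- s * complex_of_real (ln x))"
    have d: "(lterm k s has_vector_derivative ?d) (at x)"
      unfolding Suc lterm_def[abs_def]
      by (intro has_vector_derivative_mult e ln_power_has_vector_derivative assms)
    have "norm ?d \<le> (real k + norm s) * (1 + ln x) ^ k * x powr (- Re s - 1)" if x: "x \<ge> 1"
    proof -
      have l: "ln x \<ge> 0" using x by simp
      have "?d = exp ((- s - 1) * complex_of_real (ln x)) * (- s * of_real (ln x ^ Suc j) + of_nat (Suc j) * of_real (ln x ^ j))"
        by (simp add: algebra_simps exp_diff exp_minus divide_inverse)
      also have "norm \<dots> \<le> x powr (- Re s - 1) * (norm s * ln x ^ Suc j + real (Suc j) * ln x ^ j)"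
        unfolding norm_mult[of "exp _"] ne
        using l by (intro mult_left_mono order.trans[OF norm_triangle_ineq]) (auto simp: norm_mult norm_power simp del: of_nat_Suc)
      also have "\<dots> \<le> x powr (- Re s - 1) * (norm s * (1 + ln x) ^ k + real k * (1 + ln x) ^ k)"
      proof (intro mult_left_mono add_mono)
        show "ln x ^ Suc j \<le> (1 + ln x) ^ k" unfolding Suc using l by (intro power_mono) auto
        have "ln x ^ j \<le> (1 + ln x) ^ j" using l by (intro power_mono) auto
        also have "\<dots> \<le> (1 + ln x) ^ k" using l by (intro power_increasing) (auto simp: Suc)
        finally show "real (Suc j) * ln x ^ j \<le> real k * (1 + ln x) ^ k"
          unfolding Suc by (intro mult_left_mono) auto
      qed auto
      finally show ?thesis by (simp add: algebra_simps)
    qed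
    with d show ?thesis by blast
  qed
qed

lemma vector_derivative_bound_interval:
  fixes f :: "real \<Rightarrow> 'a :: real_normed_vector"
  assumes "\<And>x. x \<in> {a..b} \<Longrightarrow> (f has_vector_derivative f' x) (at x)" "\<And>x. x \<in> {a..b} \<Longrightarrow> norm (f' x) \<le> B"
    "x \<in> {a..b}" "y \<in> {a..b}"
  shows "norm (f x - f y) \<le> B * \<bar>x - y\<bar>"
proof -
  have "norm (f x - f y) \<le> B * norm (x - y)"
  proof (rule differentiable_bound[of "{a..b}" f "\<lambda>x h. h *\<^sub>R f' x"])
    show "(f has_derivative (\<lambda>h. h *\<^sub>R f' z)) (at z within {a..b})" if "z \<in> {a..b}" for z
      using assms(1)[OF that] by (simp add: has_vector_derivative_def has_derivative_at_withinI)
    show "onorm (\<lambda>h. h *\<^sub>R f' z) \<le> B" if "z \<in> {a..b}" for z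
      using assms(2)[OF that] by (simp add: onorm_scaleR_left onorm_id[where 'a = real])
  qed (use assms in auto)
  then show ?thesis by simp
qed


text \<open>
  The left-hand side is at most \<open>2 sup |g|\<close> and at most \<open>sup |g'|\<close> on \<open>[n, n+1]\<close> for \<open>g = lterm k s\<close>;
  interpolating between the two makes the series converge uniformly up to the line \<open>Re s = 1\<close> at the
  price of a factor \<open>|s| powr \<theta>\<close> with \<open>\<theta>\<close> as small as we like.
\<close>

lemma lterm_diff_bound:
  assumes s: "Re s > 1" and n: "n \<ge> 1" and \<theta>: "0 < \<theta>" "\<theta> < 1"
  shows "norm (lterm k s (real n) - (lprim k s (real (Suc n)) - lprim k s (real n)))
    \<le> 2 * (real k + norm s) powr \<theta> * ((1 + ln (real (Suc n))) ^ k * real n powr (- (1 + \<theta>)))"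
proof -
  let ?a = "real n" and ?b = "real (Suc n)"
  define L where "L = (1 + ln (real (Suc n))) ^ k"
  define c where "c = real k + norm s"
  have sn1: "s \<noteq> 1" using s by auto
  have "norm s \<ge> Re s" by (rule complex_Re_le_cmod)
  moreover have "real k \<ge> 0" by (rule of_nat_0_le_iff)
  ultimately have c: "c > 0" using s unfolding c_def by linarith
  have "ln (real (Suc n)) \<ge> 0" by (rule ln_ge_zero) simp
  then have "1 + ln (real (Suc n)) \<ge> 1" by linarith
  then have L: "L \<ge> 1" unfolding L_def by (rule one_le_power)
  \<comment> \<open>\<open>lprim\<close> is an antiderivative of \<open>lterm\<close>, so on an
    interval of length \<open>1\<close> the error against the left endpoint value is at most the
    oscillation of \<open>lterm\<close> there.\<close>
  have D: "norm (lprim k s ?b - lprim k s ?a - (?b - ?a) *\<^sub>R lterm k s ?a) \<le> norm (?b - ?a) * B"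
    if "\<And>x. x \<in> {?a..?b} \<Longrightarrow> norm (lterm k s x - lterm k s ?a) \<le> B" for B
  proof (rule vector_differentiable_bound_linearization[where S = "{?a..?b}" and f' = "lterm k s"])
    show "(lprim k s has_vector_derivative lterm k s x) (at x within {?a..?b})" if "x \<in> {?a..?b}" for x
      by (rule has_vector_derivative_at_within[OF lprim_has_vector_derivative[OF _ sn1]]) (use that n in simp)
    show "closed_segment ?a ?b \<subseteq> {?a..?b}" by (simp add: closed_segment_eq_real_ivl)
    show "?a \<in> {?a..?b}" by simp
  qed (rule that)
  define X where "X = norm (lterm k s ?a - (lprim k s ?b - lprim k s ?a))"
  have XB: "X \<le> B" if "\<And>x. x \<in> {?a..?b} \<Longrightarrow> norm (lterm k s x - lterm k s ?a) \<le> B" for B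
    using D[OF that] by (simp add: X_def norm_minus_commute)
  have lx: "0 \<le> ln x" "ln x \<le> ln ?b" if "x \<in> {?a..?b}" for x using that n by auto
  have px: "x powr - e \<le> ?a powr - e" if "x \<in> {?a..?b}" "e \<ge> 0" for x e
    using that n by (intro powr_mono2') auto
  have b1: "norm (lterm k s x) \<le> L * ?a powr - 1" if x: "x \<in> {?a..?b}" for x
  proof -
    have "norm (lterm k s x) = ln x ^ k * x powr - Re s" using x n by (intro norm_lterm) auto
    also have "\<dots> \<le> L * ?a powr - 1"
    proof (rule mult_mono)
      show "ln x ^ k \<le> L" unfolding L_def using lx[OF x] by (intro power_mono) auto
      have "x powr - Re s \<le> x powr - 1" using x n s by (intro powr_mono) auto
      also have "\<dots> \<le> ?a powr - 1" using px[OF x, of 1] by simp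
      finally show "x powr - Re s \<le> ?a powr - 1" .
    qed (use L in auto)
    finally show ?thesis .
  qed
  have X1: "X \<le> 2 * L * ?a powr - 1"
  proof (rule XB)
    fix x assume x: "x \<in> {?a..?b}"
    have "norm (lterm k s x - lterm k s ?a) \<le> norm (lterm k s x) + norm (lterm k s ?a)" by (rule norm_triangle_ineq4)
    also have "\<dots> \<le> L * ?a powr - 1 + L * ?a powr - 1" using x by (intro add_mono b1) auto
    finally show "norm (lterm k s x - lterm k s ?a) \<le> 2 * L * ?a powr - 1" by simp
  qed
  define d where "d = (\<lambda>x. vector_derivative (lterm k s) (at x))"
  have d: "(lterm k s has_vector_derivative d x) (at x)"
    "x \<ge> 1 \<Longrightarrow> norm (d x) \<le> c * (1 + ln x) ^ k * x powr (- Re s - 1)" if "x > 0" for x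
  proof -
    from lterm_has_vector_derivative[OF that, of k s] obtain e
      where e: "(lterm k s has_vector_derivative e) (at x)"
        "x \<ge> 1 \<longrightarrow> norm e \<le> (real k + norm s) * (1 + ln x) ^ k * x powr (- Re s - 1)" by blast
    have "d x = e" unfolding d_def by (rule vector_derivative_at[OF e(1)])
    then show "(lterm k s has_vector_derivative d x) (at x)"
      "x \<ge> 1 \<Longrightarrow> norm (d x) \<le> c * (1 + ln x) ^ k * x powr (- Re s - 1)"
      using e unfolding c_def by blast+
  qed
  have X2: "X \<le> c * L * ?a powr - 2"
  proof (rule XB)
    fix x assume x: "x \<in> {?a..?b}"
    have "norm (lterm k s x - lterm k s ?a) \<le> (c * L * ?a powr - 2) * \<bar>x - ?a\<bar>"
    proof (rule vector_derivative_bound_interval[of ?a ?b _ d])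
      fix y assume y: "y \<in> {?a..?b}"
      then show "(lterm k s has_vector_derivative d y) (at y)" using n by (intro d) auto
      have "norm (d y) \<le> c * (1 + ln y) ^ k * y powr (- Re s - 1)" using y n by (intro d) auto
      also have "\<dots> \<le> c * L * ?a powr - 2"
      proof (intro mult_mono)
        show "(1 + ln y) ^ k \<le> L" unfolding L_def using lx[OF y] by (intro power_mono) auto
        have "y powr (- Re s - 1) \<le> y powr - 2" using y n s by (intro powr_mono) auto
        also have "\<dots> \<le> ?a powr - 2" using px[OF y, of 2] by simp
        finally show "y powr (- Re s - 1) \<le> ?a powr - 2" .
      qed (use L c lx[OF y] in auto)
      finally show "norm (d y) \<le> c * L * ?a powr - 2" .
    qed (use x in auto)
    also have "\<dots> \<le> (c * L * ?a powr - 2) * 1" using x c L by (intro mult_left_mono) auto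
    finally show "norm (lterm k s x - lterm k s ?a) \<le> c * L * ?a powr - 2" by simp
  qed
  have X0: "X \<ge> 0" by (simp add: X_def)
  \<comment> \<open>Geometric mean of the two bounds with weights \<open>1 - \<theta>\<close> and
    \<open>\<theta>\<close>: the exponents of \<open>?a\<close> add up to
    \<open>- (1 - \<theta>) - 2 * \<theta> = - (1 + \<theta>)\<close>, which is summable.\<close>
  have "X \<le> (2 * L * ?a powr - 1) powr (1 - \<theta>) * (c * L * ?a powr - 2) powr \<theta>"
  proof (cases "X = 0")
    case False
    then have "X = X powr (1 - \<theta>) * X powr \<theta>" using X0 by (simp add: powr_add[symmetric])
    also have "\<dots> \<le> (2 * L * ?a powr - 1) powr (1 - \<theta>) * (c * L * ?a powr - 2) powr \<theta>"
      using X0 X1 X2 \<theta> by (intro mult_mono powr_mono2) auto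
    finally show ?thesis .
  qed auto
  also have "\<dots> = 2 powr (1 - \<theta>) * c powr \<theta> * (L powr (1 - \<theta>) * L powr \<theta>) * (?a powr (- (1 - \<theta>)) * ?a powr (- 2 * \<theta>))"
  proof -
    have "(x * y * z) powr e = x powr e * y powr e * z powr e" if "x \<ge> 0" "y \<ge> 0" "z \<ge> 0" for x y z e :: real
      using that by (simp add: powr_mult)
    note m = this[of 2 L "?a powr - 1" "1 - \<theta>"] this[of c L "?a powr - 2" \<theta>]
    have "(2 * L * ?a powr - 1) powr (1 - \<theta>) * (c * L * ?a powr - 2) powr \<theta> =
        (2 powr (1 - \<theta>) * L powr (1 - \<theta>) * (?a powr - 1) powr (1 - \<theta>)) * (c powr \<theta> * L powr \<theta> * (?a powr - 2) powr \<theta>)"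
      using m L c by (simp only: powr_ge_zero)
    also have "(?a powr - 1) powr (1 - \<theta>) = ?a powr (- (1 - \<theta>))" by (simp only: powr_powr mult_minus_left mult_1_left)
    also have "(?a powr - 2) powr \<theta> = ?a powr (- 2 * \<theta>)" by (rule powr_powr)
    finally show ?thesis by (simp only: mult_ac)
  qed
  also have "L powr (1 - \<theta>) * L powr \<theta> = L" using L by (simp add: powr_add[symmetric])
  also have "?a powr (- (1 - \<theta>)) * ?a powr (- 2 * \<theta>) = ?a powr (- (1 + \<theta>))"
    unfolding powr_add[symmetric] by (rule arg_cong[where f = "\<lambda>e. ?a powr e"]) simp
  also have "2 powr (1 - \<theta>) * c powr \<theta> * L * ?a powr (- (1 + \<theta>)) \<le> 2 * c powr \<theta> * L * ?a powr (- (1 + \<theta>))"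
    using \<theta> L powr_mono[of "1 - \<theta>" 1 2] by (intro mult_right_mono) auto
  finally show ?thesis by (simp add: X_def c_def L_def mult.assoc)
qed

text \<open>The differences of \<open>lprim\<close> telescope: the upper end tends to
  \<open>0\<close> and the lower end is the polar part. What remains is the sum of the defects on
  the intervals \<open>[n, n + 1]\<close>, and these are summable with a constant that is
  independent of \<open>s\<close>.\<close>

lemma zlog_approx:
  assumes \<theta>: "0 < \<theta>" "\<theta> < 1"
  shows "\<exists>K>0. \<forall>s. Re s > 1 \<longrightarrow> norm (zlog k s - fact k / (s - 1) ^ Suc k) \<le> K * (real k + norm s) powr \<theta>"
proof -
  \<comment> \<open>Shifted by one: \<open>B n\<close> belongs to the interval
    \<open>[n + 1, n + 2]\<close>.\<close>
  define B where "B = (\<lambda>n. (1 + ln (real (Suc (Suc n)))) ^ k * real (Suc n) powr (- (1 + \<theta>)))"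
  have Bs: "summable B"
  proof (rule summable_comparison_test_bigo)
    show "summable (\<lambda>n. norm (real (Suc n) powr (- (1 + \<theta> / 2))))"
      using \<theta> by (subst summable_Suc_iff) (simp add: summable_real_powr_iff)
    show "B \<in> O(\<lambda>n. real (Suc n) powr (- (1 + \<theta> / 2)))"
      unfolding B_def using \<theta>(1) by real_asymp
  qed
  have B0: "B n > 0" for n
  proof -
    have "ln (real (Suc (Suc n))) \<ge> 0" by (rule ln_ge_zero) simp
    then have "1 + ln (real (Suc (Suc n))) > 0" by linarith
    then show ?thesis unfolding B_def by (intro mult_pos_pos zero_less_power) simp_all
  qed
  define K where "K = 2 * suminf B"
  have "suminf B > 0" by (rule suminf_pos[OF Bs B0])
  then have K: "K > 0" by (simp add: K_def)
  show ?thesis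
  proof (intro exI[of _ K] conjI allI impI K)
    fix s :: complex assume s: "Re s > 1"
    have sn1: "s \<noteq> 1" using s by auto
    let ?D = "\<lambda>n. lterm k s (real n) - (lprim k s (real (Suc n)) - lprim k s (real n))"
    have part: "(\<Sum>n<N. ?D (Suc n)) = (\<Sum>n<N. lterm k s (real (Suc n))) - lprim k s (real (Suc N)) + lprim k s 1" for N
      by (induction N) (simp_all add: algebra_simps)
    have "((\<lambda>n. of_real (ln (real n) ^ k) * dterm s n) has_sum zlog k s) {1..}"
      using dconv_log[OF s, of k] unfolding dconv_def dser_def by (rule has_sum_infsum)
    also have "?this \<longleftrightarrow> ((\<lambda>n. lterm k s (real (Suc n))) has_sum zlog k s) UNIV"
      by (rule has_sum_reindex_bij_witness[of _ Suc "\<lambda>n. n - 1"]) (auto simp: lterm_def dterm_def simp del: of_nat_Suc)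
    finally have "(\<lambda>N. \<Sum>n<N. lterm k s (real (Suc n))) \<longlonglongrightarrow> zlog k s"
      unfolding sums_def[symmetric] by (rule has_sum_imp_sums)
    then have "(\<lambda>N. \<Sum>n<N. ?D (Suc n)) \<longlonglongrightarrow> zlog k s - 0 + lprim k s 1"
      unfolding part by (intro tendsto_intros lprim_tendsto_0[OF s])
    moreover have "zlog k s - 0 + lprim k s 1 = zlog k s - fact k / (s - 1) ^ Suc k"
      unfolding lprim_one[OF sn1] by (simp only: diff_0_right minus_divide_left[symmetric] add_uminus_conv_diff)
    ultimately have "(\<lambda>N. \<Sum>n<N. ?D (Suc n)) \<longlonglongrightarrow> zlog k s - fact k / (s - 1) ^ Suc k"
      by (simp only:)
    then have lim: "(\<lambda>N. norm (\<Sum>n<N. ?D (Suc n))) \<longlonglongrightarrow> norm (zlog k s - fact k / (s - 1) ^ Suc k)"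
      by (rule tendsto_norm)
    have "norm (\<Sum>n<N. ?D (Suc n)) \<le> K * (real k + norm s) powr \<theta>" for N
    proof -
      have "norm (\<Sum>n<N. ?D (Suc n)) \<le> (\<Sum>n<N. norm (?D (Suc n)))" by (rule norm_sum)
      also have "\<dots> \<le> (\<Sum>n<N. 2 * (real k + norm s) powr \<theta> * B n)"
      proof (rule sum_mono)
        fix n
        show "norm (?D (Suc n)) \<le> 2 * (real k + norm s) powr \<theta> * B n"
          unfolding B_def by (rule lterm_diff_bound[OF s _ \<theta>]) simp
      qed
      also have "\<dots> = 2 * (real k + norm s) powr \<theta> * (\<Sum>n<N. B n)" by (rule sum_distrib_left[symmetric])
      also have "\<dots> \<le> 2 * (real k + norm s) powr \<theta> * suminf B"
        by (intro mult_left_mono sum_le_suminf Bs) (use B0 less_imp_le in auto)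
      finally show ?thesis by (simp add: K_def mult_ac)
    qed
    then have "\<exists>N. \<forall>n\<ge>N. norm (\<Sum>i<n. ?D (Suc i)) \<le> K * (real k + norm s) powr \<theta>" by blast
    then show "norm (zlog k s - fact k / (s - 1) ^ Suc k) \<le> K * (real k + norm s) powr \<theta>"
      by (rule LIMSEQ_le_const2[OF lim])
  qed
qed

section \<open>Differentiating zeta and moving horizontally\<close>

lemma zlog_sums:
  assumes "Re s > 1"
  shows "(\<lambda>n. of_real (ln (real (Suc n)) ^ k) * dterm s (Suc n)) sums zlog k s"
proof -
  have "((\<lambda>n. of_real (ln (real n) ^ k) * dterm s n) has_sum zlog k s) {1..}"
    using dconv_log[OF assms, of k] unfolding dconv_def dser_def by (rule has_sum_infsum)
  also have "?this \<longleftrightarrow> ((\<lambda>n. of_real (ln (real (Suc n)) ^ k) * dterm s (Suc n)) has_sum zlog k s) UNIV"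
    by (rule has_sum_reindex_bij_witness[of _ Suc "\<lambda>n. n - 1"]) (auto simp del: of_nat_Suc)
  finally show ?thesis by (rule has_sum_imp_sums)
qed

text \<open>Termwise differentiation on a half plane \<open>Re z \<ge> a\<close> with
  \<open>1 < a < Re s\<close>, where \<open>ln n * n powr - a\<close> is a summable majorant. It
  serves to carry lower bounds for zeta along horizontal segments.\<close>

lemma zeta_has_field_derivative:
  assumes s: "Re s > 1"
  shows "(zlog 0 has_field_derivative - zlog 1 s) (at s)"
proof -
  define a where "a = (1 + Re s) / 2"
  have a: "1 < a" "a < Re s" using s by (simp_all add: a_def)
  define S where "S = {z. Re z \<ge> a}"
  define f where "f = (\<lambda>(n::nat) z. dterm z (Suc n))"
  define f' where "f' = (\<lambda>(n::nat) z. - (of_real (ln (real (Suc n))) * dterm z (Suc n)))"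
  have conv: "convex S" unfolding S_def by (rule convex_halfspace_Re_ge)
  have der: "(f n has_field_derivative f' n z) (at z within S)" for n z
    unfolding f_def f'_def dterm_def by (auto intro!: derivative_eq_intros simp del: of_nat_Suc)
  have bound: "norm (f' n z) \<le> ln (real (Suc n)) ^ 1 * real (Suc n) powr - a" if "z \<in> S" for n z
  proof -
    have "ln (real (Suc n)) \<ge> 0" by (rule ln_ge_zero) simp
    have "norm (f' n z) = ln (real (Suc n)) * real (Suc n) powr - Re z"
      unfolding f'_def norm_minus_cancel norm_mult norm_of_real using \<open>ln (real (Suc n)) \<ge> 0\<close>
      by (subst norm_dterm) (simp_all del: of_nat_Suc)
    also have "\<dots> \<le> ln (real (Suc n)) * real (Suc n) powr - a"
      using that \<open>ln (real (Suc n)) \<ge> 0\<close> by (intro mult_left_mono powr_mono) (auto simp: S_def)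
    finally show ?thesis by (simp only: power_one_right)
  qed
  have sm: "summable (\<lambda>n. ln (real (Suc n)) ^ 1 * real (Suc n) powr - a)"
    by (subst summable_Suc_iff) (rule summable_log_power[OF a(1)])
  have unif: "uniformly_convergent_on S (\<lambda>n z. \<Sum>i<n. f' i z)"
    by (rule uniformly_convergentI[OF Weierstrass_m_test[OF bound sm]])
  have sS: "s \<in> S" using a by (simp add: S_def)
  have "{z. Re z > a} \<subseteq> S" by (auto simp: S_def)
  then have int: "s \<in> interior S"
    using a by (intro interiorI[of "{z. Re z > a}"] open_halfspace_Re_gt) auto
  have z0: "(\<lambda>n. f n z) sums zlog 0 z" if "Re z > 1" for z
    using zlog_sums[OF that, of 0] by (simp add: f_def)
  have z1: "(\<lambda>n. f' n s) sums (- zlog 1 s)"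
    unfolding f'_def using zlog_sums[OF s, of 1] by (intro sums_minus) simp
  have "((\<lambda>z. suminf (\<lambda>n. f n z)) has_field_derivative (suminf (\<lambda>n. f' n s))) (at s)"
    by (rule has_field_derivative_series'(2)[OF conv der unif sS sums_summable[OF z0[OF s]] int])
  then have "((\<lambda>z. suminf (\<lambda>n. f n z)) has_field_derivative - zlog 1 s) (at s)"
    using sums_unique[OF z1] by simp
  then show ?thesis
  proof (rule DERIV_cong_ev[THEN iffD1, rotated -1])
    have "eventually (\<lambda>z. z \<in> {z. Re z > 1}) (nhds s)"
      using s by (intro eventually_nhds_in_open open_halfspace_Re_gt) auto
    then show "eventually (\<lambda>z. (suminf (\<lambda>n. f n z)) = zlog 0 z) (nhds s)"
      by eventually_elim (use z0 in \<open>simp add: sums_iff\<close>)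
  qed simp_all
qed

lemma zeta_difference_bound:
  assumes "1 < a" "a \<le> b" "\<And>x. a \<le> x \<Longrightarrow> x \<le> b \<Longrightarrow> norm (zlog 1 (Complex x t)) \<le> B"
  shows "norm (zlog 0 (Complex a t) - zlog 0 (Complex b t)) \<le> B * (b - a)"
proof -
  \<comment> \<open>The horizontal segment between the two points, written as an intersection of
    half planes so that convexity is immediate.\<close>
  define S where "S = {z. Re z \<ge> a} \<inter> {z. Re z \<le> b} \<inter> {z. Im z \<ge> t} \<inter> {z. Im z \<le> t}"
  have cvx: "convex S" unfolding S_def
    by (intro convex_Int convex_halfspace_Re_ge convex_halfspace_Re_le convex_halfspace_Im_ge convex_halfspace_Im_le)
  have der: "(zlog 0 has_field_derivative - zlog 1 z) (at z within S)" if "z \<in> S" for z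
    by (rule has_field_derivative_at_within[OF zeta_has_field_derivative]) (use that assms(1) in \<open>simp add: S_def\<close>)
  have bd: "norm (- zlog 1 z) \<le> B" if "z \<in> S" for z
  proof -
    have z: "a \<le> Re z" "Re z \<le> b" "Im z = t" using that by (simp_all add: S_def)
    have "z = Complex (Re z) t" using z(3) by (simp add: complex_eq_iff)
    then have "zlog 1 z = zlog 1 (Complex (Re z) t)" by (rule arg_cong)
    then show ?thesis unfolding norm_minus_cancel using assms(3)[OF z(1,2)] by (rule ssubst)
  qed
  have ab: "Complex a t \<in> S" "Complex b t \<in> S" using assms(2) by (simp_all add: S_def)
  have "norm (zlog 0 (Complex a t) - zlog 0 (Complex b t)) \<le> B * norm (Complex a t - Complex b t)"
    by (rule field_differentiable_bound[OF cvx der bd ab])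
  also have "Complex a t - Complex b t = of_real (a - b)" by (simp add: complex_eq_iff)
  also have "norm \<dots> = b - a" using assms(2) by (subst norm_of_real) simp
  finally show ?thesis .
qed

text \<open>Away from the pole, zeta and its first two derivatives are bounded by multiples of
  \<open>u = vweight t\<close>. The lower bound for zeta then loses \<open>u^4\<close>, the
  quotients by zeta grow like \<open>u^5\<close>, and the squared one like \<open>u^10\<close>. The
  exponent \<open>1 / 20\<close> is chosen so that \<open>u^10 = sqrt (1 + |t|)\<close>.\<close>

definition vweight :: "real \<Rightarrow> real" where
  "vweight t = (1 + \<bar>t\<bar>) powr (1 / 20)"

lemma vweight_ge_1: "vweight t \<ge> 1"
  unfolding vweight_def by (intro ge_one_powr_ge_zero) auto

text \<open>The 3-4-1 inequality involves zeta at height \<open>2 * t\<close>; this expresses its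
  growth through the weight at \<open>t\<close>.\<close>

lemma vweight_double: "vweight (2 * t) \<le> 2 * vweight t"
proof -
  have "vweight (2 * t) \<le> (2 * (1 + \<bar>t\<bar>)) powr (1 / 20)"
    unfolding vweight_def by (intro powr_mono2) auto
  also have "\<dots> = 2 powr (1 / 20) * vweight t" unfolding vweight_def by (rule powr_mult)
  also have "\<dots> \<le> 2 powr 1 * vweight t"
    using vweight_ge_1[of t] by (intro mult_right_mono powr_mono) auto
  finally show ?thesis by simp
qed

lemma vweight_small: "\<bar>t\<bar> \<le> 1 \<Longrightarrow> vweight t \<le> 2"
proof -
  assume "\<bar>t\<bar> \<le> 1"
  then have "vweight t \<le> 2 powr (1 / 20)" unfolding vweight_def by (intro powr_mono2) auto
  also have "\<dots> \<le> 2 powr 1" by (intro powr_mono) auto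
  finally show ?thesis by simp
qed

lemma vweight_power_10: "vweight t ^ 10 = sqrt (1 + \<bar>t\<bar>)"
proof -
  have "vweight t ^ 10 = vweight t powr 10"
    using vweight_ge_1[of t] by (subst powr_numeral) auto
  also have "\<dots> = (1 + \<bar>t\<bar>) powr (1 / 2)" unfolding vweight_def powr_powr by simp
  finally show ?thesis by (simp add: powr_half_sqrt)
qed

lemma zlog_uniform_approx:
  shows "\<exists>A\<ge>1. \<forall>k\<le>2. \<forall>\<sigma> t. 1 < \<sigma> \<longrightarrow> \<sigma> \<le> 2 \<longrightarrow>
    norm (zlog k (Complex \<sigma> t) - fact k / (Complex \<sigma> t - 1) ^ Suc k) \<le> A * vweight t"
proof -
  have "\<forall>k. \<exists>K>0. \<forall>s. Re s > 1 \<longrightarrow> norm (zlog k s - fact k / (s - 1) ^ Suc k) \<le> K * (real k + norm s) powr (1 / 20)"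
    by (intro allI zlog_approx) auto
  from choice[OF this] obtain K where K0: "\<forall>k. K k > 0 \<and> (\<forall>s. Re s > 1 \<longrightarrow>
    norm (zlog k s - fact k / (s - 1) ^ Suc k) \<le> K k * (real k + norm s) powr (1 / 20))" ..
  have K: "K k > 0" for k using spec[OF K0, of k] by (rule conjunct1)
  have K2: "norm (zlog k s - fact k / (s - 1) ^ Suc k) \<le> K k * (real k + norm s) powr (1 / 20)"
    if "Re s > 1" for k s
    using that by (rule spec[OF K0, of k, THEN conjunct2, THEN spec, THEN mp])
  \<comment> \<open>The factor \<open>4\<close> comes from
    \<open>k + norm s \<le> 4 * (1 + |t|)\<close> for \<open>k \<le> 2\<close> and
    \<open>\<sigma> \<le> 2\<close>.\<close>
  define A where "A = 1 + 4 * (K 0 + K 1 + K 2)"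
  have A1: "A \<ge> 1" using K[of 0] K[of 1] K[of 2] by (simp add: A_def)
  show ?thesis
  proof (rule exI[of _ A], intro conjI A1 allI impI)
    fix k :: nat and \<sigma> t :: real
    assume k: "k \<le> 2" and \<sigma>: "1 < \<sigma>" "\<sigma> \<le> 2"
    have KA: "4 * K k \<le> A"
    proof -
      have "k = 0 \<or> k = 1 \<or> k = 2" using k by linarith
      then show ?thesis using K[of 0] K[of 1] K[of 2] unfolding A_def by (elim disjE) simp_all
    qed
    have "norm (Complex \<sigma> t) \<le> \<sigma> + \<bar>t\<bar>" using cmod_le[of "Complex \<sigma> t"] \<sigma> by simp
    then have "real k + norm (Complex \<sigma> t) \<le> 2 + (2 + \<bar>t\<bar>)"
      using k \<sigma> by (intro add_mono) simp_all
    also have "\<dots> \<le> 4 * (1 + \<bar>t\<bar>)" by simp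
    finally have "real k + norm (Complex \<sigma> t) \<le> 4 * (1 + \<bar>t\<bar>)" .
    then have "(real k + norm (Complex \<sigma> t)) powr (1 / 20) \<le> (4 * (1 + \<bar>t\<bar>)) powr (1 / 20)"
      by (intro powr_mono2) auto
    also have "\<dots> = 4 powr (1 / 20) * vweight t" unfolding vweight_def by (rule powr_mult)
    also have "\<dots> \<le> 4 powr 1 * vweight t"
      using vweight_ge_1[of t] by (intro mult_right_mono powr_mono) auto
    finally have "(real k + norm (Complex \<sigma> t)) powr (1 / 20) \<le> 4 * vweight t" by simp
    then have "K k * (real k + norm (Complex \<sigma> t)) powr (1 / 20) \<le> K k * (4 * vweight t)"
      using K[of k] by (intro mult_left_mono) auto
    also have "\<dots> = (4 * K k) * vweight t" by simp
    also have "\<dots> \<le> A * vweight t" using KA vweight_ge_1[of t] by (intro mult_right_mono) auto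
    finally have KA': "K k * (real k + norm (Complex \<sigma> t)) powr (1 / 20) \<le> A * vweight t" .
    have "1 < Re (Complex \<sigma> t)" using \<sigma> by simp
    from order.trans[OF K2[OF this] KA']
    show "norm (zlog k (Complex \<sigma> t) - fact k / (Complex \<sigma> t - 1) ^ Suc k) \<le> A * vweight t" .
  qed
qed

subsection \<open>Lower bound for zeta and the pole cancellation\<close>

text \<open>The 3-4-1 inequality is solved for its middle factor, the factor at the real point
  contributing the third power of the pole and the factor at \<open>2 * t\<close> a single power of
  the growth bound \<open>u\<close>.\<close>

lemma zeta_341_lower:
  fixes A D E u :: real
  assumes \<sigma>: "1 < \<sigma>" and A: "A \<ge> 1" and D: "D \<ge> 1" and u: "u \<ge> 1"
    and z1: "norm (zlog 0 (of_real \<sigma>)) \<le> (1 + A) / (\<sigma> - 1)"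
    and z3: "norm (zlog 0 (Complex \<sigma> (2 * t))) \<le> 2 * D * u"
    and E: "E = (1 + A) ^ 3 * (2 * D)"
  shows "norm (zlog 0 (Complex \<sigma> t)) ^ 4 \<ge> (\<sigma> - 1) ^ 3 / (E * u)"
proof -
  let ?z = "norm (zlog 0 (Complex \<sigma> t)) ^ 4"
  have Eu: "E * u > 0" unfolding E using A D u by (intro mult_pos_pos zero_less_power) linarith+
  have "1 \<le> norm (zlog 0 (of_real \<sigma>)) ^ 3 * ?z * norm (zlog 0 (Complex \<sigma> (2 * t)))"
    by (rule zeta_341[OF \<sigma>])
  also have "\<dots> \<le> ((1 + A) / (\<sigma> - 1)) ^ 3 * ?z * (2 * D * u)"
    using A \<sigma> by (intro mult_mono power_mono z1 z3 mult_nonneg_nonneg zero_le_power divide_nonneg_nonneg norm_ge_zero order_refl) linarith+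
  also have "\<dots> = ?z * (E * u) / (\<sigma> - 1) ^ 3"
    unfolding E power_divide by (simp only: times_divide_eq_left times_divide_eq_right mult_ac)
  finally have "(\<sigma> - 1) ^ 3 \<le> ?z * (E * u)"
    using \<sigma> by (simp only: le_divide_eq zero_less_power diff_gt_0_iff_gt if_True mult_1_left)
  then show ?thesis using Eu by (simp only: pos_divide_le_eq)
qed

text \<open>
  Within distance \<open>\<eta>\<close> of the line \<open>Re s = 1\<close> the lower bound is transported from the abscissa \<open>1 + \<eta>\<close>;
  \<open>\<eta> = \<kappa> / u^5\<close> balances the 3-4-1 bound there against the bound for the derivative.
\<close>

lemma zeta_lower_bound_aux:
  fixes A D E u r \<kappa> :: real
  assumes A: "A \<ge> 1" and D: "D \<ge> 1" and u: "u \<ge> 1" and E: "E = (1 + A) ^ 3 * (2 * D)"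
    and \<kappa>: "\<kappa> = 1 / (16 * E * D ^ 4)" and \<sigma>: "1 < \<sigma>" "\<sigma> \<le> 2"
    and z1: "\<And>x. 1 < x \<Longrightarrow> x \<le> 2 \<Longrightarrow> norm (zlog 0 (of_real x)) \<le> (1 + A) / (x - 1)"
    and z3: "\<And>x. \<sigma> \<le> x \<Longrightarrow> x \<le> 2 \<Longrightarrow> norm (zlog 0 (Complex x (2 * t))) \<le> 2 * D * u"
    and zd: "\<And>x. \<sigma> \<le> x \<Longrightarrow> x \<le> 2 \<Longrightarrow> norm (zlog 1 (Complex x t)) \<le> D * u"
  shows "norm (zlog 0 (Complex \<sigma> t)) \<ge> \<kappa> * D / u ^ 4"
proof -
  have E1: "E \<ge> 1"
  proof -
    have "1 \<le> (1 + A) ^ 3" using A by (intro one_le_power) linarith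
    moreover have "1 \<le> 2 * D" using D by linarith
    ultimately have "1 * 1 \<le> (1 + A) ^ 3 * (2 * D)" by (intro mult_mono) linarith+
    then show ?thesis unfolding E by linarith
  qed
  have D4: "D ^ 4 \<ge> 1" using D by (rule one_le_power)
  have ED: "16 * E * D ^ 4 \<ge> 1"
  proof -
    have "1 * 1 \<le> (16 * E) * D ^ 4" using E1 D4 by (intro mult_mono) linarith+
    then show ?thesis by linarith
  qed
  have k0: "\<kappa> > 0" unfolding \<kappa> using ED by (intro divide_pos_pos) linarith+
  have k1: "\<kappa> \<le> 1" unfolding \<kappa> using ED by (subst divide_le_eq_1_pos) linarith+
  \<comment> \<open>This normalization of \<open>\<kappa>\<close> makes the 3-4-1 bound at distance
    \<open>\<eta>\<close> exactly twice the loss incurred in moving from \<open>1 + \<eta>\<close>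
    to the left.\<close>
  have k2: "16 * \<kappa> * D ^ 4 * E = 1" 
  proof -
    have "16 * E * D ^ 4 \<noteq> 0" using ED by linarith
    then have "1 / (16 * E * D ^ 4) * (16 * E * D ^ 4) = 1" by simp
    then show ?thesis unfolding \<kappa> by (simp only: mult_ac)
  qed
  define \<eta> where "\<eta> = \<kappa> / u ^ 5"
  have u5: "u ^ 5 \<ge> 1" and u4: "u ^ 4 \<ge> 1" using u by (intro one_le_power; assumption)+
  have \<eta>: "\<eta> > 0" unfolding \<eta>_def using k0 u5 by (intro divide_pos_pos) linarith+
  have \<eta>1: "\<eta> \<le> 1"
  proof -
    have "\<eta> \<le> \<kappa> / 1" unfolding \<eta>_def using k0 u5 by (intro divide_left_mono) linarith+
    then show ?thesis using k1 by linarith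
  qed
  have main: "norm (zlog 0 (Complex x t)) \<ge> 2 * \<kappa> * D / u ^ 4" if x: "\<sigma> \<le> x" "x \<le> 2" "x - 1 \<ge> \<eta>" for x
  proof -
    have x1: "1 < x" using x \<sigma> by linarith
    \<comment> \<open>The fourth power of twice the target equals
      \<open>\<eta> ^ 3 / (E * u)\<close>, which is the 3-4-1 bound at distance
      \<open>\<eta>\<close>.\<close>
    have "(2 * \<kappa> * D / u ^ 4) ^ 4 = 2 ^ 4 * (\<kappa> * \<kappa> ^ 3) * D ^ 4 / u ^ 16"
      by (simp only: power_divide power_mult_distrib power_mult[symmetric] power_Suc[symmetric]) simp
    also have "\<dots> = (16 * \<kappa> * D ^ 4 * E) * \<kappa> ^ 3 / (E * u ^ 16)"
      using E1 by simp
    also have "\<dots> = \<eta> ^ 3 / (E * u)"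
    proof -
      have "u ^ 16 = (u ^ 5) ^ 3 * u" by (simp only: power_mult[symmetric] power_Suc2[symmetric]) simp
      then show ?thesis unfolding k2 \<eta>_def power_divide by (simp add: mult_ac)
    qed
    also have "\<dots> \<le> (x - 1) ^ 3 / (E * u)"
      using x \<eta> E1 u by (intro divide_right_mono power_mono mult_nonneg_nonneg) linarith+
    also have "\<dots> \<le> norm (zlog 0 (Complex x t)) ^ 4"
      by (rule zeta_341_lower[OF x1 A D u z1[OF x1 x(2)] z3[OF x(1,2)] E])
    finally show ?thesis by (rule power_le_imp_le_base[of _ 3, unfolded Suc_numeral, simplified]) simp
  qed
  show ?thesis
  proof (cases "\<sigma> - 1 \<ge> \<eta>")
    case True
    have "\<kappa> * D / u ^ 4 \<ge> 0" using k0 D u4 by (intro divide_nonneg_nonneg mult_nonneg_nonneg) linarith+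
    moreover have "2 * \<kappa> * D / u ^ 4 = 2 * (\<kappa> * D / u ^ 4)" by simp
    ultimately have "\<kappa> * D / u ^ 4 \<le> 2 * \<kappa> * D / u ^ 4" by (metis mult_2 le_add_same_cancel1)
    also have "\<dots> \<le> norm (zlog 0 (Complex \<sigma> t))" by (rule main) (use True \<sigma> in linarith)+
    finally show ?thesis .
  next
    case False
    \<comment> \<open>Moving from \<open>?x\<close> to \<open>\<sigma>\<close> changes zeta by at
      most \<open>D * u * \<eta> = \<kappa> * D / u ^ 4\<close>, which is half of its lower bound at
      \<open>?x\<close>.\<close>
    let ?x = "1 + \<eta>"
    have x: "\<sigma> \<le> ?x" "?x \<le> 2" "?x - 1 \<ge> \<eta>" using False \<eta>1 by linarith+
    have "norm (zlog 0 (Complex \<sigma> t) - zlog 0 (Complex ?x t)) \<le> D * u * (?x - \<sigma>)"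
      by (rule zeta_difference_bound[OF \<sigma>(1) x(1)], rule zd) (use x in linarith)+
    also have "\<dots> \<le> D * u * \<eta>" using D u \<sigma> by (intro mult_left_mono mult_nonneg_nonneg) linarith+
    also have "\<dots> = \<kappa> * D / u ^ 4" 
    proof -
      have "u ^ 5 = u * u ^ 4" by (simp only: power_Suc[symmetric]) simp
      then show ?thesis unfolding \<eta>_def using u by simp
    qed
    finally have "norm (zlog 0 (Complex \<sigma> t) - zlog 0 (Complex ?x t)) \<le> \<kappa> * D / u ^ 4" .
    moreover have "2 * (\<kappa> * D / u ^ 4) \<le> norm (zlog 0 (Complex ?x t))"
      using main[OF x] by simp
    moreover have "norm (zlog 0 (Complex ?x t)) \<le> norm (zlog 0 (Complex \<sigma> t)) + norm (zlog 0 (Complex \<sigma> t) - zlog 0 (Complex ?x t))"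
      by (metis norm_triangle_sub norm_minus_commute)
    moreover have "m \<le> x" if "d \<le> m" "2 * m \<le> y" "y \<le> x + d" for d m x y :: real
      using that by linarith
    ultimately show ?thesis by blast
  qed
qed

abbreviation mangoldt_diff :: "nat \<Rightarrow> real" where
  "mangoldt_diff \<equiv> \<lambda>n. mangoldt n * ln (real n) - ln (real n)"

text \<open>The two convolution identities form a triangular linear system for the series of
  \<open>mangoldt n\<close> and of \<open>mangoldt n * ln n\<close>; it can be solved wherever zeta
  does not vanish.\<close>

lemma dconv_mangoldt_diff: "Re s > 1 \<Longrightarrow> dconv mangoldt_diff s"
  and dser_mangoldt_diff: "Re s > 1 \<Longrightarrow> zlog 0 s \<noteq> 0 \<Longrightarrow>
    dser mangoldt_diff s = zlog 2 s / zlog 0 s - (zlog 1 s / zlog 0 s)\<^sup>2 - zlog 1 s"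
proof -
  assume s: "Re s > 1"
  have c1: "dconv (\<lambda>n. ln (real n)) s" using dconv_log[OF s, of 1] by (simp only: power_one_right)
  note c2 = dconv_mangoldt_log[OF s]
  show "dconv mangoldt_diff s"
    using summable_on_add[OF c2[unfolded dconv_def] summable_on_uminus[THEN iffD2, OF c1[unfolded dconv_def]]]
    unfolding dconv_def by (simp add: left_diff_distrib)
  assume z: "zlog 0 s \<noteq> 0"
  define P P1 Z Z1 Z2 where "P = dser mangoldt s" and "P1 = dser (\<lambda>n. mangoldt n * ln (real n)) s"
    and "Z = zlog 0 s" and "Z1 = zlog 1 s" and "Z2 = zlog 2 s"
  have e: "P * Z = Z1" "P1 * Z + P * Z1 = Z2" "Z \<noteq> 0"
    using zlog_mangoldt[OF s] z unfolding P_def P1_def Z_def Z1_def Z2_def by blast+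
  have P: "P = Z1 / Z" using e by (simp add: field_simps)
  have "P1 * Z = Z2 - P * Z1" using e(2) by (simp add: algebra_simps)
  then have "P1 = (Z2 - P * Z1) / Z" using e(3) by (simp add: field_simps)
  also have "\<dots> = Z2 / Z - (Z1 / Z)\<^sup>2" unfolding P by (simp add: diff_divide_distrib power2_eq_square)
  finally have "P1 = Z2 / Z - (Z1 / Z)\<^sup>2" .
  moreover have "dser mangoldt_diff s = P1 - Z1"
    using dser_diff[OF c2 c1] unfolding P1_def Z1_def by (simp only: power_one_right)
  ultimately show "dser mangoldt_diff s = zlog 2 s / zlog 0 s - (zlog 1 s / zlog 0 s)\<^sup>2 - zlog 1 s"
    unfolding Z_def Z1_def Z2_def by simp
qed

text \<open>Here \<open>a, b, c\<close> are the regular parts of the three series and \<open>w = s - 1\<close>: the poles cancel.\<close>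

lemma pole_cancellation:
  fixes a b c w :: complex and B :: real
  assumes w: "w \<noteq> 0" "norm w \<le> 1 / (2 * B)" and B: "B \<ge> 1" and abc: "norm a \<le> B" "norm b \<le> B" "norm c \<le> B"
  shows "1 / w + a \<noteq> 0"
    and "norm ((2 / w ^ 3 + c) / (1 / w + a) - ((1 / w ^ 2 + b) / (1 / w + a)) ^ 2 - (1 / w ^ 2 + b)) \<le> 40 * B ^ 2"
proof -
  have w1: "norm w \<le> 1"
  proof -
    have "1 / (2 * B) \<le> 1" using B by (simp add: divide_le_eq)
    then show ?thesis using w(2) by linarith
  qed
  have "norm (a * w) \<le> B * (1 / (2 * B))" unfolding norm_mult using abc w B by (intro mult_mono) auto
  also have "\<dots> = 1 / 2" using B by simp
  finally have aw: "norm (a * w) \<le> 1 / 2" .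
  have "norm (1::complex) \<le> norm (1 + a * w) + norm (a * w)"
    using norm_triangle_ineq4[of "1 + a * w" "a * w"] by (simp only: add_diff_cancel_right')
  then have q: "norm (1 + a * w) \<ge> 1 / 2" using aw by (simp only: norm_one)
  then have q0: "1 + a * w \<noteq> 0" by auto
  have e: "1 / w + a = (1 + a * w) / w" using w(1) by (simp add: field_simps)
  show "1 / w + a \<noteq> 0" unfolding e using q0 w(1) by simp
  \<comment> \<open>Over the common denominator \<open>w ^ 2 * (1 + a * w) ^ 2\<close> the constant
    terms \<open>2 - 1 - 1\<close> and the linear terms \<open>2 * a - 2 * a\<close> cancel;
    \<open>?N\<close> is the numerator divided by \<open>w ^ 2\<close>.\<close>
  let ?N = "- 2 * b - a ^ 2 + c * w + (c * a - b ^ 2) * w ^ 2"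
  have "(2 / w ^ 3 + c) / (1 / w + a) - ((1 / w ^ 2 + b) / (1 / w + a)) ^ 2 - (1 / w ^ 2 + b)
      = ?N / (1 + a * w) ^ 2 - b"
  proof -
    have 1: "(2 / w ^ 3 + c) / ((1 + a * w) / w) = (2 + c * w ^ 3) * (1 + a * w) / (w ^ 2 * (1 + a * w) ^ 2)"
    proof -
      have "2 / w ^ 3 + c = (2 + c * w ^ 3) / w ^ 3" using w(1) by (simp add: add_divide_distrib)
      moreover have "x / w ^ 3 / (y / w) = x * y / (w ^ 2 * y ^ 2)" if "y \<noteq> 0" for x y
        using w(1) that by (simp add: power2_eq_square power3_eq_cube)
      ultimately show ?thesis using q0 by (simp only:)
    qed
    have 2: "((1 / w ^ 2 + b) / ((1 + a * w) / w)) ^ 2 = (1 + b * w ^ 2) ^ 2 / (w ^ 2 * (1 + a * w) ^ 2)"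
      using w(1) q0 by (simp add: divide_simps)
    have 3: "1 / w ^ 2 + b = (1 + a * w) ^ 2 / (w ^ 2 * (1 + a * w) ^ 2) + b"
      using w(1) q0 by simp
    have 4: "?N / (1 + a * w) ^ 2 = w ^ 2 * ?N / (w ^ 2 * (1 + a * w) ^ 2)" using w(1) by simp
    have 5: "(2 + c * w ^ 3) * (1 + a * w) - (1 + b * w ^ 2) ^ 2 - (1 + a * w) ^ 2 = w ^ 2 * ?N"
      by (simp add: algebra_simps power2_eq_square power3_eq_cube)
    show ?thesis unfolding e 1 2 4 5[symmetric] by (subst 3) (simp add: diff_divide_distrib)
  qed
  also have "norm \<dots> \<le> norm ?N / norm (1 + a * w) ^ 2 + norm b"
    using norm_triangle_ineq4[of "?N / (1 + a * w) ^ 2" b] by (simp only: norm_divide norm_power)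
  also have "\<dots> \<le> 6 * B ^ 2 / (1 / 2) ^ 2 + B ^ 2"
  proof (intro add_mono frac_le)
    have BB: "B \<le> B ^ 2" using B by (simp add: power2_eq_square)
    have n1: "norm (a ^ 2) \<le> B ^ 2" "norm (b ^ 2) \<le> B ^ 2" unfolding norm_power using abc by (auto intro: power_mono)
    have n2: "norm (c * a) \<le> B ^ 2" unfolding norm_mult power2_eq_square using abc B by (intro mult_mono) auto
    have n3: "norm (c * w) \<le> B" unfolding norm_mult using abc w1 B mult_mono[of "norm c" B "norm w" 1] by simp
    have n4: "norm ((c * a - b ^ 2) * w ^ 2) \<le> 2 * B ^ 2"
    proof -
      have "norm (c * a - b ^ 2) \<le> B ^ 2 + B ^ 2" by (rule order.trans[OF norm_triangle_ineq4 add_mono[OF n2 n1(2)]])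
      moreover have "norm (w ^ 2) \<le> 1" unfolding norm_power using w1 by (intro power_le_one) auto
      ultimately have "norm (c * a - b ^ 2) * norm (w ^ 2) \<le> (B ^ 2 + B ^ 2) * 1" by (intro mult_mono) auto
      then show ?thesis unfolding norm_mult by simp
    qed
    have n5: "norm (- 2 * b) \<le> 2 * B" unfolding norm_mult using abc by simp
    have "norm ?N \<le> norm (- 2 * b) + norm (a ^ 2) + norm (c * w) + norm ((c * a - b ^ 2) * w ^ 2)"
      by (intro order.trans[OF norm_triangle_ineq] order.trans[OF norm_triangle_ineq4] add_mono order_refl)
    also have "\<dots> \<le> 2 * B + B ^ 2 + B + 2 * B ^ 2" by (intro add_mono n1 n3 n4 n5)
    also have "\<dots> \<le> 6 * B ^ 2" using BB by linarith
    finally show "norm ?N \<le> 6 * B ^ 2" .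
    show "(1 / 2) ^ 2 \<le> norm (1 + a * w) ^ 2" using q by (intro power_mono) auto
    show "norm b \<le> B ^ 2" using abc(2) BB by linarith
  qed auto
  also have "\<dots> \<le> 40 * B ^ 2" by (simp add: power2_eq_square)
  finally show "norm ((2 / w ^ 3 + c) / (1 / w + a) - ((1 / w ^ 2 + b) / (1 / w + a)) ^ 2 - (1 / w ^ 2 + b)) \<le> 40 * B ^ 2" .
qed

lemma norm_pole_le:
  fixes w :: complex
  assumes "norm w \<ge> r" "0 < r" "r \<le> 1" "k \<le> 2"
  shows "norm (fact k / w ^ Suc k) \<le> 2 / r ^ 3"
proof -
  have "norm (fact k / w ^ Suc k) = fact k / norm w ^ Suc k"
    unfolding norm_divide norm_power by (simp only: norm_fact)
  also have "\<dots> \<le> 2 / r ^ 3"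
  proof (rule frac_le)
    have "(fact k :: real) \<le> fact 2" using assms(4) by (rule fact_mono)
    then show "(fact k :: real) \<le> 2" by (simp add: fact_numeral)
    have "r ^ 3 \<le> r ^ Suc k" using assms by (intro power_decreasing) auto
    also have "\<dots> \<le> norm w ^ Suc k" using assms by (intro power_mono) auto
    finally show "r ^ 3 \<le> norm w ^ Suc k" .
  qed (use assms in auto)
  finally show ?thesis .
qed

text \<open>Two regimes: in the disc of radius \<open>r\<close> around \<open>1\<close> the poles
  cancel, and outside it the polar parts are bounded by constants, so the growth bounds and the
  lower bound for zeta apply.\<close>

lemma dser_mangoldt_diff_bound:
  "\<exists>C>0. \<forall>\<sigma> t. 1 < \<sigma> \<longrightarrow> \<sigma> \<le> 2 \<longrightarrow> norm (dser mangoldt_diff (Complex \<sigma> t)) \<le> C * sqrt (1 + \<bar>t\<bar>)"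
proof -
  obtain A where A: "A \<ge> 1" and approx0: "\<forall>k\<le>2. \<forall>\<sigma> t. 1 < \<sigma> \<longrightarrow> \<sigma> \<le> 2 \<longrightarrow>
    norm (zlog k (Complex \<sigma> t) - fact k / (Complex \<sigma> t - 1) ^ Suc k) \<le> A * vweight t"
    using zlog_uniform_approx by blast
  have approx: "norm (zlog k (Complex \<sigma> t) - fact k / (Complex \<sigma> t - 1) ^ Suc k) \<le> A * vweight t"
    if "k \<le> 2" "1 < \<sigma>" "\<sigma> \<le> 2" for k \<sigma> t
    using approx0[rule_format, OF that] .
  \<comment> \<open>In the disc \<open>|t| \<le> 1\<close>, so the weight is at most
    \<open>2\<close> and \<open>B\<close> bounds the regular parts; \<open>r\<close> is the radius
    that the pole cancellation permits for this \<open>B\<close>.\<close>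
  define B where "B = 2 * A"
  define r where "r = 1 / (2 * B)"
  define D where "D = 2 / r ^ 3 + A"
  define E where "E = (1 + A) ^ 3 * (2 * D)"
  define \<kappa> where "\<kappa> = 1 / (16 * E * D ^ 4)"
  define m where "m = \<kappa> * D"
  define C where "C = 40 * B ^ 2 + (D / m + (D / m) ^ 2 + D)"
  have B: "B \<ge> 1" using A by (simp add: B_def)
  have r: "0 < r" "r \<le> 1" using B by (simp_all add: r_def divide_le_eq)
  have D: "D \<ge> 1" using r A by (simp add: D_def add_increasing)
  have "E > 0" unfolding E_def using A D by (intro mult_pos_pos zero_less_power) linarith+
  then have \<kappa>: "\<kappa> > 0" unfolding \<kappa>_def using D by (intro divide_pos_pos mult_pos_pos zero_less_power) linarith+
  then have m: "m > 0" unfolding m_def using D by (intro mult_pos_pos) linarith+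
  have C1: "40 * B ^ 2 > 0" using B by (intro mult_pos_pos zero_less_power) linarith+
  have C2: "D / m + (D / m) ^ 2 + D > 0" using D m by (intro add_pos_pos divide_pos_pos zero_less_power) linarith+
  have C0: "C > 0" unfolding C_def using C1 C2 by (rule add_pos_pos)
  have far: "norm (zlog k (Complex \<sigma> t)) \<le> D * vweight t"
    if "k \<le> 2" "1 < \<sigma>" "\<sigma> \<le> 2" "norm (Complex \<sigma> t - 1) \<ge> r" for k \<sigma> t
  proof -
    have "norm (zlog k (Complex \<sigma> t)) \<le> norm (fact k / (Complex \<sigma> t - 1) ^ Suc k) +
        norm (zlog k (Complex \<sigma> t) - fact k / (Complex \<sigma> t - 1) ^ Suc k)"
      by (rule norm_triangle_sub)
    also have "\<dots> \<le> 2 / r ^ 3 + A * vweight t"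
      by (intro add_mono norm_pole_le approx that r)
    also have "\<dots> \<le> 2 / r ^ 3 * vweight t + A * vweight t"
      using vweight_ge_1[of t] r mult_left_mono[of 1 "vweight t" "2 / r ^ 3"] by simp
    finally show ?thesis by (simp only: D_def distrib_right)
  qed
  \<comment> \<open>The 3-4-1 inequality uses real points arbitrarily close to \<open>1\<close>,
    where the pole has to be kept explicitly.\<close>
  have real_bound: "norm (zlog 0 (of_real x)) \<le> (1 + A) / (x - 1)" if x: "1 < x" "x \<le> 2" for x
  proof -
    have "norm (zlog 0 (Complex x 0)) \<le> norm (fact 0 / (Complex x 0 - 1) ^ Suc 0) +
        norm (zlog 0 (Complex x 0) - fact 0 / (Complex x 0 - 1) ^ Suc 0)"
      by (rule norm_triangle_sub)
    also have "\<dots> \<le> norm (fact 0 / (Complex x 0 - 1) ^ Suc 0) + A * vweight 0"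
      by (intro add_mono order_refl approx x) simp
    also have "Complex x 0 - 1 = of_real (x - 1)" by (simp add: complex_eq_iff)
    also have "norm (fact 0 / complex_of_real (x - 1) ^ Suc 0) = 1 / (x - 1)"
      using x by (simp only: norm_divide norm_power norm_of_real norm_fact fact_0 power_Suc0_right) simp
    also have "vweight 0 = 1" by (simp add: vweight_def)
    also have "1 / (x - 1) + A * 1 \<le> 1 / (x - 1) + A / (x - 1)"
      using A x by (intro add_mono order_refl) (simp add: le_divide_eq mult_left_le)
    finally have "norm (zlog 0 (Complex x 0)) \<le> (1 + A) / (x - 1)" by (simp only: add_divide_distrib)
    moreover have cx: "complex_of_real x = Complex x 0" by (simp add: complex_eq_iff)
    ultimately show ?thesis unfolding cx by (simp only:)
  qed
  have "norm (dser mangoldt_diff (Complex \<sigma> t)) \<le> C * vweight t ^ 10" if \<sigma>: "1 < \<sigma>" "\<sigma> \<le> 2" for \<sigma> t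
  proof -
    define s where "s = Complex \<sigma> t"
    define u where "u = vweight t"
    have s1: "Re s > 1" using \<sigma> by (simp add: s_def)
    have u: "u \<ge> 1" unfolding u_def by (rule vweight_ge_1)
    have u10: "u ^ 10 \<ge> 1" using u by (rule one_le_power)
    show ?thesis
    proof (cases "norm (s - 1) \<le> r")
      case True
      define w where "w = s - 1"
      have w0: "w \<noteq> 0" using s1 by (auto simp: w_def)
      have "\<bar>Im w\<bar> \<le> 1" using abs_Im_le_cmod[of w] True r by (simp add: w_def)
      then have "\<bar>t\<bar> \<le> 1" by (simp add: w_def s_def)
      then have "A * vweight t \<le> B" using vweight_small[of t] A by (simp add: B_def)
      then have ap: "norm (zlog k s - fact k / w ^ Suc k) \<le> B" if "k \<le> 2" for k
        using approx[OF that \<sigma>, of t] unfolding s_def w_def by linarith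
      define a b c where "a = zlog 0 s - 1 / w" and "b = zlog 1 s - 1 / w ^ 2" and "c = zlog 2 s - 2 / w ^ 3"
      have abc: "norm a \<le> B" "norm b \<le> B" "norm c \<le> B"
        using ap[of 0] ap[of 1] ap[of 2] by (simp_all add: a_def b_def c_def numeral_2_eq_2 numeral_3_eq_3)
      have z: "zlog 0 s = 1 / w + a" "zlog 1 s = 1 / w ^ 2 + b" "zlog 2 s = 2 / w ^ 3 + c"
        by (simp_all add: a_def b_def c_def)
      note pc = pole_cancellation[OF w0 _ B abc]
      have wr: "norm w \<le> 1 / (2 * B)" using True by (simp only: w_def r_def)
      have "norm (dser mangoldt_diff s) \<le> 40 * B ^ 2"
        using pc(2)[OF wr] unfolding dser_mangoldt_diff[OF s1, unfolded z, OF pc(1)[OF wr]] .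
      also have "\<dots> \<le> C * 1" using C2 unfolding C_def by (simp only: mult_1_right le_add_same_cancel1 less_imp_le)
      also have "\<dots> \<le> C * u ^ 10" using u10 C0 by (intro mult_left_mono) linarith+
      finally show ?thesis by (simp only: s_def u_def)
    next
      case False
      \<comment> \<open>Moving to the right or away from the real axis only increases the distance
        from \<open>1\<close>. Thus the far bounds hold at height \<open>2 * t\<close> and on the
        whole segment that the lower bound for zeta uses.\<close>
      have mono: "norm (Complex x v - 1) \<ge> r" if "\<sigma> \<le> x" "\<bar>t\<bar> \<le> \<bar>v\<bar>" for x v
      proof -
        have "norm (s - 1) \<le> norm (Complex x v - 1)"
          unfolding cmod_def using that \<sigma> by (intro real_sqrt_le_mono add_mono) (auto simp: s_def abs_le_square_iff intro: power_mono)
        then show ?thesis using False by linarith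
      qed
      have z3: "norm (zlog 0 (Complex x (2 * t))) \<le> 2 * D * u" if "\<sigma> \<le> x" "x \<le> 2" for x
      proof -
        have x: "1 < x" using that \<sigma> by linarith
        have tt: "\<bar>t\<bar> \<le> \<bar>2 * t\<bar>" by simp
        have "norm (zlog 0 (Complex x (2 * t))) \<le> D * vweight (2 * t)"
          by (rule far[OF _ x that(2) mono[OF that(1) tt]]) simp
        also have "\<dots> \<le> D * (2 * u)" unfolding u_def using D by (intro mult_left_mono vweight_double) linarith
        finally show ?thesis by (simp only: mult_ac)
      qed
      have zd: "norm (zlog k (Complex x t)) \<le> D * u" if "\<sigma> \<le> x" "x \<le> 2" "k \<le> 2" for x k
      proof -
        have x: "1 < x" using that \<sigma> by linarith
        show ?thesis unfolding u_def by (rule far[OF that(3) x that(2) mono[OF that(1) order_refl]])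
      qed
      have low: "m / u ^ 4 \<le> norm (zlog 0 s)"
        unfolding m_def s_def
        by (rule zeta_lower_bound_aux[OF A D u E_def \<kappa>_def \<sigma> real_bound z3 zd]) simp_all
      have u4: "u ^ 4 > 0" using u by (intro zero_less_power) linarith
      have mu: "m / u ^ 4 > 0" using m u4 by (rule divide_pos_pos)
      then have z0: "zlog 0 s \<noteq> 0" using low by auto
      have k: "norm (zlog k s) \<le> D * u" if "k \<le> 2" for k
        unfolding s_def by (rule zd[OF order_refl \<sigma>(2) that])
      have quot: "norm (zlog k s / zlog 0 s) \<le> D / m * u ^ 5" if "k \<le> 2" for k
      proof -
        have "norm (zlog k s / zlog 0 s) \<le> D * u / (m / u ^ 4)"
          unfolding norm_divide using D u by (intro frac_le k that mu low mult_nonneg_nonneg) linarith+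
        also have "\<dots> = D / m * (u * u ^ 4)" by simp
        also have "u * u ^ 4 = u ^ 5" by (simp only: power_Suc[symmetric]) simp
        finally show ?thesis .
      qed
      have "norm (dser mangoldt_diff s) \<le> norm (zlog 2 s / zlog 0 s) + norm ((zlog 1 s / zlog 0 s) ^ 2) + norm (zlog 1 s)"
        unfolding dser_mangoldt_diff[OF s1 z0]
        by (intro order.trans[OF norm_triangle_ineq4] add_mono order_refl)
      also have "\<dots> \<le> D / m * u ^ 5 + (D / m * u ^ 5) ^ 2 + D * u"
        unfolding norm_power by (intro add_mono quot k power_mono norm_ge_zero) simp_all
      also have "\<dots> \<le> D / m * u ^ 10 + (D / m) ^ 2 * u ^ 10 + D * u ^ 10"
      proof (intro add_mono mult_left_mono)
        show "u ^ 5 \<le> u ^ 10" using u by (intro power_increasing) auto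
        show "u \<le> u ^ 10" using u power_increasing[of 1 10 u] by simp
        show "(D / m * u ^ 5) ^ 2 \<le> (D / m) ^ 2 * u ^ 10" by (simp only: power_mult_distrib power_mult[symmetric]) simp
      qed (use D m in simp_all)
      also have "\<dots> = (D / m + (D / m) ^ 2 + D) * u ^ 10" by (simp only: distrib_right)
      also have "\<dots> \<le> C * u ^ 10" using u10 C1 unfolding C_def by (intro mult_right_mono) linarith+
      finally show ?thesis by (simp only: s_def u_def)
    qed
  qed
  then show ?thesis unfolding vweight_power_10
    using C0 by blast
qed

subsection \<open>Fourier inversion with an exponential kernel\<close>

definition expdist :: "real \<Rightarrow> real measure" where
  "expdist l = density lborel (exponential_density l)"

lemma real_distribution_expdist: "l > 0 \<Longrightarrow> real_distribution (expdist l)"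
  unfolding real_distribution_def real_distribution_axioms_def expdist_def
  by (simp add: prob_space_exponential_density)

lemma emeasure_expdist_Icc:
  assumes "l > 0" "0 \<le> a" "a \<le> b"
  shows "emeasure (expdist l) {a<..b} = ennreal (exp (- a * l) - exp (- b * l))"
proof -
  have "emeasure (expdist l) {a<..b} = (\<integral>\<^sup>+x. ennreal (exponential_density l x) * indicator {a<..b} x \<partial>lborel)"
    unfolding expdist_def by (subst emeasure_density) auto
  also have "\<dots> = (\<integral>\<^sup>+x. ennreal (l * exp (- x * l)) * indicator {a..b} x \<partial>lborel)"
  proof (rule nn_integral_cong_AE)
    have "AE x in lborel. x \<noteq> a" by (rule AE_lborel_singleton)
    then show "AE x in lborel. ennreal (exponential_density l x) * indicator {a<..b} x = ennreal (l * exp (- x * l)) * indicator {a..b} x"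
      by eventually_elim (use assms in \<open>auto simp: exponential_density_def indicator_def\<close>)
  qed
  also have "\<dots> = ennreal ((- exp (- b * l)) - (- exp (- a * l)))"
    using assms by (intro nn_integral_FTC_Icc) (auto intro!: derivative_eq_intros)
  finally show ?thesis by simp
qed

lemma measure_expdist:
  assumes "l > 0" "a \<le> b"
  shows "measure (expdist l) {a<..b} = exp (- max 0 a * l) - exp (- max 0 b * l)"
proof -
  have neg: "emeasure (expdist l) {x<..0} = 0" for x
  proof -
    have "emeasure (expdist l) {x<..0} = (\<integral>\<^sup>+y. ennreal (exponential_density l y) * indicator {x<..0} y \<partial>lborel)"
      unfolding expdist_def by (subst emeasure_density) auto
    also have "\<dots> = (\<integral>\<^sup>+y. 0 \<partial>(lborel::real measure))"
    proof (rule nn_integral_cong_AE)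
      have "AE y in (lborel::real measure). y \<noteq> 0" by (rule AE_lborel_singleton)
      then show "AE y in lborel. ennreal (exponential_density l y) * indicator {x<..0} y = 0"
        by eventually_elim (auto simp: exponential_density_def indicator_def)
    qed
    finally show ?thesis by simp
  qed
  have pos: "exp (- max 0 b * l) \<le> exp (- max 0 a * l)" using assms by (auto simp: max_def intro: mult_right_mono)
  have "emeasure (expdist l) {a<..b} = emeasure (expdist l) {max 0 a<..max 0 b}"
  proof (cases "a \<ge> 0")
    case False
    have "{a<..b} \<subseteq> {a<..0} \<union> {max 0 a<..max 0 b}" by auto
    then have "emeasure (expdist l) {a<..b} \<le> emeasure (expdist l) ({a<..0} \<union> {max 0 a<..max 0 b})"
      by (intro emeasure_mono) (simp_all add: expdist_def)
    also have "\<dots> \<le> emeasure (expdist l) {a<..0} + emeasure (expdist l) {max 0 a<..max 0 b}"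
      by (intro emeasure_subadditive) (simp_all add: expdist_def)
    also have "\<dots> = emeasure (expdist l) {max 0 a<..max 0 b}" by (simp add: neg)
    finally have 1: "emeasure (expdist l) {a<..b} \<le> emeasure (expdist l) {max 0 a<..max 0 b}" .
    have "emeasure (expdist l) {max 0 a<..max 0 b} \<le> emeasure (expdist l) {a<..b}"
      using False by (cases "b \<ge> 0") (auto intro!: emeasure_mono simp: expdist_def)
    with 1 show ?thesis by (rule antisym)
  qed (use assms in \<open>simp add: max_def\<close>)
  also have "\<dots> = ennreal (exp (- max 0 a * l) - exp (- max 0 b * l))"
    using assms by (intro emeasure_expdist_Icc) auto
  finally show ?thesis using pos by (simp add: measure_def)
qed

lemma measure_expdist_singleton: "measure (expdist l) {a} = 0"
proof -
  have "emeasure (expdist l) {a} = (\<integral>\<^sup>+x. ennreal (exponential_density l x) * indicator {a} x \<partial>lborel)"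
    unfolding expdist_def by (subst emeasure_density) auto
  also have "\<dots> = (\<integral>\<^sup>+y. 0 \<partial>(lborel::real measure))"
  proof (rule nn_integral_cong_AE)
    have "AE y in (lborel::real measure). y \<noteq> a" by (rule AE_lborel_singleton)
    then show "AE y in lborel. ennreal (exponential_density l y) * indicator {a} y = 0"
      by eventually_elim (auto simp: indicator_def)
  qed
  finally show ?thesis by (simp add: measure_def)
qed

text \<open>With \<open>z = \<i> * t - l\<close> the integrand is \<open>l * exp (z * x)\<close> on
  the half line; its antiderivative decays, and the value at \<open>0\<close> gives the
  formula.\<close>

lemma char_expdist:
  assumes l: "l > 0"
  shows "char (expdist l) t = of_real l / (of_real l - \<i> * of_real t)"
proof -
  define z where "z = \<i> * complex_of_real t - of_real l"
  have z: "z \<noteq> 0" using l by (auto simp: z_def complex_eq_iff)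
  let ?f = "\<lambda>x::real. of_real l * exp (z * of_real x)"
  have nrm: "norm (?f x) = l * exp (- x * l)" for x using l by (simp add: norm_mult z_def mult.commute)
  have lim: "((\<lambda>x::real. exp (z * of_real x)) \<longlongrightarrow> 0) at_top"
  proof (rule tendsto_norm_zero_cancel)
    have "((\<lambda>x::real. exp (- l * x)) \<longlongrightarrow> 0) at_top" using l by real_asymp
    then show "((\<lambda>x::real. norm (exp (z * of_real x))) \<longlongrightarrow> 0) at_top" by (simp add: z_def)
  qed
  have int: "set_integrable lborel {0..} ?f"
  proof -
    have "integrable lborel (\<lambda>x. exponential_density l x)"
      using prob_space_exponential_density[OF l] l
      by (intro integrableI_nonneg)
        (auto simp: exponential_density_nonneg prob_space.emeasure_space_1 emeasure_density dest!: prob_space.emeasure_space_1)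
    then have "integrable lborel (\<lambda>x. indicator {0..} x *\<^sub>R ?f x)"
      by (rule Bochner_Integration.integrable_bound)
        (auto simp: nrm[unfolded norm_mult] norm_mult exponential_density_def indicator_def z_def mult.commute)
    then show ?thesis unfolding set_integrable_def .
  qed
  have der: "((\<lambda>x::real. of_real l / z * exp (z * of_real x)) has_vector_derivative ?f x) (at x)" for x
  proof -
    have "((\<lambda>y. of_real l / z * exp (z * y)) has_field_derivative of_real l * exp (z * of_real x)) (at (of_real x))"
      using z by (auto intro!: derivative_eq_intros)
    then show ?thesis by (rule has_vector_derivative_real_field)
  qed
  have "char (expdist l) t = (CLINT x|density lborel (exponential_density l). iexp (t * x))"
    unfolding char_def expdist_def ..
  also have "\<dots> = (CLINT x|lborel. exponential_density l x *\<^sub>R iexp (t * x))"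
    by (rule integral_density) (use l in \<open>auto simp: exponential_density_nonneg\<close>)
  also have "\<dots> = (CLINT x|lborel. indicator {0..} x *\<^sub>R ?f x)"
  proof (intro Bochner_Integration.integral_cong refl)
    fix x :: real
    have "exp (z * of_real x) = of_real (exp (- x * l)) * iexp (t * x)"
      unfolding exp_of_real[symmetric] mult_exp_exp z_def by (rule arg_cong[where f = exp]) (simp add: algebra_simps)
    then show "exponential_density l x *\<^sub>R iexp (t * x) = indicator {0..} x *\<^sub>R ?f x"
      by (simp add: exponential_density_def indicator_def scaleR_conv_of_real mult.assoc)
  qed
  also have "\<dots> = (CLINT x:{0..}|lborel. ?f x)" by (simp only: set_lebesgue_integral_def)
  finally have char: "char (expdist l) t = (CLINT x:{0..}|lborel. ?f x)" .
  have "((\<lambda>b. CLINT x:{0..b}|lborel. ?f x) \<longlongrightarrow> (CLINT x:{0..}|lborel. ?f x)) at_top"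
    by (rule tendsto_set_lebesgue_integral_at_top[OF _ int]) simp
  moreover have "eventually (\<lambda>b. (CLINT x:{0..b}|lborel. ?f x) = of_real l / z * exp (z * of_real b) - of_real l / z) at_top"
    using eventually_ge_at_top[of 0]
  proof eventually_elim
    case (elim b)
    have "(CLINT x:{0..b}|lborel. ?f x) = of_real l / z * exp (z * of_real b) - of_real l / z * exp (z * of_real 0)"
      unfolding set_lebesgue_integral_def
      by (rule integral_FTC_Icc[OF elim has_vector_derivative_at_within[OF der]]) (intro continuous_intros)
    then show ?case by simp
  qed
  ultimately have "((\<lambda>b. of_real l / z * exp (z * of_real b) - of_real l / z) \<longlongrightarrow> (CLINT x:{0..}|lborel. ?f x)) at_top"
    by (rule Lim_transform_eventually)
  moreover have "((\<lambda>b. of_real l / z * exp (z * of_real b) - of_real l / z) \<longlongrightarrow> of_real l / z * 0 - of_real l / z) at_top"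
    by (intro tendsto_intros lim)
  ultimately have "(CLINT x:{0..}|lborel. ?f x) = of_real l / z * 0 - of_real l / z"
    by (rule tendsto_unique[OF trivial_limit_at_top_linorder])
  then show ?thesis unfolding char z_def using z by (simp add: z_def field_simps)
qed

lemma norm_char_expdist: "1 \<le> l \<Longrightarrow> norm (char (expdist l) t) \<le> 2 * l / (1 + \<bar>t\<bar>)"
proof -
  assume l: "1 \<le> l"
  have "1 + \<bar>t\<bar> \<le> 2 * norm (of_real l - \<i> * complex_of_real t)"
    using abs_Re_le_cmod[of "of_real l - \<i> * complex_of_real t"] abs_Im_le_cmod[of "of_real l - \<i> * complex_of_real t"] l by simp
  moreover have "norm (char (expdist l) t) = l / norm (of_real l - \<i> * complex_of_real t)"
    using l by (subst char_expdist) (simp_all add: norm_divide)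
  moreover have "l / n \<le> 2 * l / (1 + \<bar>t\<bar>)" if "1 + \<bar>t\<bar> \<le> 2 * n" for n
  proof -
    have "l / n = 2 * l / (2 * n)" by simp
    also have "\<dots> \<le> 2 * l / (1 + \<bar>t\<bar>)" using that l by (intro divide_left_mono mult_pos_pos) auto
    finally show ?thesis .
  qed
  ultimately show ?thesis by simp
qed

text \<open>The integral of \<open>exp (- \<i> t x)\<close> over \<open>x\<close> from
  \<open>a\<close> to \<open>b\<close>, in the form used by the Levy inversion formula. At
  \<open>t = 0\<close> division makes it \<open>0\<close> instead of \<open>b - a\<close>, on a null
  set.\<close>

definition levy_kernel :: "real \<Rightarrow> real \<Rightarrow> real \<Rightarrow> complex" where
  "levy_kernel a b t = (iexp (-(t * a)) - iexp (-(t * b))) / (\<i> * t)"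

text \<open>The minimum of the two elementary bounds \<open>b - a \<le> 1\<close>, for small
  \<open>t\<close>, and \<open>2 / |t|\<close>, for large \<open>t\<close>.\<close>

lemma norm_levy_kernel:
  assumes "a \<le> b" "b - a \<le> 1"
  shows "norm (levy_kernel a b t) \<le> 4 / (1 + \<bar>t\<bar>)"
proof (cases "t = 0")
  case False
  have "norm (levy_kernel a b t) = norm ((iexp (t * (- a)) - iexp (t * (- b))) / (\<i> * t))" by (simp add: levy_kernel_def)
  also have "\<dots> \<le> - a - - b" by (rule Levy_Inversion_aux2) (use assms False in auto)
  finally have 1: "norm (levy_kernel a b t) \<le> 1" using assms by simp
  have "norm (iexp (-(t * a)) - iexp (-(t * b))) \<le> 1 + 1"
    by (rule order.trans[OF norm_triangle_ineq4]) (simp del: of_real_minus of_real_mult)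
  then have 2: "norm (levy_kernel a b t) \<le> 2 / \<bar>t\<bar>"
    unfolding levy_kernel_def norm_divide by (simp add: norm_mult divide_right_mono)
  show ?thesis
  proof (cases "\<bar>t\<bar> \<le> 1")
    case True
    moreover have "0 < 1 + \<bar>t\<bar>" by (rule add_pos_nonneg) simp_all
    ultimately have "1 \<le> 4 / (1 + \<bar>t\<bar>)" by (subst le_divide_eq_1_pos) simp_all
    with 1 show ?thesis by (rule order.trans)
  next
    case False
    then have "2 / \<bar>t\<bar> \<le> 4 / (1 + \<bar>t\<bar>)" by (simp add: field_simps)
    with 2 show ?thesis by (rule order.trans)
  qed
qed (simp add: levy_kernel_def)

text \<open>The exponent is the total decay in the inversion integral: two factors
  \<open>1 / (1 + |t|)\<close> against a growth of \<open>sqrt (1 + |t|)\<close>.\<close>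

lemma integrable_inverse_powr: "integrable lborel (\<lambda>t::real. (1 + \<bar>t\<bar>) powr (- (3 / 2)))"
proof -
  have pos: "set_integrable lborel {0..} (\<lambda>t::real. (1 + t) powr (- (3 / 2)))"
  proof -
    have "(\<integral>\<^sup>+t\<in>{0..}. ennreal ((1 + t) powr (- (3 / 2))) \<partial>lborel) = ennreal (0 - (- 2) * (1 + 0) powr (- (1 / 2)))"
    proof (rule nn_integral_FTC_atLeast)
      show "((\<lambda>t::real. (- 2) * (1 + t) powr (- (1 / 2))) \<longlongrightarrow> 0) at_top" by real_asymp
      show "((\<lambda>t. (- 2) * (1 + t) powr (- (1 / 2))) has_real_derivative (1 + x) powr (- (3 / 2))) (at x)" if "0 \<le> x" for x :: real
      proof -
        have "((\<lambda>t. (- 2) * (1 + t) powr (- (1 / 2))) has_real_derivative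
            (- 2) * ((- (1 / 2)) * (1 + x) powr (- (1 / 2) - 1) * (0 + 1))) (at x)"
          using that by (intro DERIV_cmult DERIV_chain2[OF has_real_derivative_powr] derivative_intros) auto
        then show ?thesis by simp
      qed
    qed auto
    moreover have "(\<integral>\<^sup>+t. ennreal (indicator {0..} t *\<^sub>R (1 + t) powr (- (3 / 2))) \<partial>lborel)
        = (\<integral>\<^sup>+t\<in>{0..}. ennreal ((1 + t) powr (- (3 / 2))) \<partial>lborel)"
      by (intro nn_integral_cong) (auto simp: indicator_def)
    ultimately show ?thesis unfolding set_integrable_def
      by (intro integrableI_nonneg) auto
  qed
  then have neg: "set_integrable lborel {..0} (\<lambda>t::real. (1 + - t) powr (- (3 / 2)))"
    using lborel_integrable_real_affine[of "\<lambda>x. indicator {0..} x *\<^sub>R (1 + x) powr (- (3 / 2))" "-1" 0]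
    unfolding set_integrable_def by (simp add: indicator_def)
  have "integrable lborel (\<lambda>t::real. indicator {0..} t *\<^sub>R (1 + t) powr (- (3 / 2)) + indicator {..0} t *\<^sub>R (1 + - t) powr (- (3 / 2)))"
    using pos neg unfolding set_integrable_def by (rule Bochner_Integration.integrable_add)
  then show ?thesis
    by (rule Bochner_Integration.integrable_bound) (auto simp: indicator_def)
qed

lemma one_plus_abs_powr: "1 / (1 + \<bar>t\<bar>) * (1 / (1 + \<bar>t\<bar>)) * sqrt (1 + \<bar>t\<bar>) = (1 + \<bar>t::real\<bar>) powr (- (3 / 2))"
proof -
  define y where "y = 1 + \<bar>t\<bar>"
  have y: "y > 0" unfolding y_def by (rule add_pos_nonneg) simp_all
  have a: "y powr (- 1) = 1 / y" using y by (simp add: powr_minus_divide)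
  have b: "y powr (1 / 2) = sqrt y" using y by (simp add: powr_half_sqrt)
  have "1 / y * (1 / y) * sqrt y = y powr (- 1 + - 1 + 1 / 2)" unfolding powr_add a b ..
  also have "- 1 + - 1 + 1 / 2 = - (3 / 2 :: real)" by simp
  finally show ?thesis by (simp only: y_def)
qed

lemma norm_levy_char:
  assumes "1 \<le> \<sigma>" "\<sigma> \<le> 2" "0 < h" "h \<le> 1"
  shows "norm (levy_kernel v (v + h) t * char (expdist \<sigma>) t) \<le> 16 * (1 / (1 + \<bar>t\<bar>) * (1 / (1 + \<bar>t\<bar>)))"
proof -
  have "norm (levy_kernel v (v + h) t * char (expdist \<sigma>) t) \<le> 4 / (1 + \<bar>t\<bar>) * (2 * \<sigma> / (1 + \<bar>t\<bar>))"
    unfolding norm_mult using assms by (intro mult_mono norm_levy_kernel norm_char_expdist) auto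
  also have "\<dots> \<le> 4 / (1 + \<bar>t\<bar>) * (4 / (1 + \<bar>t\<bar>))"
    using assms by (intro mult_left_mono divide_right_mono) auto
  finally show ?thesis by simp
qed

lemma levy_kernel_measurable [measurable]: "levy_kernel a b \<in> borel_measurable borel"
  unfolding levy_kernel_def[abs_def] by measurable

lemma integrable_levy_char:
  assumes "1 \<le> \<sigma>" "\<sigma> \<le> 2" "0 < h" "h \<le> 1"
  shows "integrable lborel (\<lambda>t. levy_kernel v (v + h) t * char (expdist \<sigma>) t)"
proof (rule Bochner_Integration.integrable_bound)
  show "integrable lborel (\<lambda>t::real. 16 * (1 + \<bar>t\<bar>) powr (- (3 / 2)))"
    by (intro integrable_mult_right integrable_inverse_powr)
  interpret real_distribution "expdist \<sigma>" using assms by (intro real_distribution_expdist) simp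
  show "(\<lambda>t. levy_kernel v (v + h) t * char (expdist \<sigma>) t) \<in> borel_measurable lborel" by measurable
  show "AE t in lborel. norm (levy_kernel v (v + h) t * char (expdist \<sigma>) t) \<le> norm (16 * (1 + \<bar>t\<bar>) powr (- (3 / 2)))"
  proof (rule AE_I2)
    fix t :: real
    have "1 / (1 + \<bar>t\<bar>) * (1 / (1 + \<bar>t\<bar>)) * 1 \<le> 1 / (1 + \<bar>t\<bar>) * (1 / (1 + \<bar>t\<bar>)) * sqrt (1 + \<bar>t\<bar>)"
      by (intro mult_left_mono) auto
    then have "16 * (1 / (1 + \<bar>t\<bar>) * (1 / (1 + \<bar>t\<bar>))) \<le> 16 * (1 + \<bar>t\<bar>) powr (- (3 / 2))"
      unfolding one_plus_abs_powr by simp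
    with norm_levy_char[OF assms, of v t]
    show "norm (levy_kernel v (v + h) t * char (expdist \<sigma>) t) \<le> norm (16 * (1 + \<bar>t\<bar>) powr (- (3 / 2)))"
      by (rule order.trans[OF _ order.trans]) simp
  qed
qed

text \<open>Levy inversion provides a limit of integrals over \<open>[-T, T]\<close>. The integrand
  decays like \<open>1 / t^2\<close>, so by dominated convergence this is one absolutely convergent
  integral, which can later be exchanged with a sum.\<close>

lemma measure_expdist_fourier:
  assumes "1 \<le> \<sigma>" "\<sigma> \<le> 2" "0 < h" "h \<le> 1"
  shows "complex_of_real (measure (expdist \<sigma>) {v<..v + h}) =
    of_real (1 / (2 * pi)) * (CLINT t|lborel. levy_kernel v (v + h) t * char (expdist \<sigma>) t)"
proof -
  interpret real_distribution "expdist \<sigma>" using assms by (intro real_distribution_expdist) simp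
  let ?f = "\<lambda>t. levy_kernel v (v + h) t * char (expdist \<sigma>) t"
  have int: "integrable lborel ?f" by (rule integrable_levy_char[OF assms])
  have L1: "(\<lambda>T. of_real (1 / (2 * pi)) * (CLBINT t=ereal (real_of_int (- int T))..ereal (real T). ?f t))
      \<longlonglongrightarrow> of_real (measure (expdist \<sigma>) {v<..v + h})"
    unfolding levy_kernel_def
    by (rule Levy_Inversion) (use assms in \<open>auto simp: measure_expdist_singleton\<close>)
  have E: "(CLBINT t=ereal (real_of_int (- int T))..ereal (real T). ?f t) = (CLINT t|lborel. indicator {- real T..real T} t *\<^sub>R ?f t)" for T
    by (subst interval_integral_Icc) (simp_all add: set_lebesgue_integral_def)
  have L2: "(\<lambda>T. CLINT t|lborel. indicator {- real T..real T} t *\<^sub>R ?f t) \<longlonglongrightarrow> (CLINT t|lborel. ?f t)"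
  proof (rule integral_dominated_convergence[where w = "\<lambda>t. norm (?f t)"])
    show "?f \<in> borel_measurable lborel" using int by simp
    show "(\<lambda>t. indicator {- real T..real T} t *\<^sub>R ?f t) \<in> borel_measurable lborel" for T using int by simp
    show "integrable lborel (\<lambda>t. norm (?f t))" using int by simp
    show "AE t in lborel. (\<lambda>T. indicator {- real T..real T} t *\<^sub>R ?f t) \<longlonglongrightarrow> ?f t"
    proof (rule AE_I2)
      fix t :: real
      have "eventually (\<lambda>T. real T \<ge> \<bar>t\<bar>) sequentially" by real_asymp
      then have "eventually (\<lambda>T. indicator {- real T..real T} t *\<^sub>R ?f t = ?f t) sequentially"
        by eventually_elim (auto simp: indicator_def)
      then show "(\<lambda>T. indicator {- real T..real T} t *\<^sub>R ?f t) \<longlonglongrightarrow> ?f t" by (rule tendsto_eventually)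
    qed
    show "AE t in lborel. norm (indicator {- real T..real T} t *\<^sub>R ?f t) \<le> norm (?f t)" for T
      by (rule AE_I2) (simp add: indicator_def)
  qed
  show ?thesis by (rule LIMSEQ_unique[OF L1[unfolded E] tendsto_mult_left[OF L2]])
qed

lemma dterm_real_powr:
  assumes "n \<ge> 1"
  shows "dterm (Complex \<sigma> (- t)) n = of_real (real n powr - \<sigma>) * iexp (t * ln (real n))"
proof -
  have "complex_of_real (real n powr - \<sigma>) = exp (of_real (- \<sigma> * ln (real n)))"
    using assms by (simp only: exp_of_real) (simp add: powr_def)
  then show ?thesis unfolding dterm_def
    by (simp only: mult_exp_exp) (rule arg_cong[where f = exp], simp add: complex_eq_iff)
qed

text \<open>For \<open>y = ln n\<close> the translation of the interval becomes the factor
  \<open>n^(i t)\<close>, which joins \<open>n powr - \<sigma>\<close> to form the Dirichlet term at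
  \<open>\<sigma> - i t\<close>; the rest is independent of \<open>n\<close>.\<close>

lemma levy_kernel_shift:
  "levy_kernel (T - y) (T - y + h) t = iexp (t * y) * (iexp (- (t * T)) * levy_kernel 0 h t)"
proof -
  have "iexp (- (t * (T - y))) = iexp (t * y) * iexp (- (t * T))"
    and "iexp (- (t * (T - y + h))) = iexp (t * y) * (iexp (- (t * T)) * iexp (- (t * h)))"
    unfolding mult_exp_exp by (rule arg_cong[where f = exp]; simp add: algebra_simps)+
  then show ?thesis by (simp add: levy_kernel_def algebra_simps diff_divide_distrib)
qed

text \<open>Each measure is replaced by its inversion integral. Exchanging sum and integral turns
  the series into \<open>1 / (2 pi)\<close> times the integral of
  \<open>dser mangoldt_diff (Complex \<sigma> (- t)) * g t\<close>. The bounds for both factors are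
  free of \<open>\<sigma>\<close>, \<open>h\<close> and \<open>T\<close>, hence so is the
  constant.\<close>

lemma smoothed_sum_bound:
  "\<exists>C>0. \<forall>\<sigma> h T. 1 < \<sigma> \<longrightarrow> \<sigma> \<le> 2 \<longrightarrow> 0 < h \<longrightarrow> h \<le> 1 \<longrightarrow>
     \<bar>suminf (\<lambda>n. mangoldt_diff (Suc n) * real (Suc n) powr - \<sigma> * measure (expdist \<sigma>) {T - ln (real (Suc n))<..T - ln (real (Suc n)) + h})\<bar> \<le> C"
proof -
  obtain C where C: "C > 0" and F0: "\<forall>\<sigma> t. 1 < \<sigma> \<longrightarrow> \<sigma> \<le> 2 \<longrightarrow> norm (dser mangoldt_diff (Complex \<sigma> t)) \<le> C * sqrt (1 + \<bar>t\<bar>)"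
    using dser_mangoldt_diff_bound by blast
  define J where "J = (LINT t|lborel. (1 + \<bar>t::real\<bar>) powr (- (3 / 2)))"
  have J: "J \<ge> 0" unfolding J_def by (rule Bochner_Integration.integral_nonneg) simp
  define C' where "C' = 16 * C * J + 1"
  have C': "C' > 0" unfolding C'_def using C J by (simp add: add_nonneg_pos)
  have main: "\<bar>suminf (\<lambda>n. mangoldt_diff (Suc n) * real (Suc n) powr - \<sigma> * measure (expdist \<sigma>) {T - ln (real (Suc n))<..T - ln (real (Suc n)) + h})\<bar> \<le> C'"
    if \<sigma>: "1 < \<sigma>" "\<sigma> \<le> 2" and h: "0 < h" "h \<le> 1" for \<sigma> h T
  proof -
    have \<sigma>1: "1 \<le> \<sigma>" using \<sigma> by simp
    define \<mu> where "\<mu> = (\<lambda>n. measure (expdist \<sigma>) {T - ln (real n)<..T - ln (real n) + h})"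
    define g where "g = (\<lambda>t. iexp (- (t * T)) * levy_kernel 0 h t * char (expdist \<sigma>) t)"
    define f where "f = (\<lambda>n t. of_real (mangoldt_diff (Suc n)) * dterm (Complex \<sigma> (- t)) (Suc n) * g t)"
    define S where "S = (\<lambda>n. mangoldt_diff (Suc n) * real (Suc n) powr - \<sigma> * \<mu> (Suc n))"
    interpret real_distribution "expdist \<sigma>" using \<sigma> by (intro real_distribution_expdist) simp
    have gb: "norm (g t) \<le> 16 * (1 / (1 + \<bar>t\<bar>) * (1 / (1 + \<bar>t\<bar>)))" for t
    proof -
      have "norm (g t) = norm (levy_kernel 0 (0 + h) t * char (expdist \<sigma>) t)"
        unfolding g_def norm_mult by (simp del: of_real_minus of_real_mult)
      then show ?thesis using norm_levy_char[OF \<sigma>1 \<sigma>(2) h, of 0 t] by simp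
    qed
    have gint: "integrable lborel g"
    proof (rule Bochner_Integration.integrable_bound[OF integrable_levy_char[OF \<sigma>1 \<sigma>(2) h, of 0]])
      show "g \<in> borel_measurable lborel" unfolding g_def by measurable
      show "AE t in lborel. norm (g t) \<le> norm (levy_kernel 0 (0 + h) t * char (expdist \<sigma>) t)"
        unfolding g_def norm_mult by (rule AE_I2) (simp del: of_real_minus of_real_mult)
    qed
    have dc: "dconv mangoldt_diff (Complex \<sigma> t)" for t using \<sigma> by (intro dconv_mangoldt_diff) simp
    have sums: "(\<lambda>n. of_real (mangoldt_diff (Suc n)) * dterm (Complex \<sigma> t) (Suc n)) sums dser mangoldt_diff (Complex \<sigma> t)"
      and nsum: "summable (\<lambda>n. norm (of_real (mangoldt_diff (Suc n)) * dterm (Complex \<sigma> t) (Suc n)))" for t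
    proof -
      have "((\<lambda>n. of_real (mangoldt_diff n) * dterm (Complex \<sigma> t) n) has_sum dser mangoldt_diff (Complex \<sigma> t)) {1..}"
        using dc[of t] unfolding dconv_def dser_def by (rule has_sum_infsum)
      also have "?this \<longleftrightarrow> ((\<lambda>n. of_real (mangoldt_diff (Suc n)) * dterm (Complex \<sigma> t) (Suc n)) has_sum dser mangoldt_diff (Complex \<sigma> t)) UNIV"
        by (rule has_sum_reindex_bij_witness[of _ Suc "\<lambda>n. n - 1"]) (auto simp del: of_nat_Suc)
      finally have hs: "((\<lambda>n. of_real (mangoldt_diff (Suc n)) * dterm (Complex \<sigma> t) (Suc n)) has_sum dser mangoldt_diff (Complex \<sigma> t)) UNIV" .
      show "(\<lambda>n. of_real (mangoldt_diff (Suc n)) * dterm (Complex \<sigma> t) (Suc n)) sums dser mangoldt_diff (Complex \<sigma> t)"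
        by (rule has_sum_imp_sums[OF hs])
      show "summable (\<lambda>n. norm (of_real (mangoldt_diff (Suc n)) * dterm (Complex \<sigma> t) (Suc n)))"
        by (rule summable_on_imp_summable, rule summable_on_iff_abs_summable_on_complex[THEN iffD1], rule has_sum_imp_summable[OF hs])
    qed
    have dn: "norm (dterm (Complex \<sigma> t) (Suc n)) = real (Suc n) powr - \<sigma>" for t n
      by (subst norm_dterm) simp_all
    have fnorm: "norm (f n t) = norm (of_real (mangoldt_diff (Suc n)) * dterm (Complex \<sigma> 0) (Suc n)) * norm (g t)" for n t
      unfolding f_def norm_mult dn ..
    have fint: "integrable lborel (f n)" for n
    proof (rule Bochner_Integration.integrable_bound)
      show "integrable lborel (\<lambda>t. norm (of_real (mangoldt_diff (Suc n)) * dterm (Complex \<sigma> 0) (Suc n)) * norm (g t))"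
        using gint by (intro integrable_mult_right integrable_norm)
      have "g \<in> borel_measurable lborel" using gint by simp
      moreover have "(\<lambda>t. dterm (Complex \<sigma> (- t)) (Suc n)) \<in> borel_measurable lborel"
        unfolding dterm_real_powr[of "Suc n" \<sigma>, OF le_add1[of 1 n, folded Suc_eq_plus1_left]] by measurable
      ultimately show "f n \<in> borel_measurable lborel" unfolding f_def by measurable
      show "AE t in lborel. norm (f n t) \<le> norm (norm (of_real (mangoldt_diff (Suc n)) * dterm (Complex \<sigma> 0) (Suc n)) * norm (g t))"
        unfolding fnorm by (rule AE_I2) simp
    qed
    have fmu: "(CLINT t|lborel. f n t) = of_real (2 * pi * S n)" for n
    proof -
      have n1: "Suc n \<ge> 1" by simp
      have "f n t = of_real (mangoldt_diff (Suc n) * real (Suc n) powr - \<sigma>) *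
          (levy_kernel (T - ln (real (Suc n))) (T - ln (real (Suc n)) + h) t * char (expdist \<sigma>) t)" for t
        unfolding f_def g_def levy_kernel_shift dterm_real_powr[OF n1] of_real_mult by (simp only: mult_ac)
      then have "(CLINT t|lborel. f n t) = of_real (mangoldt_diff (Suc n) * real (Suc n) powr - \<sigma>) *
          (CLINT t|lborel. levy_kernel (T - ln (real (Suc n))) (T - ln (real (Suc n)) + h) t * char (expdist \<sigma>) t)"
        by simp
      also have "(CLINT t|lborel. levy_kernel (T - ln (real (Suc n))) (T - ln (real (Suc n)) + h) t * char (expdist \<sigma>) t)
          = of_real (2 * pi) * of_real (\<mu> (Suc n))"
        unfolding \<mu>_def measure_expdist_fourier[OF \<sigma>1 \<sigma>(2) h] by simp
      finally show ?thesis by (simp add: S_def mult_ac)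
    qed
    \<comment> \<open>The exchange is legitimate because the norms separate: an absolutely
      convergent series in \<open>n\<close> times the integral of \<open>norm (g t)\<close>.\<close>
    have sm: "summable (\<lambda>n. LINT t|lborel. norm (f n t))"
      unfolding fnorm using gint by (simp only: integral_mult_right_zero) (intro summable_mult2 nsum)
    have ae: "AE t in lborel. summable (\<lambda>n. norm (f n t))"
      unfolding fnorm by (intro AE_I2 summable_mult2 nsum)
    have tot: "(CLINT t|lborel. (suminf (\<lambda>n. f n t))) = (suminf (\<lambda>n. (CLINT t|lborel. f n t)))"
      by (rule integral_suminf[OF fint ae sm])
    have "integrable lborel (\<lambda>t. (suminf (\<lambda>n. f n t)))" by (rule integrable_suminf[OF fint ae sm])
    have fs: "(suminf (\<lambda>n. f n t)) = dser mangoldt_diff (Complex \<sigma> (- t)) * g t" for t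
      unfolding f_def by (rule sums_unique[symmetric, OF sums_mult2[OF sums]])
    have "norm (CLINT t|lborel. (suminf (\<lambda>n. f n t))) \<le> (LINT t|lborel. 16 * C * (1 + \<bar>t\<bar>) powr (- (3 / 2)))"
    proof (rule order.trans[OF Bochner_Integration.integral_norm_bound Bochner_Integration.integral_mono])
      show "integrable lborel (\<lambda>t. norm (suminf (\<lambda>n. f n t)))" by (rule integrable_norm) fact
      show "integrable lborel (\<lambda>t. 16 * C * (1 + \<bar>t\<bar>) powr (- (3 / 2)))"
        by (intro integrable_mult_right integrable_inverse_powr)
      fix t :: real
      have "norm (suminf (\<lambda>n. f n t)) \<le> (C * sqrt (1 + \<bar>- t\<bar>)) * (16 * (1 / (1 + \<bar>t\<bar>) * (1 / (1 + \<bar>t\<bar>))))"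
        unfolding fs norm_mult using C by (intro mult_mono gb F0[rule_format, OF \<sigma>]) auto
      also have "\<dots> = 16 * C * (1 / (1 + \<bar>t\<bar>) * (1 / (1 + \<bar>t\<bar>)) * sqrt (1 + \<bar>t\<bar>))" by simp
      also have "\<dots> = 16 * C * (1 + \<bar>t\<bar>) powr (- (3 / 2))" unfolding one_plus_abs_powr ..
      finally show "norm (suminf (\<lambda>n. f n t)) \<le> 16 * C * (1 + \<bar>t\<bar>) powr (- (3 / 2))" .
    qed
    also have "\<dots> = 16 * C * J" unfolding J_def by simp
    finally have "norm (suminf (\<lambda>n. complex_of_real (2 * pi * S n))) \<le> 16 * C * J" unfolding tot fmu .
    moreover have Ss: "summable S"
    proof -
      have "summable (\<lambda>n. CLINT t|lborel. f n t)" by (rule summable_integral[OF fint ae sm]) 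
      then have "summable (\<lambda>n. 2 * pi * S n)" unfolding fmu by (simp only: summable_of_real_iff)
      then show ?thesis by simp
    qed
    ultimately have "\<bar>2 * pi * suminf S\<bar> \<le> 16 * C * J"
      by (simp only: suminf_of_real[symmetric, OF summable_mult[OF Ss]] norm_of_real suminf_mult[OF Ss])
    moreover have "\<bar>suminf S\<bar> \<le> \<bar>2 * pi * suminf S\<bar>"
    proof -
      have "1 \<le> 2 * pi" using pi_gt3 by simp
      then have "1 * \<bar>suminf S\<bar> \<le> 2 * pi * \<bar>suminf S\<bar>" by (intro mult_right_mono) auto
      then show ?thesis by (simp add: abs_mult)
    qed
    ultimately have "\<bar>suminf S\<bar> \<le> C'" unfolding C'_def by simp
    then show ?thesis unfolding S_def \<mu>_def .
  qed
  show ?thesis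
  proof (rule exI[of _ C'], intro conjI C' allI impI)
    fix \<sigma> h T :: real
    assume a: "1 < \<sigma>" "\<sigma> \<le> 2" "0 < h" "h \<le> 1"
    show "\<bar>suminf (\<lambda>n. mangoldt_diff (Suc n) * real (Suc n) powr - \<sigma> * measure (expdist \<sigma>) {T - ln (real (Suc n))<..T - ln (real (Suc n)) + h})\<bar> \<le> C'"
      by (rule main[OF a])
  qed
qed

subsection \<open>The prime number theorem with an error term\<close>

text \<open>
  The smoothing kernel is the exponential distribution of rate \<open>\<sigma>\<close>, because its density cancels the factor
  \<open>n powr - \<sigma>\<close> of the Dirichlet series: all \<open>n \<le> x\<close> get the same weight.
\<close>

lemma expdist_weight:
  fixes \<sigma> h x :: real
  assumes \<sigma>: "1 < \<sigma>" and h: "0 < h" and x: "x > 0"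
  defines "v \<equiv> \<lambda>n. x powr \<sigma> * real n powr - \<sigma> * measure (expdist \<sigma>) {ln x - ln (real n)<..ln x - ln (real n) + h} / (1 - exp (- h * \<sigma>))"
  shows "0 \<le> v n" "v n \<le> 1" "n \<ge> 1 \<Longrightarrow> real n \<le> x \<Longrightarrow> v n = 1" "real n \<ge> x * exp h \<Longrightarrow> v n = 0"
proof -
  have q: "1 - exp (- h * \<sigma>) > 0" using \<sigma> h by simp
  have meas: "measure (expdist \<sigma>) {ln x - ln (real n)<..ln x - ln (real n) + h} =
      exp (- max 0 (ln x - ln (real n)) * \<sigma>) - exp (- max 0 (ln x - ln (real n) + h) * \<sigma>)"
    using \<sigma> h by (intro measure_expdist) auto
  show v0: "0 \<le> v n" unfolding v_def using q by (intro divide_nonneg_pos mult_nonneg_nonneg) auto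
  show one: "v n = 1" if n: "n \<ge> 1" "real n \<le> x"
  proof -
    have n0: "real n > 0" using n by simp
    have l: "ln x - ln (real n) \<ge> 0" using n n0 x by simp
    have "exp (- (ln x - ln (real n)) * \<sigma>) - exp (- (ln x - ln (real n) + h) * \<sigma>)
        = exp (- (ln x - ln (real n)) * \<sigma>) * (1 - exp (- h * \<sigma>))"
      by (simp add: right_diff_distrib mult_exp_exp algebra_simps)
    moreover have "x powr \<sigma> * real n powr - \<sigma> * exp (- (ln x - ln (real n)) * \<sigma>) = 1"
      using n0 x by (simp add: powr_def mult_exp_exp algebra_simps)
    ultimately have E: "x powr \<sigma> * real n powr - \<sigma> * measure (expdist \<sigma>) {ln x - ln (real n)<..ln x - ln (real n) + h} = 1 - exp (- h * \<sigma>)"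
      unfolding meas using l h by (simp only: max_absorb2 add_nonneg_nonneg less_imp_le mult.assoc[symmetric] mult_1_left)
    show ?thesis unfolding v_def E by (rule divide_self) (use q in linarith)
  qed
  show "v n = 0" if n: "real n \<ge> x * exp h"
  proof -
    have n0: "real n > 0" using n x by (smt (verit) exp_gt_zero mult_pos_pos)
    have "ln (x * exp h) \<le> ln (real n)" using n x n0 by (subst ln_le_cancel_iff) auto
    then have "ln x - ln (real n) + h \<le> 0" using x by (simp add: ln_mult)
    then show ?thesis unfolding v_def meas using h by (simp add: max_absorb1)
  qed
  show "v n \<le> 1"
  proof (cases "real n \<le> x")
    case True
    then show ?thesis
    proof (cases "n \<ge> 1")
      case False
      then have "n = 0" by simp
      then show ?thesis by (simp add: v_def)
    qed (use one True in simp)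
  next
    case False
    then have n0: "real n > 0" using x by simp
    have "ln x \<le> ln (real n)" using False x n0 by simp
    \<comment> \<open>For \<open>n > x\<close> the window starts below \<open>0\<close>, where the
      distribution has no mass, so at most the piece from \<open>0\<close> to \<open>h\<close>
      counts; its mass is the normalizing factor \<open>1 - exp (- h * \<sigma>)\<close>.\<close>
    then have m: "max 0 (ln x - ln (real n)) = 0" "max 0 (ln x - ln (real n) + h) \<le> h" using h by auto
    have "x powr \<sigma> * real n powr - \<sigma> \<le> 1"
    proof -
      have "x powr \<sigma> \<le> real n powr \<sigma>" using False x \<sigma> by (intro powr_mono2) auto
      then have "x powr \<sigma> * real n powr - \<sigma> \<le> real n powr \<sigma> * real n powr - \<sigma>" by (intro mult_right_mono) auto
      also have "\<dots> = 1" using n0 by (simp add: powr_minus)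
      finally show ?thesis .
    qed
    moreover have "measure (expdist \<sigma>) {ln x - ln (real n)<..ln x - ln (real n) + h} \<le> 1 - exp (- h * \<sigma>)"
      unfolding meas m(1) using m(2) \<sigma> by simp
    ultimately have "x powr \<sigma> * real n powr - \<sigma> * measure (expdist \<sigma>) {ln x - ln (real n)<..ln x - ln (real n) + h} \<le> 1 * (1 - exp (- h * \<sigma>))"
      by (intro mult_mono) auto
    then show ?thesis unfolding v_def using q by simp
  qed
qed

lemma one_minus_exp_ge:
  assumes "0 < h" "h \<le> (1::real)" "1 < \<sigma>"
  shows "h / 2 \<le> 1 - exp (- h * \<sigma>)"
proof -
  have "exp (- h * \<sigma>) \<le> exp (- h)" using assms by simp
  also have "exp (- h) \<le> 1 / (1 + h)"
    using exp_ge_add_one_self[of h] assms by (simp add: exp_minus divide_inverse)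
  also have "1 / (1 + h) \<le> 1 - h / 2"
  proof -
    have "h * h \<le> h" using assms by (simp add: mult_left_le)
    then have "1 \<le> (1 - h / 2) * (1 + h)" by (simp add: algebra_simps)
    then show ?thesis using assms by (simp add: divide_le_eq)
  qed
  finally show ?thesis by simp
qed

text \<open>Taking \<open>T = ln x\<close> and rescaling the measures by
  \<open>x powr \<sigma> / q\<close> produces a cutoff \<open>v\<close> that is \<open>1\<close> up
  to \<open>x\<close> and \<open>0\<close> from \<open>x * exp h\<close> on, so the series is a
  finite sum. The factor \<open>1 / h\<close> stems from \<open>q \<ge> h / 2\<close>.\<close>

lemma weighted_mangoldt_diff_bound:
  "\<exists>C>0. \<forall>\<sigma> h x. 1 < \<sigma> \<longrightarrow> \<sigma> \<le> 2 \<longrightarrow> 0 < h \<longrightarrow> h \<le> 1 \<longrightarrow> 0 < x \<longrightarrow>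
    (\<exists>v. (\<forall>n. 0 \<le> v n \<and> v n \<le> 1) \<and> (\<forall>n\<ge>1. real n \<le> x \<longrightarrow> v n = 1) \<and>
      (\<forall>N. real N \<ge> x * exp h \<longrightarrow> \<bar>\<Sum>n=1..N. mangoldt_diff n * v n\<bar> \<le> C * x powr \<sigma> / h))"
proof -
  obtain C where C: "C > 0" and bd0: "\<forall>\<sigma> h T. 1 < \<sigma> \<longrightarrow> \<sigma> \<le> 2 \<longrightarrow> 0 < h \<longrightarrow> h \<le> 1 \<longrightarrow>
     \<bar>suminf (\<lambda>n. mangoldt_diff (Suc n) * real (Suc n) powr - \<sigma> * measure (expdist \<sigma>) {T - ln (real (Suc n))<..T - ln (real (Suc n)) + h})\<bar> \<le> C"
    using smoothed_sum_bound by blast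
  show ?thesis
  proof (rule exI[of _ "2 * C"], intro conjI allI impI)
    fix \<sigma> h x :: real
    assume \<sigma>: "1 < \<sigma>" "\<sigma> \<le> 2" and h: "0 < h" "h \<le> 1" and x: "0 < x"
    define \<mu> where "\<mu> = (\<lambda>n. measure (expdist \<sigma>) {ln x - ln (real n)<..ln x - ln (real n) + h})"
    define q where "q = 1 - exp (- h * \<sigma>)"
    define v where "v = (\<lambda>n. x powr \<sigma> * real n powr - \<sigma> * \<mu> n / q)"
    have v: "0 \<le> v n" "v n \<le> 1" for n
      unfolding v_def \<mu>_def q_def by (rule expdist_weight[OF \<sigma>(1) h(1) x])+
    have v1: "v n = 1" if "n \<ge> 1" "real n \<le> x" for n
      unfolding v_def \<mu>_def q_def using that by (rule expdist_weight[OF \<sigma>(1) h(1) x])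
    have v2: "v n = 0" if "real n \<ge> x * exp h" for n
      unfolding v_def \<mu>_def q_def using that by (rule expdist_weight[OF \<sigma>(1) h(1) x])
    have q: "q \<ge> h / 2" unfolding q_def by (rule one_minus_exp_ge[OF h \<sigma>(1)])
    have q0: "q > 0" using q h by linarith
    have "\<bar>\<Sum>n=1..N. mangoldt_diff n * v n\<bar> \<le> 2 * C * x powr \<sigma> / h" if N: "real N \<ge> x * exp h" for N
    proof -
      let ?S = "\<lambda>n. mangoldt_diff n * real n powr - \<sigma> * \<mu> n"
      have xs: "x powr \<sigma> > 0" using x by simp
      have eq: "mangoldt_diff n * v n = x powr \<sigma> / q * ?S n" for n by (simp add: v_def)
      have zero: "?S (Suc n) = 0" if "n \<notin> {..<N}" for n
      proof -
        have "real (Suc n) \<ge> x * exp h" using that N by simp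
        then have "v (Suc n) = 0" by (rule v2)
        then have "x powr \<sigma> / q * ?S (Suc n) = 0" unfolding eq[symmetric] by (simp only: mult_zero_right)
        then show ?thesis using xs q0 by simp
      qed
      have "(\<Sum>n=1..N. mangoldt_diff n * v n) = x powr \<sigma> / q * (\<Sum>n=1..N. ?S n)"
        unfolding eq by (rule sum_distrib_left[symmetric])
      also have "(\<Sum>n=1..N. ?S n) = (\<Sum>n<N. ?S (Suc n))"
        by (rule sum.reindex_bij_witness[of _ Suc "\<lambda>n. n - 1"]) auto
      also have "\<dots> = (suminf (\<lambda>n. ?S (Suc n)))" by (rule suminf_finite[symmetric]) (use zero in auto)
      finally have "\<bar>\<Sum>n=1..N. mangoldt_diff n * v n\<bar> = x powr \<sigma> / q * \<bar>suminf (\<lambda>n. ?S (Suc n))\<bar>"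
        using xs q0 by (simp only: abs_mult abs_divide abs_of_pos)
      also have "\<dots> \<le> x powr \<sigma> / q * C"
        unfolding \<mu>_def using xs q0 by (intro mult_left_mono bd0[rule_format, OF \<sigma> h]) simp
      also have "\<dots> \<le> x powr \<sigma> / (h / 2) * C"
        using xs q q0 C h by (intro mult_right_mono divide_left_mono mult_pos_pos) auto
      finally show ?thesis by (simp add: mult_ac)
    qed
    with v v1 show "\<exists>v. (\<forall>n. 0 \<le> v n \<and> v n \<le> 1) \<and> (\<forall>n\<ge>1. real n \<le> x \<longrightarrow> v n = 1) \<and>
      (\<forall>N. real N \<ge> x * exp h \<longrightarrow> \<bar>\<Sum>n=1..N. mangoldt_diff n * v n\<bar> \<le> 2 * C * x powr \<sigma> / h)"
      by (intro exI[of _ v]) simp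
  qed (use C in simp)
qed

lemma mangoldt_diff_ge: "n \<ge> 1 \<Longrightarrow> mangoldt_diff n \<ge> - ln (real n)"
  using mangoldt_nonneg[of n] by simp

lemma powr_one_plus_inverse_ln:
  assumes "x > (1::real)"
  shows "x powr (1 + 1 / ln x) = x * exp 1"
proof -
  have "(1 + 1 / ln x) * ln x = ln x + 1" using assms by (simp add: field_simps)
  then show ?thesis using assms by (simp add: powr_def exp_add)
qed

lemma sum_split_Icc:
  fixes f :: "nat \<Rightarrow> 'a :: comm_monoid_add"
  assumes "N \<le> M"
  shows "(\<Sum>n=1..M. f n) = (\<Sum>n=1..N. f n) + (\<Sum>n=N+1..M. f n)"
proof -
  obtain p where "M = N + p" using assms le_Suc_ex by blast
  then show ?thesis using sum.ub_add_nat[of 1 N f p] by simp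
qed

text \<open>
  Unsmoothing is possible since \<open>(\<Lambda>(n) - 1) ln n \<ge> - ln n\<close>; the choice \<open>h = 1 / sqrt (ln x)\<close> balances the
  bound \<open>x / h\<close> for the smoothed sum against the \<open>h x ln x\<close> lost at the edge.
\<close>

lemma sum_mangoldt_diff_bound:
  "\<exists>C>0. \<forall>N. ln (real N) \<ge> 1 \<longrightarrow> \<bar>\<Sum>n=1..N. mangoldt_diff n\<bar> \<le> C * (real N * sqrt (ln (real N)))"
proof -
  obtain C where C: "C > 0" and W: "\<forall>\<sigma> h x. 1 < \<sigma> \<longrightarrow> \<sigma> \<le> 2 \<longrightarrow> 0 < h \<longrightarrow> h \<le> 1 \<longrightarrow> 0 < x \<longrightarrow>
    (\<exists>v. (\<forall>n. 0 \<le> v n \<and> v n \<le> 1) \<and> (\<forall>n\<ge>1. real n \<le> x \<longrightarrow> v n = 1) \<and>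
      (\<forall>N. real N \<ge> x * exp h \<longrightarrow> \<bar>\<Sum>n=1..N. mangoldt_diff n * v n\<bar> \<le> C * x powr \<sigma> / h))"
    using weighted_mangoldt_diff_bound by blast
  have "\<bar>\<Sum>n=1..N. mangoldt_diff n\<bar> \<le> (C * exp 1 + 9) * (real N * sqrt (ln (real N)))" if lnN: "ln (real N) \<ge> 1" for N
  proof -
    define x where "x = real N"
    define S where "S = sqrt (ln x)"
    define \<sigma> where "\<sigma> = 1 + 1 / ln x"
    define h where "h = 1 / S"
    have N0: "N > 0" using lnN by (cases "N = 0") auto
    have x0: "x > 0" using N0 by (simp add: x_def)
    have x1: "x > 1" using lnN x0 unfolding x_def by (metis ln_gt_zero_iff less_le_trans zero_less_one)
    have lx: "ln x \<ge> 1" using lnN by (simp add: x_def)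
    have S1: "S \<ge> 1" unfolding S_def using lx by simp
    have SS: "S * S = ln x" unfolding S_def using lx by simp
    have \<sigma>: "1 < \<sigma>" "\<sigma> \<le> 2" unfolding \<sigma>_def using lx by (simp_all add: divide_le_eq)
    have h: "0 < h" "h \<le> 1" unfolding h_def using S1 by (simp_all add: divide_le_eq)
    have Slex: "S \<le> x"
    proof -
      have "S * 1 \<le> S * S" using S1 by (intro mult_left_mono) auto
      also have "\<dots> = ln x" by (rule SS)
      also have "\<dots> \<le> x" using ln_bound[of x] x0 by simp
      finally show ?thesis by simp
    qed
    have xS: "x * S > 0" using x0 S1 by simp
    have SSx: "S * S \<le> x * S" using Slex S1 by (intro mult_right_mono) auto
    have main: "C * y powr \<sigma> / h \<le> C * exp 1 * (x * S)" if "0 < y" "y \<le> x" for y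
    proof -
      have "y powr \<sigma> \<le> x powr \<sigma>" using that \<sigma> by (intro powr_mono2) auto
      also have "\<dots> = x * exp 1" unfolding \<sigma>_def by (rule powr_one_plus_inverse_ln[OF x1])
      finally have "C * y powr \<sigma> / h \<le> C * (x * exp 1) / h"
        using C h by (intro divide_right_mono mult_left_mono) auto
      then show ?thesis by (simp add: h_def mult_ac)
    qed
    have b: "mangoldt_diff n \<ge> - ln (real M)" if "1 \<le> n" "n \<le> M" for n M
    proof -
      have "ln (real n) \<le> ln (real M)" using that by simp
      then show ?thesis using mangoldt_diff_ge[OF that(1)] by linarith
    qed
    \<comment> \<open>The cutoff reaches beyond \<open>N\<close> up to \<open>x * exp h\<close>. The
      surplus terms are bounded from below only, which is the direction that an upper bound for the
      sum up to \<open>N\<close> requires.\<close>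
    have upper: "(\<Sum>n=1..N. mangoldt_diff n) \<le> (C * exp 1 + 9) * (x * S)"
    proof -
      obtain v where v: "\<forall>n. 0 \<le> v n \<and> v n \<le> 1" "\<forall>n\<ge>1. real n \<le> x \<longrightarrow> v n = 1"
        "\<forall>N. real N \<ge> x * exp h \<longrightarrow> \<bar>\<Sum>n=1..N. mangoldt_diff n * v n\<bar> \<le> C * x powr \<sigma> / h"
        using W[rule_format, OF \<sigma> h x0] by blast
      define M where "M = nat \<lceil>x * exp h\<rceil>"
      have M: "x * exp h \<le> real M" "real M \<le> x * exp h + 1"
        unfolding M_def using x0 by (auto simp: real_nat_ceiling_ge)
      have eh: "exp h \<le> 1 + 2 * h"
      proof -
        have "exp h \<le> 1 + h + h\<^sup>2" using h by (intro exp_bound) auto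
        moreover have "h\<^sup>2 \<le> h" using h by (simp add: power2_eq_square mult_left_le)
        ultimately show ?thesis by linarith
      qed
      have "x \<le> x * exp h" using x0 h by simp
      then have NM: "N \<le> M" using M(1) unfolding x_def by linarith
      have xe: "x * exp h \<le> x + 2 * (x * h)"
        using mult_left_mono[OF eh, of x] x0 by (simp add: algebra_simps)
      have cnt: "real (M - N) \<le> 2 * (x * h) + 1" using M(2) xe NM unfolding x_def by (simp add: of_nat_diff)
      have lnM: "ln (real M) \<le> 3 * ln x"
      proof -
        have "x * h \<le> x" using h x0 by (simp add: mult_left_le)
        then have "real M \<le> 4 * x" using M(2) xe x1 by linarith
        then have "ln (real M) \<le> ln (4 * x)" using M(1) x0 NM N0 by (subst ln_le_cancel_iff) auto
        also have "\<dots> = ln 4 + ln x" using x0 by (simp add: ln_mult)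
        also have "ln (4::real) \<le> 2"
        proof -
          have "(4::real) \<le> (exp 1) ^ 2" using exp_ge_add_one_self[of 1] power_mono[of 2 "exp 1 :: real" 2] by simp
          then have "ln (4::real) \<le> ln ((exp 1) ^ 2)" by (subst ln_le_cancel_iff) auto
          then show ?thesis by (simp add: ln_realpow)
        qed
        finally show ?thesis using lx by linarith
      qed
      have lM0: "ln (real M) \<ge> 0" using NM N0 by simp
      have "(\<Sum>n=1..M. mangoldt_diff n * v n) = (\<Sum>n=1..N. mangoldt_diff n * v n) + (\<Sum>n=N+1..M. mangoldt_diff n * v n)"
        by (rule sum_split_Icc[OF NM])
      moreover have "(\<Sum>n=1..N. mangoldt_diff n * v n) = (\<Sum>n=1..N. mangoldt_diff n)"
        by (intro sum.cong refl) (use v(2) in \<open>simp add: x_def\<close>)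
      moreover have "(\<Sum>n=N+1..M. mangoldt_diff n * v n) \<ge> (\<Sum>n=N+1..M. - ln (real M))"
      proof (rule sum_mono)
        fix n assume n: "n \<in> {N+1..M}"
        have "- ln (real M) \<le> - ln (real M) * v n" using v(1)[rule_format, of n] lM0 by (simp add: mult_left_le)
        also have "\<dots> \<le> mangoldt_diff n * v n" using n v(1)[rule_format, of n] by (intro mult_right_mono b) auto
        finally show "- ln (real M) \<le> mangoldt_diff n * v n" .
      qed
      moreover have "(\<Sum>n=N+1..M. - ln (real M)) = - (real (M - N) * ln (real M))" by simp
      moreover have "real (M - N) * ln (real M) \<le> (2 * (x * h) + 1) * (3 * ln x)"
        using cnt lnM lM0 x0 h by (intro mult_mono) auto
      moreover have "(2 * (x * h) + 1) * (3 * ln x) = 6 * (x * S) + 3 * (S * S)"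
        unfolding SS[symmetric] h_def using S1 by (simp add: field_simps)
      moreover have "\<bar>\<Sum>n=1..M. mangoldt_diff n * v n\<bar> \<le> C * exp 1 * (x * S)"
        using v(3)[rule_format, OF M(1)] main[OF x0 order_refl] by linarith
      ultimately have "(\<Sum>n=1..N. mangoldt_diff n) \<le> C * exp 1 * (x * S) + 6 * (x * S) + 3 * (S * S)" by linarith
      also have "\<dots> \<le> C * exp 1 * (x * S) + 9 * (x * S)" using SSx by linarith
      finally show ?thesis by (simp only: distrib_right)
    qed
    have lower: "- (\<Sum>n=1..N. mangoldt_diff n) \<le> (C * exp 1 + 9) * (x * S)"
    proof -
      \<comment> \<open>Now the cutoff starts at \<open>y\<close> and ends at \<open>x\<close>, so
        it lies inside the sum; the missing weights \<open>1 - v n\<close> are nonnegative and the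
        one-sided bound applies again.\<close>
      define y where "y = x * exp (- h)"
      have y0: "0 < y" using x0 by (simp add: y_def)
      have yx: "y \<le> x" unfolding y_def using x0 h by (simp add: mult_left_le)
      have ye: "y * exp h = x" by (simp add: y_def mult.assoc mult_exp_exp)
      obtain v where v: "\<forall>n. 0 \<le> v n \<and> v n \<le> 1" "\<forall>n\<ge>1. real n \<le> y \<longrightarrow> v n = 1"
        "\<forall>N. real N \<ge> y * exp h \<longrightarrow> \<bar>\<Sum>n=1..N. mangoldt_diff n * v n\<bar> \<le> C * y powr \<sigma> / h"
        using W[rule_format, OF \<sigma> h y0] by blast
      define K where "K = nat \<lfloor>y\<rfloor>"
      have K: "real K \<le> y" "y < real K + 1" unfolding K_def using y0 by (auto simp: of_nat_nat)
      have KN: "K \<le> N" using K(1) yx unfolding x_def by linarith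
      have "x - y \<le> x * h" using exp_ge_add_one_self[of "- h"] mult_left_mono[of "1 - h" "exp (- h)" x] x0
        by (simp add: y_def algebra_simps)
      then have cnt: "real (N - K) \<le> x * h + 1" using K(2) KN unfolding x_def by (simp add: of_nat_diff)
      have "(\<Sum>n=1..N. mangoldt_diff n) - (\<Sum>n=1..N. mangoldt_diff n * v n) = (\<Sum>n=1..N. mangoldt_diff n * (1 - v n))"
        by (simp only: sum_subtractf[symmetric] right_diff_distrib mult_1_right)
      also have "\<dots> = (\<Sum>n=1..K. mangoldt_diff n * (1 - v n)) + (\<Sum>n=K+1..N. mangoldt_diff n * (1 - v n))"
        by (rule sum_split_Icc[OF KN])
      also have "(\<Sum>n=1..K. mangoldt_diff n * (1 - v n)) = 0"
        by (intro sum.neutral ballI) (use v(2) K(1) in \<open>simp add: order.trans[of "real _" "real K" y]\<close>)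
      finally have e: "(\<Sum>n=1..N. mangoldt_diff n) = (\<Sum>n=1..N. mangoldt_diff n * v n) + (\<Sum>n=K+1..N. mangoldt_diff n * (1 - v n))"
        by simp
      have l0: "ln x \<ge> 0" using lx by linarith
      have "(\<Sum>n=K+1..N. mangoldt_diff n * (1 - v n)) \<ge> (\<Sum>n=K+1..N. - ln x)"
      proof (rule sum_mono)
        fix n assume n: "n \<in> {K+1..N}"
        have "- ln x \<le> - ln x * (1 - v n)" using v(1)[rule_format, of n] l0 by (simp add: mult_left_le)
        also have "\<dots> \<le> mangoldt_diff n * (1 - v n)"
          using n v(1)[rule_format, of n] b[of n N] unfolding x_def by (intro mult_right_mono) auto
        finally show "- ln x \<le> mangoldt_diff n * (1 - v n)" .
      qed
      moreover have "(\<Sum>n=K+1..N. - ln x) = - (real (N - K) * ln x)" by simp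
      moreover have "real (N - K) * ln x \<le> (x * h + 1) * ln x" using cnt l0 by (intro mult_right_mono)
      moreover have "(x * h + 1) * ln x = x * S + S * S"
        unfolding SS[symmetric] h_def using S1 by (simp add: field_simps)
      moreover have "real N \<ge> y * exp h" unfolding ye x_def by simp
      then have "\<bar>\<Sum>n=1..N. mangoldt_diff n * v n\<bar> \<le> C * exp 1 * (x * S)"
        using v(3)[rule_format, of N] main[OF y0 yx] by linarith
      ultimately have "- (\<Sum>n=1..N. mangoldt_diff n) \<le> C * exp 1 * (x * S) + x * S + S * S" using e by linarith
      also have "\<dots> \<le> C * exp 1 * (x * S) + 9 * (x * S)" using SSx xS by linarith
      finally show ?thesis by (simp only: distrib_right)
    qed
    show ?thesis using upper lower unfolding x_def[symmetric] S_def[symmetric] by (simp only: abs_le_iff)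
  qed
  moreover have "C * exp 1 + 9 > 0" using C by (simp add: add_pos_pos)
  ultimately show ?thesis by (intro exI[of _ "C * exp 1 + 9"]) simp
qed

section \<open>From the sum with \<open>mangoldt_diff\<close> to the prime counting function\<close>

lemma sum_ln_bounds:
  assumes "N \<ge> 1"
  shows "real N * ln (real N) - real N \<le> (\<Sum>n=1..N. ln (real n))" "(\<Sum>n=1..N. ln (real n)) \<le> real N * ln (real N)"
proof -
  show "real N * ln (real N) - real N \<le> (\<Sum>n=1..N. ln (real n))"
    using assms
  proof (induction N rule: dec_induct)
    case (step N)
    have N0: "real N > 0" using step by simp
    have "real (Suc N) = real N * (1 + 1 / real N)" using N0 by (simp add: field_simps)
    then have e: "ln (real (Suc N)) = ln (real N * (1 + 1 / real N))" by (simp only:)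
    have pos: "1 + 1 / real N > 0" using N0 by (intro add_pos_pos) simp_all
    have "ln (real N * (1 + 1 / real N)) = ln (real N) + ln (1 + 1 / real N)"
      by (subst ln_mult) (use N0 pos in force)+
    then have "ln (real (Suc N)) - ln (real N) = ln (1 + 1 / real N)" unfolding e by simp
    also have "\<dots> \<le> 1 / real N" using N0 by (intro ln_add_one_self_le_self) simp
    finally have "real N * (ln (real (Suc N)) - ln (real N)) \<le> real N * (1 / real N)"
      using N0 by (intro mult_left_mono) auto
    then have "real N * ln (real (Suc N)) - real N * ln (real N) \<le> 1" using N0 by (simp only: right_diff_distrib) simp
    moreover have "real (Suc N) * ln (real (Suc N)) = real N * ln (real (Suc N)) + ln (real (Suc N))"
      by (simp add: algebra_simps)
    moreover have "(\<Sum>n=1..Suc N. ln (real n)) = (\<Sum>n=1..N. ln (real n)) + ln (real (Suc N))"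
      by simp
    moreover have "real (Suc N) = real N + 1" by simp
    ultimately show ?case using step.IH by linarith
  qed simp
  have "(\<Sum>n=1..N. ln (real n)) \<le> (\<Sum>n=1..N. ln (real N))" by (intro sum_mono) auto
  then show "(\<Sum>n=1..N. ln (real n)) \<le> real N * ln (real N)" by simp
qed

text \<open>If \<open>p ^ k \<le> N\<close> and \<open>k \<ge> 2\<close>, then \<open>p\<close> is
  at most \<open>sqrt N\<close> and \<open>k\<close> at most the binary logarithm of
  \<open>N\<close>; counting all such pairs, starting from \<open>0\<close>, is enough.\<close>

lemma prime_powers_count:
  assumes "N \<ge> 1"
  shows "real (card {n \<in> {1..N}. primepow n \<and> \<not> prime n}) \<le> (sqrt (real N) + 1) * (ln (real N) / ln 2 + 1)"
proof -
  let ?A = "{..nat \<lfloor>sqrt (real N)\<rfloor>} :: nat set" and ?B = "{..nat \<lfloor>ln (real N) / ln 2\<rfloor>} :: nat set"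
  have sub: "{n \<in> {1..N}. primepow n \<and> \<not> prime n} \<subseteq> (\<lambda>(p, k). p ^ k) ` (?A \<times> ?B)"
  proof
    fix n assume n: "n \<in> {n \<in> {1..N}. primepow n \<and> \<not> prime n}"
    then obtain p k where pk: "prime p" "k > 0" "n = p ^ k" by (auto simp: primepow_def)
    have "k \<noteq> 1" using n pk by auto
    then have k: "k \<ge> 2" using pk by simp
    have p2: "p \<ge> 2" using pk prime_ge_2_nat by blast
    have "p ^ 2 \<le> p ^ k" using k p2 by (intro power_increasing) auto
    then have "p ^ 2 \<le> N" using n pk by simp
    then have "real (p ^ 2) \<le> real N" by (simp only: of_nat_le_iff)
    then have "real p \<le> sqrt (real N)" by (intro real_le_rsqrt) simp
    then have pA: "p \<in> ?A" by (simp add: le_nat_floor)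
    have "2 ^ k \<le> p ^ k" using p2 by (intro power_mono) auto
    moreover have "p ^ k \<le> N" using n pk by simp
    ultimately have "2 ^ k \<le> N" by (rule order.trans)
    then have "real (2 ^ k) \<le> real N" by (simp only: of_nat_le_iff)
    then have "ln (2 ^ k) \<le> ln (real N)" using assms by (subst ln_le_cancel_iff) auto
    then have "real k \<le> ln (real N) / ln 2" by (simp add: ln_realpow le_divide_eq)
    then have "k \<in> ?B" by (simp add: le_nat_floor)
    with pA pk(3) show "n \<in> (\<lambda>(p, k). p ^ k) ` (?A \<times> ?B)" by (intro image_eqI[of _ _ "(p, k)"]) auto
  qed
  have "card {n \<in> {1..N}. primepow n \<and> \<not> prime n} \<le> card ((\<lambda>(p, k). p ^ k) ` (?A \<times> ?B))"
    by (rule card_mono[OF _ sub]) simp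
  also have "\<dots> \<le> card (?A \<times> ?B)" by (rule card_image_le) simp
  also have "\<dots> = (nat \<lfloor>sqrt (real N)\<rfloor> + 1) * (nat \<lfloor>ln (real N) / ln 2\<rfloor> + 1)" by (simp add: card_cartesian_product)
  finally have "real (card {n \<in> {1..N}. primepow n \<and> \<not> prime n}) \<le>
      real ((nat \<lfloor>sqrt (real N)\<rfloor> + 1) * (nat \<lfloor>ln (real N) / ln 2\<rfloor> + 1))" by (simp only: of_nat_le_iff)
  also have "\<dots> = (real (nat \<lfloor>sqrt (real N)\<rfloor>) + 1) * (real (nat \<lfloor>ln (real N) / ln 2\<rfloor>) + 1)"
    by (simp only: of_nat_mult of_nat_add of_nat_1)
  also have "\<dots> \<le> (sqrt (real N) + 1) * (ln (real N) / ln 2 + 1)"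
    using assms by (intro mult_mono add_mono) auto
  finally show ?thesis .
qed

text \<open>At a prime, \<open>mangoldt p * ln p\<close> is \<open>ln p ^ 2\<close>. Proper prime
  powers, the defect of the sum of \<open>ln n\<close> from \<open>N ln N\<close>, and the rounding
  of \<open>x\<close> to an integer all cost no more than the error term already present.\<close>

lemma sum_prime_ln2_bound:
  "\<exists>C>0. eventually (\<lambda>x. \<bar>(\<Sum>p | prime p \<and> real p \<le> x. ln (real p) ^ 2) - x * ln x\<bar> \<le> C * (x * sqrt (ln x))) at_top"
proof -
  obtain C where C: "C > 0" and B: "\<forall>N. ln (real N) \<ge> 1 \<longrightarrow> \<bar>\<Sum>n=1..N. mangoldt_diff n\<bar> \<le> C * (real N * sqrt (ln (real N)))"
    using sum_mangoldt_diff_bound by blast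
  have bnd: "\<bar>(\<Sum>p | prime p \<and> real p \<le> x. ln (real p) ^ 2) - x * ln x\<bar> \<le> (C + 4) * (x * sqrt (ln x))"
    if x: "ln (x - 1) \<ge> 1" "x \<ge> 2" and pp: "(sqrt x + 1) * (ln x / ln 2 + 1) * ln x ^ 2 \<le> x * sqrt (ln x)"
      and dd: "x * ln x - (x - 1) * ln (x - 1) \<le> x * sqrt (ln x)" for x
  proof -
    define N where "N = nat \<lfloor>x\<rfloor>"
    have N: "real N \<le> x" "x < real N + 1" unfolding N_def using x by (auto simp: of_nat_nat)
    have N1: "N \<ge> 1" using N x by linarith
    have Np: "real p \<le> x \<longleftrightarrow> p \<le> N" for p
    proof
      assume "p \<le> N"
      then have "real p \<le> real N" by simp
      then show "real p \<le> x" using N(1) by (rule order.trans)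
    qed (simp add: N_def le_nat_floor)
    have lnN: "ln (real N) \<ge> 1"
    proof -
      have "ln (x - 1) \<le> ln (real N)" using N x N1 by (subst ln_le_cancel_iff) auto
      then show ?thesis using x(1) by linarith
    qed
    have lNx: "ln (real N) \<le> ln x" using N N1 by (subst ln_le_cancel_iff) auto
    have lx: "ln x \<ge> 1" using lnN lNx by linarith
    let ?T = "\<Sum>p | prime p \<and> real p \<le> x. ln (real p) ^ 2"
    let ?M = "\<Sum>n=1..N. mangoldt n * ln (real n)"
    let ?P = "{n \<in> {1..N}. primepow n \<and> \<not> prime n}"
    have M: "?M = (\<Sum>n=1..N. mangoldt_diff n) + (\<Sum>n=1..N. ln (real n))"
      by (simp only: sum.distrib[symmetric] diff_add_cancel)
    have f2: "?M - ?T = (\<Sum>n\<in>?P. mangoldt n * ln (real n))"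
    proof -
      have primes: "{p. prime p \<and> real p \<le> x} = {n \<in> {1..N}. prime n}"
        unfolding Np by (auto simp: Suc_le_eq prime_gt_0_nat)
      have T: "?T = (\<Sum>n\<in>{n \<in> {1..N}. prime n}. mangoldt n * ln (real n))"
        unfolding primes by (rule sum.cong) (auto simp: power2_eq_square)
      have "?M = (\<Sum>n\<in>{n \<in> {1..N}. prime n} \<union> ?P. mangoldt n * ln (real n))"
        by (rule sum.mono_neutral_right) (auto simp: mangoldt_def)
      also have "\<dots> = (\<Sum>n\<in>{n \<in> {1..N}. prime n}. mangoldt n * ln (real n)) + (\<Sum>n\<in>?P. mangoldt n * ln (real n))"
        by (rule sum.union_disjoint) auto
      finally show ?thesis unfolding T by simp
    qed
    have f3: "(\<Sum>n\<in>?P. mangoldt n * ln (real n)) \<ge> 0"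
      by (intro sum_nonneg mult_nonneg_nonneg mangoldt_nonneg) auto
    have f4: "(\<Sum>n\<in>?P. mangoldt n * ln (real n)) \<le> x * sqrt (ln x)"
    proof -
      have "(\<Sum>n\<in>?P. mangoldt n * ln (real n)) \<le> (\<Sum>n\<in>?P. ln x ^ 2)"
      proof (rule sum_mono)
        fix n assume n: "n \<in> ?P"
        have "ln (real n) \<le> ln x" using n N by (subst ln_le_cancel_iff) auto
        moreover have "mangoldt n \<le> ln (real n)" using n by (intro mangoldt_le) auto
        ultimately show "mangoldt n * ln (real n) \<le> ln x ^ 2"
          unfolding power2_eq_square using n lx by (intro mult_mono) auto
      qed
      also have "\<dots> = real (card ?P) * ln x ^ 2" by simp
      also have "\<dots> \<le> ((sqrt (real N) + 1) * (ln (real N) / ln 2 + 1)) * ln x ^ 2"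
        by (intro mult_right_mono prime_powers_count N1) simp
      also have "\<dots> \<le> ((sqrt x + 1) * (ln x / ln 2 + 1)) * ln x ^ 2"
        using N N1 lNx lnN by (intro mult_right_mono mult_mono add_mono divide_right_mono) auto
      also have "\<dots> \<le> x * sqrt (ln x)" using pp by simp
      finally show ?thesis .
    qed
    have f5: "\<bar>\<Sum>n=1..N. mangoldt_diff n\<bar> \<le> C * (x * sqrt (ln x))"
    proof -
      have "\<bar>\<Sum>n=1..N. mangoldt_diff n\<bar> \<le> C * (real N * sqrt (ln (real N)))" using B lnN by blast
      also have "\<dots> \<le> C * (x * sqrt (ln x))" using C N lNx lnN by (intro mult_left_mono mult_mono) auto
      finally show ?thesis .
    qed
    have f8: "real N * ln (real N) \<le> x * ln x" using N lNx lnN lx x by (intro mult_mono) auto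
    have f9: "(x - 1) * ln (x - 1) \<le> real N * ln (real N)"
    proof (intro mult_mono)
      show "ln (x - 1) \<le> ln (real N)" using N x N1 by (subst ln_le_cancel_iff) auto
    qed (use N x in auto)
    have f11: "real N \<le> x * sqrt (ln x)"
    proof -
      have "real N * 1 \<le> x * sqrt (ln x)" using N lx x by (intro mult_mono) auto
      then show ?thesis by simp
    qed
    \<comment> \<open>The bookkeeping of all error terms, abstracted to a statement of linear
      arithmetic.\<close>
    have comb: "\<bar>t - e\<bar> \<le> cs + 4 * xs"
      if "m = b + l" "m - t = pw" "pw \<ge> 0" "pw \<le> xs" "\<bar>b\<bar> \<le> cs" "ll - n \<le> l" "l \<le> ll" "ll \<le> e" "d \<le> ll" "e - d \<le> xs" "n \<le> xs"
      for t e m b l pw xs cs ll n d :: real using that by linarith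
    show ?thesis
      using comb[OF M f2 f3 f4 f5 sum_ln_bounds[OF N1] f8 f9 dd f11] by (simp only: distrib_right)
  qed
  have "eventually (\<lambda>x. ln (x - 1) \<ge> (1::real)) at_top" by real_asymp
  moreover have "eventually (\<lambda>x::real. x \<ge> 2) at_top" by real_asymp
  moreover have "eventually (\<lambda>x::real. (sqrt x + 1) * (ln x / ln 2 + 1) * ln x ^ 2 \<le> x * sqrt (ln x)) at_top" by real_asymp
  moreover have "eventually (\<lambda>x::real. x * ln x - (x - 1) * ln (x - 1) \<le> x * sqrt (ln x)) at_top" by real_asymp
  ultimately have "eventually (\<lambda>x. \<bar>(\<Sum>p | prime p \<and> real p \<le> x. ln (real p) ^ 2) - x * ln x\<bar> \<le> (C + 4) * (x * sqrt (ln x))) at_top"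
    by eventually_elim (rule bnd)
  moreover have "C + 4 > 0" using C by simp
  ultimately show ?thesis by blast
qed

lemma prime_pi_finite: "finite {p::nat. prime p \<and> real p \<le> x}"
proof (rule finite_subset)
  show "{p::nat. prime p \<and> real p \<le> x} \<subseteq> {..nat \<lfloor>x\<rfloor>}" by (auto simp: le_nat_floor)
qed simp

lemma prime_pi_le: "x \<ge> 0 \<Longrightarrow> real (prime_pi x) \<le> x"
proof -
  assume x: "x \<ge> 0"
  have "prime_pi x \<le> card {1..nat \<lfloor>x\<rfloor>}"
    unfolding prime_pi_def by (intro card_mono) (auto simp: le_nat_floor Suc_le_eq prime_gt_0_nat)
  then show ?thesis using x by simp linarith
qed

text \<open>Partial summation is avoided. From below, every prime up to \<open>x\<close> contributes
  at most \<open>ln x ^ 2\<close>. From above, all primes beyond a slightly smaller \<open>y\<close>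
  contribute at least \<open>ln y ^ 2\<close>, and there are at most \<open>y\<close>
  others.\<close>

lemma prime_number_theorem_sqrt:
  "\<exists>C>0. eventually (\<lambda>x. \<bar>real (prime_pi x) * ln x / x - 1\<bar> \<le> C / sqrt (ln x)) at_top"
proof -
  obtain C where C: "C > 0" and B: "eventually (\<lambda>x. \<bar>(\<Sum>p | prime p \<and> real p \<le> x. ln (real p) ^ 2) - x * ln x\<bar> \<le> C * (x * sqrt (ln x))) at_top"
    using sum_prime_ln2_bound by blast
  have lower: "real (prime_pi x) * ln x / x - 1 \<ge> - (C / sqrt (ln x))"
    if x: "ln x \<ge> 1" "x \<ge> 2" and b: "\<bar>(\<Sum>p | prime p \<and> real p \<le> x. ln (real p) ^ 2) - x * ln x\<bar> \<le> C * (x * sqrt (ln x))" for x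
  proof -
    have "(\<Sum>p | prime p \<and> real p \<le> x. ln (real p) ^ 2) \<le> (\<Sum>p | prime p \<and> real p \<le> x. ln x ^ 2)"
    proof (intro sum_mono power_mono)
      fix p assume p: "p \<in> {p. prime p \<and> real p \<le> x}"
      then have "p \<ge> 1" using prime_gt_0_nat[of p] by simp
      then show "ln (real p) \<le> ln x" "0 \<le> ln (real p)" using p x by simp_all
    qed
    also have "\<dots> = real (prime_pi x) * ln x ^ 2" by (simp add: prime_pi_def)
    finally have "real (prime_pi x) * ln x ^ 2 \<ge> x * ln x - C * (x * sqrt (ln x))" using b by linarith
    then have "(x * ln x - C * (x * sqrt (ln x))) / (x * ln x) \<le> real (prime_pi x) * ln x ^ 2 / (x * ln x)"
      using x by (intro divide_right_mono) auto
    also have "\<dots> = real (prime_pi x) * ln x / x" using x by (simp add: power2_eq_square)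
    also have "(x * ln x - C * (x * sqrt (ln x))) / (x * ln x) = 1 - C * (sqrt (ln x) / ln x)"
      using x by (simp add: diff_divide_distrib)
    also have "sqrt (ln x) / ln x = 1 / sqrt (ln x)" using x by (simp add: sqrt_divide_self_eq inverse_eq_divide)
    finally show ?thesis by simp
  qed
  have upper: "real (prime_pi x) * ln x / x - 1 \<le> 1 / ln x + (1 + C / sqrt (ln x)) / (1 - 2 * ln (ln x) / ln x)\<^sup>2 - 1"
    if x: "ln x \<ge> 1" "x \<ge> 2" "2 * ln (ln x) < ln x" "x / ln x ^ 2 \<ge> 1"
      and b: "\<bar>(\<Sum>p | prime p \<and> real p \<le> x. ln (real p) ^ 2) - x * ln x\<bar> \<le> C * (x * sqrt (ln x))" for x
  proof -
    \<comment> \<open>Small enough that the primes up to \<open>y\<close> have relative weight at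
      most \<open>1 / ln x\<close>, and large enough that \<open>ln y\<close> differs from
      \<open>ln x\<close> by \<open>2 * ln (ln x)\<close> only.\<close>
    define y where "y = x / ln x ^ 2"
    have x0: "x > 0" using x by simp
    have y1: "y \<ge> 1" using x by (simp add: y_def)
    have ly: "ln y = ln x - 2 * ln (ln x)" using x unfolding y_def by (subst ln_div) (auto simp: ln_realpow)
    have ly0: "ln y > 0" using x ly by simp
    have yx: "y \<le> x"
    proof -
      have "x / ln x ^ 2 \<le> x / 1" using x by (intro divide_left_mono one_le_power) auto
      then show ?thesis by (simp add: y_def)
    qed
    let ?S = "{p::nat. prime p \<and> y < real p \<and> real p \<le> x}"
    have fS: "finite ?S" by (rule finite_subset[OF _ prime_pi_finite[of x]]) auto
    have "{p::nat. prime p \<and> real p \<le> x} = {p. prime p \<and> real p \<le> y} \<union> ?S" using yx by auto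
    then have "prime_pi x = card ({p. prime p \<and> real p \<le> y} \<union> ?S)" by (simp only: prime_pi_def)
    also have "\<dots> = prime_pi y + card ?S"
      unfolding prime_pi_def by (rule card_Un_disjoint[OF prime_pi_finite fS]) auto
    finally have e: "real (prime_pi x) = real (prime_pi y) + real (card ?S)" by simp
    have "real (card ?S) * ln y ^ 2 = (\<Sum>p\<in>?S. ln y ^ 2)" by simp
    also have "\<dots> \<le> (\<Sum>p\<in>?S. ln (real p) ^ 2)"
      using y1 ly0 by (intro sum_mono power_mono) auto
    also have "\<dots> \<le> (\<Sum>p | prime p \<and> real p \<le> x. ln (real p) ^ 2)"
      by (rule sum_mono2[OF prime_pi_finite]) auto
    also have "\<dots> \<le> x * ln x + C * (x * sqrt (ln x))" using b by linarith
    finally have cS: "real (card ?S) \<le> (x * ln x + C * (x * sqrt (ln x))) / ln y ^ 2"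
      using ly0 by (subst le_divide_eq) auto
    have "real (prime_pi x) * ln x / x \<le> (y + (x * ln x + C * (x * sqrt (ln x))) / ln y ^ 2) * ln x / x"
      unfolding e using cS prime_pi_le[of y] y1 x by (intro divide_right_mono mult_right_mono add_mono) auto
    also have "\<dots> = y * ln x / x + (x * ln x + C * (x * sqrt (ln x))) / ln y ^ 2 * ln x / x"
      by (simp only: distrib_right add_divide_distrib)
    also have "y * ln x / x = 1 / ln x" unfolding y_def using x x0 by (simp add: power2_eq_square)
    also have "(x * ln x + C * (x * sqrt (ln x))) / ln y ^ 2 * ln x / x = (ln x + C * sqrt (ln x)) * ln x / ln y ^ 2"
      using x0 ly0 by (simp add: field_simps)
    also have "ln y = ln x * (1 - 2 * ln (ln x) / ln x)" unfolding ly using x by (simp add: right_diff_distrib)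
    also have "(ln x + C * sqrt (ln x)) * ln x / (ln x * (1 - 2 * ln (ln x) / ln x)) ^ 2
        = (ln x + C * sqrt (ln x)) / ln x / (1 - 2 * ln (ln x) / ln x) ^ 2"
      using x by (simp add: power_mult_distrib power2_eq_square)
    also have "(ln x + C * sqrt (ln x)) / ln x = 1 + C * (sqrt (ln x) / ln x)"
      using x by (simp add: add_divide_distrib)
    also have "sqrt (ln x) / ln x = 1 / sqrt (ln x)" using x by (simp add: sqrt_divide_self_eq inverse_eq_divide)
    finally show ?thesis by simp
  qed
  \<comment> \<open>With \<open>L = ln x\<close> the upper bound is an explicit function whose
    leading error is \<open>C / sqrt L\<close>; the terms of order \<open>ln L / L\<close> are
    smaller.\<close>
  have "(\<lambda>L. 1 / L + (1 + C / sqrt L) / (1 - 2 * ln L / L)\<^sup>2 - 1) \<in> O(\<lambda>L. 1 / sqrt L)"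
    using C by real_asymp
  then obtain D where D: "D > 0" and evD: "eventually (\<lambda>L. norm (1 / L + (1 + C / sqrt L) / (1 - 2 * ln L / L)\<^sup>2 - 1) \<le> D * norm (1 / sqrt L)) at_top"
    by (rule landau_o.bigE)
  have "eventually (\<lambda>x::real. norm (1 / ln x + (1 + C / sqrt (ln x)) / (1 - 2 * ln (ln x) / ln x)\<^sup>2 - 1) \<le> D * norm (1 / sqrt (ln x))) at_top"
    by (rule eventually_compose_filterlim[OF evD ln_at_top])
  moreover have "eventually (\<lambda>x::real. ln x \<ge> 1) at_top" by real_asymp
  moreover have "eventually (\<lambda>x::real. x \<ge> 2) at_top" by real_asymp
  moreover have "eventually (\<lambda>x::real. 2 * ln (ln x) < ln x) at_top" by real_asymp
  moreover have "eventually (\<lambda>x::real. x / ln x ^ 2 \<ge> 1) at_top" by real_asymp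
  moreover note B
  ultimately have "eventually (\<lambda>x. \<bar>real (prime_pi x) * ln x / x - 1\<bar> \<le> (C + D) / sqrt (ln x)) at_top"
  proof eventually_elim
    case (elim x)
    have s: "sqrt (ln x) > 0" using elim(2) by simp
    have "norm (1 / sqrt (ln x)) = 1 / sqrt (ln x)" using s by simp
    then have 1: "\<bar>1 / ln x + (1 + C / sqrt (ln x)) / (1 - 2 * ln (ln x) / ln x)\<^sup>2 - 1\<bar> \<le> D / sqrt (ln x)"
      using elim(1) by simp
    have 2: "C / sqrt (ln x) \<ge> 0" "D / sqrt (ln x) \<ge> 0" using C D s by simp_all
    have "\<bar>z\<bar> \<le> c + d" if "z \<ge> - c" "z \<le> e" "\<bar>e\<bar> \<le> d" "c \<ge> 0" "d \<ge> 0" for z c d e :: real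
      using that by linarith
    from this[OF lower[OF elim(2,3,6)] upper[OF elim(2-6)] 1 2] show ?case by (simp only: add_divide_distrib)
  qed
  moreover have "C + D > 0" using C D by simp
  ultimately show ?thesis by blast
qed

subsection \<open>Minimal generators and composite numbers\<close>

lemma infinite_primes_nat: "infinite {p::nat. prime p}"
  using primes_infinite .

lemma nth_prime_prime: "prime (nth_prime i)"
  unfolding nth_prime_def using enumerate_in_set[OF infinite_primes_nat] by simp

lemma inj_on_nth_prime: "inj_on nth_prime {1..}"
proof (rule inj_onI)
  fix i j :: nat assume "i \<in> {1..}" "j \<in> {1..}" "nth_prime i = nth_prime j"
  then have "i - 1 = j - 1"
    using strict_mono_enumerate[OF infinite_primes_nat] unfolding nth_prime_def
    by (simp add: strict_mono_eq)
  then show "i = j" using \<open>i \<in> {1..}\<close> \<open>j \<in> {1..}\<close> by auto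
qed

lemma downward_closed_eq_lessThan:
  assumes "finite J" "\<And>i j. j \<in> J \<Longrightarrow> i < j \<Longrightarrow> i \<in> J"
  shows "J = {..<card (J :: nat set)}"
proof -
  define k where "k = (LEAST k. k \<notin> J)"
  have "\<exists>k. k \<notin> J" using assms(1) ex_new_if_finite infinite_UNIV_nat by blast
  then have k: "k \<notin> J" unfolding k_def by (rule LeastI_ex)
  have "i \<in> J" if "i < k" for i using not_less_Least[of i "\<lambda>k. k \<notin> J"] that by (auto simp: k_def)
  moreover have "i < k" if "i \<in> J" for i using assms(2)[OF that, of k] k that by (cases rule: linorder_cases[of i k]) auto
  ultimately have "J = {..<k}" by auto
  then show ?thesis by simp
qed

lemma nth_prime_image: "nth_prime ` {1..prime_pi (real n)} = {p. prime p \<and> p \<le> n}"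
proof -
  let ?e = "enumerate {p::nat. prime p}"
  define J where "J = {j. ?e j \<le> n}"
  have mono: "strict_mono ?e" by (rule strict_mono_enumerate[OF infinite_primes_nat])
  have img: "?e ` J = {p. prime p \<and> p \<le> n}"
  proof (intro equalityI subsetI)
    fix p assume p: "p \<in> {p. prime p \<and> p \<le> n}"
    then obtain j where "?e j = p" using enumerate_Ex[OF infinite_primes_nat, of p] by auto
    then show "p \<in> ?e ` J" using p by (auto simp: J_def)
  qed (use enumerate_in_set[OF infinite_primes_nat] in \<open>auto simp: J_def\<close>)
  have inj: "inj_on ?e J" using inj_enumerate[OF infinite_primes_nat] by (rule inj_on_subset) simp
  have "finite (?e ` J)" unfolding img by (rule finite_subset[of _ "{..n}"]) auto
  then have fin: "finite J" using inj by (rule finite_imageD)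
  have down: "i \<in> J" if "j \<in> J" "i < j" for i j
    using that strict_monoD[OF mono that(2)] by (simp add: J_def)
  have "card J = card (?e ` J)" using inj by (simp add: card_image)
  then have "card J = prime_pi (real n)" unfolding img prime_pi_def by simp
  then have J: "J = {..<prime_pi (real n)}" using downward_closed_eq_lessThan[OF fin down] by simp
  have "(\<lambda>i. i - 1) ` {1..prime_pi (real n)} = {..<prime_pi (real n)}"
    by (auto simp: image_iff intro!: bexI[of _ "Suc _"])
  then have e: "{..<prime_pi (real n)} = (\<lambda>i. i - 1) ` {1..prime_pi (real n)}" ..
  have "nth_prime ` {1..prime_pi (real n)} = ?e ` {..<prime_pi (real n)}"
    unfolding e image_image nth_prime_def ..
  then show ?thesis using img J by simp
qed

section \<open>Monomials as integers: divisibility and minimality\<close>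

lemma weight_superset:
  assumes "finite B" "Poly_Mapping.keys a \<subseteq> B"
  shows "weight a = (\<Prod>i\<in>B. nth_prime i ^ Poly_Mapping.lookup a i)"
  unfolding weight_def using assms by (intro prod.mono_neutral_left) (auto simp: in_keys_iff)

lemma weight_add: "weight (a + b) = weight a * weight b"
proof -
  let ?B = "Poly_Mapping.keys a \<union> Poly_Mapping.keys b \<union> Poly_Mapping.keys (a + b)"
  have "weight (a + b) = (\<Prod>i\<in>?B. nth_prime i ^ Poly_Mapping.lookup (a + b) i)"
    by (rule weight_superset) auto
  also have "\<dots> = (\<Prod>i\<in>?B. nth_prime i ^ Poly_Mapping.lookup a i) * (\<Prod>i\<in>?B. nth_prime i ^ Poly_Mapping.lookup b i)"
    by (simp add: lookup_add power_add prod.distrib)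
  also have "\<dots> = weight a * weight b"
    by (subst (1 2) weight_superset[symmetric]) auto
  finally show ?thesis .
qed

lemma weight_pos: "weight a > 0"
  unfolding weight_def by (intro prod_pos) (simp add: nth_prime_prime prime_gt_0_nat)

lemma multiplicity_weight:
  assumes a: "a \<in> exponents r" and j: "j \<ge> 1"
  shows "multiplicity (nth_prime j) (weight a) = Poly_Mapping.lookup a j"
proof -
  \<comment> \<open>\<open>j\<close> may exceed \<open>r\<close>; the index set is enlarged so that
    the multiplicity at \<open>j\<close> can be read off in that case too.\<close>
  let ?B = "{1..max r j}"
  define g where "g = inv_into {1..} nth_prime"
  have g: "g (nth_prime i) = i" if "i \<ge> 1" for i
    unfolding g_def using that by (intro inv_into_f_f inj_on_nth_prime) simp
  have inj: "inj_on nth_prime ?B" by (rule inj_on_subset[OF inj_on_nth_prime]) auto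
  have "weight a = (\<Prod>i\<in>?B. nth_prime i ^ Poly_Mapping.lookup a i)"
  proof (rule weight_superset)
    have "{1..r} \<subseteq> ?B" by auto
    with a show "Poly_Mapping.keys a \<subseteq> ?B" unfolding exponents_def by blast
  qed simp
  also have "\<dots> = (\<Prod>i\<in>?B. nth_prime i ^ Poly_Mapping.lookup a (g (nth_prime i)))"
    by (intro prod.cong refl) (simp add: g)
  also have "\<dots> = (\<Prod>p\<in>nth_prime ` ?B. p ^ Poly_Mapping.lookup a (g p))"
    by (subst prod.reindex[OF inj]) simp
  finally have "multiplicity (nth_prime j) (weight a) =
      (if nth_prime j \<in> nth_prime ` ?B then Poly_Mapping.lookup a (g (nth_prime j)) else 0)"
    by (simp only:) (rule multiplicity_prod_prime_powers, auto simp: nth_prime_prime)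
  then show ?thesis using j by (simp add: g)
qed

lemma weight_inj:
  assumes "a \<in> exponents r" "b \<in> exponents r" "weight a = weight b"
  shows "a = b"
proof (rule poly_mapping_eqI)
  fix i
  show "Poly_Mapping.lookup a i = Poly_Mapping.lookup b i"
  proof (cases "i \<ge> 1")
    case True
    then show ?thesis using multiplicity_weight[OF assms(1) True] multiplicity_weight[OF assms(2) True] assms(3) by simp
  next
    case False
    then have "i \<notin> Poly_Mapping.keys a" "i \<notin> Poly_Mapping.keys b"
      using assms(1,2) unfolding exponents_def by force+
    then show ?thesis by (simp add: in_keys_iff)
  qed
qed

text \<open>Unique factorization: the monomials in the variables of the ring correspond to the
  integers all of whose prime factors are at most \<open>n\<close>, the exponents being the
  multiplicities.\<close>

lemma weight_image:
  "weight ` exponents (prime_pi (real n)) = {m. m > 0 \<and> (\<forall>p. prime p \<and> p dvd m \<longrightarrow> p \<le> n)}"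
proof (intro equalityI subsetI)
  fix m assume "m \<in> weight ` exponents (prime_pi (real n))"
  then obtain a where a: "a \<in> exponents (prime_pi (real n))" "m = weight a" by auto
  have "p \<le> n" if p: "prime p" "p dvd m" for p
  proof -
    obtain i where i: "i \<in> Poly_Mapping.keys a" "p dvd nth_prime i ^ Poly_Mapping.lookup a i"
      using p unfolding a(2) weight_def by (subst (asm) prime_dvd_prod_iff) auto
    then have "p dvd nth_prime i" using p(1) prime_dvd_power by blast
    then have "p = nth_prime i" by (rule primes_dvd_imp_eq[OF p(1) nth_prime_prime])
    moreover have "i \<in> {1..prime_pi (real n)}" using a(1) i(1) by (auto simp: exponents_def)
    ultimately show ?thesis using nth_prime_image[of n] by blast
  qed
  then show "m \<in> {m. m > 0 \<and> (\<forall>p. prime p \<and> p dvd m \<longrightarrow> p \<le> n)}" using weight_pos a(2) by auto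
next
  fix m assume m: "m \<in> {m. m > 0 \<and> (\<forall>p. prime p \<and> p dvd m \<longrightarrow> p \<le> n)}"
  let ?r = "prime_pi (real n)"
  define a where "a = (\<Sum>i\<in>{1..?r}. Poly_Mapping.single i (multiplicity (nth_prime i) m))"
  have lk: "Poly_Mapping.lookup a i = (if i \<in> {1..?r} then multiplicity (nth_prime i) m else 0)" for i
    unfolding a_def by (simp add: lookup_sum lookup_single when_def)
  have keys: "Poly_Mapping.keys a \<subseteq> {1..?r}" by (auto simp: in_keys_iff lk split: if_splits)
  have "weight a = (\<Prod>i\<in>{1..?r}. nth_prime i ^ Poly_Mapping.lookup a i)"
    by (rule weight_superset) (use keys in auto)
  also have "\<dots> = (\<Prod>i\<in>{1..?r}. nth_prime i ^ multiplicity (nth_prime i) m)"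
    by (intro prod.cong refl) (simp add: lk)
  also have "\<dots> = (\<Prod>p\<in>nth_prime ` {1..?r}. p ^ multiplicity p m)"
  proof -
    have "inj_on nth_prime {1..?r}" by (rule inj_on_subset[OF inj_on_nth_prime]) auto
    then show ?thesis by (subst prod.reindex) simp_all
  qed
  also have "\<dots> = (\<Prod>p\<in>prime_factors m. p ^ multiplicity p m)"
    unfolding nth_prime_image
  proof (rule prod.mono_neutral_right)
    show "finite {p. prime p \<and> p \<le> n}" by (rule finite_subset[of _ "{..n}"]) auto
    show "prime_factors m \<subseteq> {p. prime p \<and> p \<le> n}" using m by (auto simp: in_prime_factors_iff)
    show "\<forall>p\<in>{p. prime p \<and> p \<le> n} - prime_factors m. p ^ multiplicity p m = 1"
      using m by (auto simp: in_prime_factors_iff not_dvd_imp_multiplicity_0)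
  qed
  also have "\<dots> = m" using m by (intro prime_factorization_nat[symmetric]) simp
  finally show "m \<in> weight ` exponents ?r" using keys by (auto simp: exponents_def)
qed

lemma divides_exp_iff_weight:
  assumes a: "a \<in> exponents r" and b: "b \<in> exponents r"
  shows "divides_exp a b \<longleftrightarrow> weight a dvd weight b"
proof
  assume "divides_exp a b"
  then show "weight a dvd weight b" by (auto simp: divides_exp_def weight_add)
next
  assume dvd: "weight a dvd weight b"
  have le: "Poly_Mapping.lookup a i \<le> Poly_Mapping.lookup b i" for i
  proof (cases "i \<ge> 1")
    case True
    then show ?thesis
      using dvd_imp_multiplicity_le[OF dvd, of "nth_prime i"] weight_pos[of b]
        multiplicity_weight[OF a True] multiplicity_weight[OF b True] by simp
  next
    case False
    then have "i \<notin> Poly_Mapping.keys a" using a unfolding exponents_def by force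
    then show ?thesis by (simp add: in_keys_iff)
  qed
  have "b = a + (b - a)"
    by (rule poly_mapping_eqI) (simp add: lookup_add lookup_minus le)
  then show "divides_exp a b" unfolding divides_exp_def by blast
qed

text \<open>The weights of the minimal generators. A divisor of \<open>m\<close> inherits the
  restriction on prime factors, so minimality may be tested against all divisors above
  \<open>n\<close>.\<close>

definition min_weights :: "nat \<Rightarrow> nat set" where
  "min_weights n = {m. m > n \<and> (\<forall>p. prime p \<and> p dvd m \<longrightarrow> p \<le> n) \<and> (\<forall>d. d dvd m \<and> d > n \<longrightarrow> d = m)}"

text \<open>\<open>weight\<close> is injective and translates divisibility of monomials into
  divisibility of integers, so minimal exponent vectors go to minimal weights.\<close>

lemma num_gens_eq_card: "num_gens (K :: 'k :: field_char_0 itself) n = card (min_weights n)"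
proof -
  let ?r = "prime_pi (real n)"
  let ?A = "{a \<in> exponents ?r. weight a > n}"
  have "num_gens K n = card (monom ` min_exps ?A :: ((nat \<Rightarrow>\<^sub>0 nat) \<Rightarrow>\<^sub>0 'k) set)"
    unfolding num_gens_def weight_ideal_def by (subst min_monomial_gens_eq) auto
  also have "\<dots> = card (min_exps ?A)"
  proof (rule card_image, rule inj_onI)
    fix a b assume "(monom a :: (nat \<Rightarrow>\<^sub>0 nat) \<Rightarrow>\<^sub>0 'k) = monom b"
    then have "Poly_Mapping.keys (monom a :: (nat \<Rightarrow>\<^sub>0 nat) \<Rightarrow>\<^sub>0 'k) = Poly_Mapping.keys (monom b :: (nat \<Rightarrow>\<^sub>0 nat) \<Rightarrow>\<^sub>0 'k)" by simp
    then show "a = b" by (simp add: monom_def)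
  qed
  also have "\<dots> = card (weight ` min_exps ?A)"
    
  proof (rule card_image[symmetric], rule inj_onI)
    fix a b assume "a \<in> min_exps ?A" "b \<in> min_exps ?A" "weight a = weight b"
    then show "a = b" by (intro weight_inj[of a ?r b]) (simp_all add: min_exps_def)
  qed
  also have "weight ` min_exps ?A = min_weights n"
  proof (intro equalityI subsetI)
    fix m assume "m \<in> weight ` min_exps ?A"
    then obtain a where a: "a \<in> exponents ?r" "weight a > n" "m = weight a"
      and least: "\<And>b. b \<in> ?A \<Longrightarrow> divides_exp b a \<Longrightarrow> b = a" by (auto simp: min_exps_def)
    have sm: "\<forall>p. prime p \<and> p dvd m \<longrightarrow> p \<le> n" using weight_image[of n] a by blast
    have "d = m" if d: "d dvd m" "d > n" for d
    proof -
      have "d \<in> weight ` exponents ?r"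
        unfolding weight_image using d sm by (auto intro: dvd_trans)
      then obtain b where b: "b \<in> exponents ?r" "d = weight b" by auto
      then have "b = a" using d a divides_exp_iff_weight[of b ?r a] by (intro least) auto
      then show ?thesis using a b by simp
    qed
    then show "m \<in> min_weights n" unfolding min_weights_def using a sm by blast
  next
    fix m assume m: "m \<in> min_weights n"
    then have "m \<in> weight ` exponents ?r" unfolding weight_image min_weights_def by auto
    then obtain a where a: "a \<in> exponents ?r" "m = weight a" by auto
    have "a \<in> min_exps ?A" unfolding min_exps_def
    proof (intro CollectI conjI ballI impI)
      show "a \<in> exponents ?r" by fact
      show "weight a > n" using m a by (simp add: min_weights_def)
      fix b assume b: "b \<in> ?A" "divides_exp b a"
      then have "weight b dvd m" using a divides_exp_iff_weight[of b ?r a] by simp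
      then have "weight b = weight a" using m b a unfolding min_weights_def by blast
      then show "b = a" using a b by (intro weight_inj[of b ?r a]) simp_all
    qed
    then show "m \<in> weight ` min_exps ?A" using a by blast
  qed
  finally show ?thesis .
qed

section \<open>Splitting off the least prime factor\<close>

lemma lpf_props:
  assumes "x \<ge> 2"
  shows "prime (lpf x)" "lpf x dvd x" "\<And>p. prime p \<Longrightarrow> p dvd x \<Longrightarrow> lpf x \<le> p"
proof -
  obtain p where "prime p" "p dvd x" using prime_factor_nat[of x] assms by auto
  then have "p \<in> prime_factors x" using assms by (simp add: in_prime_factors_iff)
  then have ne: "prime_factors x \<noteq> {}" by blast
  have "lpf x \<in> prime_factors x" unfolding lpf_def using ne by (intro Min_in) auto
  then show "prime (lpf x)" "lpf x dvd x" by (auto simp: in_prime_factors_iff)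
  show "lpf x \<le> p" if "prime p" "p dvd x" for p
    unfolding lpf_def using that assms by (intro Min_le) (auto simp: in_prime_factors_iff)
qed

lemma lpf_mult:
  assumes "x \<ge> 2" "prime p" "p \<le> lpf x"
  shows "lpf (p * x) = p"
proof (rule antisym)
  have px: "p * x \<ge> 2" using mult_le_mono[of 1 p 2 x] assms prime_gt_0_nat[of p] by simp
  show "lpf (p * x) \<le> p" by (rule lpf_props(3)[OF px assms(2)]) simp
  have "lpf (p * x) dvd p \<or> lpf (p * x) dvd x" using lpf_props[OF px] prime_dvd_multD by blast
  then show "p \<le> lpf (p * x)"
  proof
    assume "lpf (p * x) dvd p"
    then show ?thesis using primes_dvd_imp_eq[OF lpf_props(1)[OF px] assms(2)] by simp
  next
    assume "lpf (p * x) dvd x"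
    then have "lpf x \<le> lpf (p * x)" by (rule lpf_props(3)[OF assms(1) lpf_props(1)[OF px]])
    then show ?thesis using assms(3) by linarith
  qed
qed

lemma lpf_div_props:
  assumes "m \<ge> 2" "m div lpf m \<ge> 2"
  shows "lpf m * (m div lpf m) = m" "lpf m \<le> lpf (m div lpf m)"
proof -
  show e: "lpf m * (m div lpf m) = m" using lpf_props(2)[OF assms(1)] by simp
  have "lpf (m div lpf m) dvd m" using dvd_mult[OF lpf_props(2)[OF assms(2)], of "lpf m"] unfolding e .
  then show "lpf m \<le> lpf (m div lpf m)" by (rule lpf_props(3)[OF assms(1) lpf_props(1)[OF assms(2)]])
qed

definition composites :: "nat \<Rightarrow> nat set" where
  "composites n = {m \<in> {2..n}. \<not> prime m}"

lemma finite_composites [simp]: "finite (composites n)"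
  by (simp add: composites_def)

lemma lpf_le: "x \<ge> 2 \<Longrightarrow> lpf x \<le> x"
  using lpf_props(2)[of x] by (intro dvd_imp_le) auto

lemma composite_decomp:
  assumes "m \<ge> 2" "\<not> prime m"
  shows "m div lpf m \<ge> 2" "lpf m * (m div lpf m) = m" "lpf m \<le> lpf (m div lpf m)"
proof -
  have e: "lpf m * (m div lpf m) = m" using lpf_props(2)[OF assms(1)] by simp
  have "m div lpf m \<noteq> 0" using e assms(1) by (intro notI) simp
  moreover have "m div lpf m \<noteq> 1"
  proof
    assume "m div lpf m = 1"
    then have "lpf m = m" using e by simp
    then show False using lpf_props(1)[OF assms(1)] assms(2) by simp
  qed
  ultimately show ge: "m div lpf m \<ge> 2" by linarith
  show "lpf m * (m div lpf m) = m" "lpf m \<le> lpf (m div lpf m)"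
    by (rule lpf_div_props[OF assms(1) ge])+
qed

text \<open>The condition \<open>p \<le> lpf x\<close> makes \<open>p\<close> the least prime factor
  of \<open>p * x\<close>, so the product determines the pair.\<close>

lemma inj_on_mult_lpf: "inj_on (\<lambda>(p, x). p * x) {(p, x). x \<ge> 2 \<and> prime p \<and> p \<le> lpf x}"
proof (rule inj_onI, clarify)
  fix p x q y
  assume a: "2 \<le> x" "prime p" "p \<le> lpf x" "2 \<le> y" "prime q" "q \<le> lpf y" "p * x = q * y"
  then have "p = q" using lpf_mult[of x p] lpf_mult[of y q] by simp
  then show "p = q \<and> x = y" using a prime_gt_0_nat[of q] by simp
qed

text \<open>The largest proper divisor of \<open>m\<close> is \<open>m div lpf m\<close>. Hence
  \<open>m > n\<close> has no proper divisor above \<open>n\<close> exactly when this cofactor is at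
  most \<open>n\<close>.\<close>

lemma prod_pairs_min_weights:
  assumes "n \<ge> 1"
  shows "(\<lambda>(p, x). p * x) ` {(p, x). x \<in> {2..n} \<and> prime p \<and> p \<le> lpf x \<and> p * x > n} = min_weights n"
proof (intro equalityI subsetI)
  fix m assume "m \<in> (\<lambda>(p, x). p * x) ` {(p, x). x \<in> {2..n} \<and> prime p \<and> p \<le> lpf x \<and> p * x > n}"
  then obtain p x where m: "m = p * x" and x: "2 \<le> x" "x \<le> n" and p: "prime p" "p \<le> lpf x" "p * x > n" by auto
  have p0: "p > 0" using p prime_gt_0_nat by blast
  have m2: "m \<ge> 2" using m x p0 mult_le_mono[of 1 p 2 x] by simp
  have lm: "lpf m = p" unfolding m by (rule lpf_mult[OF x(1) p(1,2)])
  have "q \<le> n" if q: "prime q" "q dvd m" for q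
  proof -
    have "q dvd p \<or> q dvd x" using q unfolding m by (simp add: prime_dvd_mult_iff)
    then show ?thesis
    proof
      assume "q dvd p"
      then have "q \<le> p" using p0 by (rule dvd_imp_le)
      then show ?thesis using p(2) lpf_le[OF x(1)] x(2) by linarith
    next
      assume "q dvd x"
      then have "q \<le> x" using x by (intro dvd_imp_le) auto
      then show ?thesis using x(2) by linarith
    qed
  qed
  moreover have "d = m" if d: "d dvd m" "d > n" for d
  proof (rule ccontr)
    assume ne: "d \<noteq> m"
    obtain e where e: "m = d * e" using d(1) by (rule dvdE)
    have "e \<noteq> 0" using e m2 by (intro notI) simp
    have "e \<noteq> 1" using ne e by auto
    then obtain q where q: "prime q" "q dvd e" using prime_factor_nat by blast
    have "q dvd m" using q(2) e by simp
    then have "p \<le> q" using lpf_props(3)[OF m2 q(1)] lm by simp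
    moreover have "q \<le> e" using q(2) \<open>e \<noteq> 0\<close> by (intro dvd_imp_le) auto
    ultimately have "d * p \<le> d * e" by (intro mult_le_mono) auto
    then have "p * d \<le> p * x" using e m by (simp add: mult.commute)
    then have "d \<le> x" using p0 by simp
    then show False using d(2) x(2) by linarith
  qed
  ultimately show "m \<in> min_weights n" using p(3) m unfolding min_weights_def by blast
next
  fix m assume m: "m \<in> min_weights n"
  then have mn: "m > n" and sm: "\<And>p. prime p \<Longrightarrow> p dvd m \<Longrightarrow> p \<le> n"
    and least: "\<And>d. d dvd m \<Longrightarrow> d > n \<Longrightarrow> d = m" unfolding min_weights_def by blast+
  have True: "m \<ge> 2" using mn assms by linarith
  \<comment> \<open>A prime \<open>m > n\<close> would violate the restriction on prime
    factors.\<close>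
  have np: "\<not> prime m" using sm[of m] mn by auto
  note d = composite_decomp[OF True np]
  have dv: "m div lpf m dvd m" using dvd_triv_right[of "m div lpf m" "lpf m"] unfolding d(2) .
  have "m div lpf m \<le> n"
  proof (rule ccontr)
    assume "\<not> m div lpf m \<le> n"
    then have "m div lpf m = m" using least[OF dv] by simp
    then have "lpf m * m = 1 * m" using d(2) by simp
    then show False using True lpf_props(1)[OF True] by simp
  qed
  then show "m \<in> (\<lambda>(p, x). p * x) ` {(p, x). x \<in> {2..n} \<and> prime p \<and> p \<le> lpf x \<and> p * x > n}"
    using d mn lpf_props(1)[OF True] by (intro image_eqI[of _ _ "(lpf m, m div lpf m)"]) auto
qed

lemma prod_pairs_composites:
  "(\<lambda>(p, x). p * x) ` {(p, x). x \<in> {2..n} \<and> prime p \<and> p \<le> lpf x \<and> p * x \<le> n} = composites n"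
proof (intro equalityI subsetI)
  fix m assume "m \<in> (\<lambda>(p, x). p * x) ` {(p, x). x \<in> {2..n} \<and> prime p \<and> p \<le> lpf x \<and> p * x \<le> n}"
  then obtain p x where m: "m = p * x" and x: "2 \<le> x" "x \<le> n" and p: "prime p" "p * x \<le> n" by auto
  have "\<not> prime m" unfolding m using prime_product[of p x] x prime_gt_1_nat[OF p(1)] by auto
  moreover have "m \<ge> 2" using m x prime_gt_0_nat[OF p(1)] mult_le_mono[of 1 p 2 x] by simp
  ultimately show "m \<in> composites n" using p m by (simp add: composites_def)
next
  fix m assume m: "m \<in> composites n"
  then have m': "m \<ge> 2" "\<not> prime m" "m \<le> n" by (auto simp: composites_def)
  note d = composite_decomp[OF m'(1,2)]
  have "m div lpf m \<le> n" using m'(3) div_le_dividend[of m "lpf m"] by linarith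
  then show "m \<in> (\<lambda>(p, x). p * x) ` {(p, x). x \<in> {2..n} \<and> prime p \<and> p \<le> lpf x \<and> p * x \<le> n}"
    using d m' lpf_props(1)[OF m'(1)] by (intro image_eqI[of _ _ "(lpf m, m div lpf m)"]) auto
qed

lemma prime_pi_Suc: "prime_pi (real (Suc n)) = (if prime (Suc n) then Suc (prime_pi (real n)) else prime_pi (real n))"
proof -
  have e: "{p. prime p \<and> real p \<le> real (Suc n)} = {p. prime p \<and> real p \<le> real n} \<union> (if prime (Suc n) then {Suc n} else {})"
    by (auto simp: le_Suc_eq simp del: of_nat_Suc)
  show ?thesis unfolding prime_pi_def e using prime_pi_finite[of "real n"] by auto
qed

lemma prime_pi_less_2: "x < 2 \<Longrightarrow> prime_pi x = 0"
proof -
  assume x: "x < 2"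
  have e: "{p::nat. prime p \<and> real p \<le> x} = {}" using x by (auto dest!: prime_ge_2_nat)
  show ?thesis unfolding prime_pi_def e by simp
qed

text \<open>On the primes \<open>prime_pi\<close> is the numbering, so \<open>prime_pi p\<close>
  takes each value from \<open>1\<close> to \<open>prime_pi n\<close> once.\<close>

lemma sum_over_primes:
  fixes f :: "nat \<Rightarrow> 'a :: comm_monoid_add"
  shows "(\<Sum>p | prime p \<and> p \<le> n. f (prime_pi (real p))) = (\<Sum>k=1..prime_pi (real n). f k)"
proof (induction n)
  case 0
  have e: "{p::nat. prime p \<and> p \<le> 0} = {}" by auto
  show ?case unfolding e by (simp add: prime_pi_less_2)
next
  case (Suc n)
  have fin: "finite {p::nat. prime p \<and> p \<le> n}" by (rule finite_subset[of _ "{..n}"]) auto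
  show ?case
  proof (cases "prime (Suc n)")
    case True
    have e: "{p. prime p \<and> p \<le> Suc n} = insert (Suc n) {p. prime p \<and> p \<le> n}" using True by (auto simp: le_Suc_eq)
    have "(\<Sum>p | prime p \<and> p \<le> Suc n. f (prime_pi (real p))) = f (prime_pi (real (Suc n))) + (\<Sum>p | prime p \<and> p \<le> n. f (prime_pi (real p)))"
      unfolding e by (rule sum.insert[OF fin]) simp
    then show ?thesis unfolding Suc.IH prime_pi_Suc using True by (simp add: add.commute)
  next
    case False
    have "{p. prime p \<and> p \<le> Suc n} = {p. prime p \<and> p \<le> n}" using False by (auto simp: le_Suc_eq)
    then show ?thesis using Suc.IH False unfolding prime_pi_Suc by simp
  qed
qed

lemma prime_pi_nat: "prime_pi (real n) = card {p. prime p \<and> p \<le> n}"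
  unfolding prime_pi_def by simp

lemma lpf_prime: "prime p \<Longrightarrow> lpf p = p"
  unfolding lpf_def by (simp add: prime_factorization_prime)

text \<open>
  Count the pairs \<open>(p, x)\<close> with \<open>2 \<le> x \<le> n\<close> and \<open>p \<le> lpf x\<close>: those with \<open>p x > n\<close> correspond to the minimal
  generators and those with \<open>p x \<le> n\<close> to the composite numbers up to \<open>n\<close>.
\<close>

lemma S_fun_eq:
  assumes "n \<ge> 1"
  shows "S_fun K n = (\<Sum>m\<in>composites n. int (prime_pi (real (lpf m))) - 1)"
proof -
  let ?Q = "{(p, x). x \<in> {2..n} \<and> prime p \<and> p \<le> lpf x \<and> p * x > n}"
  let ?R = "{(p, x). x \<in> {2..n} \<and> prime p \<and> p \<le> lpf x \<and> p * x \<le> n}"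
  let ?S = "SIGMA x:{2..n}. {p. prime p \<and> p \<le> lpf x}"
  have finp: "finite {p::nat. prime p \<and> p \<le> k}" for k by (rule finite_subset[of _ "{..k}"]) auto
  have finS: "finite ?S" using finp by (intro finite_SigmaI) auto
  have sw: "?Q \<union> ?R = prod.swap ` ?S" by (auto simp: image_iff)
  have "finite (?Q \<union> ?R)" unfolding sw by (rule finite_imageI[OF finS])
  then have fin: "finite ?Q" "finite ?R" by (simp_all only: finite_Un)
  have cQ: "card (min_weights n) = card ?Q"
    unfolding prod_pairs_min_weights[OF assms, symmetric]
    by (rule card_image, rule inj_on_subset[OF inj_on_mult_lpf]) auto
  have cR: "card (composites n) = card ?R"
    unfolding prod_pairs_composites[symmetric]
    by (rule card_image, rule inj_on_subset[OF inj_on_mult_lpf]) auto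
  have "card ?Q + card ?R = card (?Q \<union> ?R)" using fin by (intro card_Un_disjoint[symmetric]) auto
  also have "\<dots> = card ?S" unfolding sw by (rule card_image) simp
  also have "\<dots> = (\<Sum>x\<in>{2..n}. prime_pi (real (lpf x)))" using finp by (simp add: prime_pi_nat)
  also have "\<dots> = (\<Sum>x\<in>{p. prime p \<and> p \<le> n} \<union> composites n. prime_pi (real (lpf x)))"
    by (rule sum.cong) (auto simp: composites_def prime_ge_2_nat)
  \<comment> \<open>The prime \<open>x\<close> contribute \<open>1 + 2 + ... + prime_pi n\<close>,
    which is the binomial coefficient subtracted in \<open>S_fun\<close>; the term
    \<open>- 1\<close> for each composite will come from \<open>card (composites n)\<close>.\<close>
  also have "\<dots> = (\<Sum>p | prime p \<and> p \<le> n. prime_pi (real (lpf p))) + (\<Sum>m\<in>composites n. prime_pi (real (lpf m)))"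
    by (rule sum.union_disjoint[OF finp finite_composites]) (auto simp: composites_def)
  also have "(\<Sum>p | prime p \<and> p \<le> n. prime_pi (real (lpf p))) = (\<Sum>p | prime p \<and> p \<le> n. prime_pi (real p))"
    by (rule sum.cong) (simp_all add: lpf_prime)
  also have "\<dots> = (\<Sum>k=1..prime_pi (real n). k)" using sum_over_primes[of "\<lambda>k. k" n] .
  also have "\<dots> = (prime_pi (real n) + 1) choose 2"
    by (simp only: Sum_Icc_nat) (simp add: choose_two mult.commute)
  finally have "int (card (min_weights n)) + int (card (composites n)) =
      int ((prime_pi (real n) + 1) choose 2) + (\<Sum>m\<in>composites n. int (prime_pi (real (lpf m))))"
    unfolding cQ cR by (simp only: of_nat_add[symmetric] of_nat_sum[symmetric])
  then show ?thesis unfolding S_fun_def num_gens_eq_card by (simp add: sum_subtractf)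
qed

section \<open>Numbers with exactly two prime factors\<close>

lemma big_Omega_mult_prime:
  assumes "prime p" "m > 0"
  shows "big_Omega (p * m) = Suc (big_Omega m)"
proof -
  have "prime_factorization (p * m) = prime_factorization p + prime_factorization m"
    using assms by (intro prime_factorization_mult) auto
  then show ?thesis using assms by (simp add: big_Omega_def prime_factorization_prime)
qed

lemma big_Omega_prime: "prime p \<Longrightarrow> big_Omega p = 1"
  by (simp add: big_Omega_def prime_factorization_prime)

lemma big_Omega_eq_1D:
  assumes "big_Omega m = 1"
  shows "prime m"
proof -
  have "size (prime_factorization m) = 1" using assms unfolding big_Omega_def .
  then obtain a where a: "prime_factorization m = {#a#}" using size_1_singleton_mset by blast
  then have "a \<in> prime_factors m" by simp
  then have "prime a" "m \<noteq> 0" by (auto simp: in_prime_factors_iff)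
  moreover have "m = prod_mset (prime_factorization m)" using \<open>m \<noteq> 0\<close> by (simp add: prod_mset_prime_factorization_nat)
  ultimately show ?thesis using a by simp
qed

lemma big_Omega_2_image:
  "{x \<in> {1..n}. big_Omega x = 2} = (\<lambda>(p, q). p * q) ` {(p, q). prime p \<and> prime q \<and> p \<le> q \<and> p * q \<le> n}"
proof (intro equalityI subsetI)
  fix x assume x: "x \<in> {x \<in> {1..n}. big_Omega x = 2}"
  have np: "\<not> prime x" using x big_Omega_prime[of x] by auto
  have "x \<noteq> 1" using x by (auto simp: big_Omega_def)
  then have x2: "x \<ge> 2" using x by auto
  note d = composite_decomp[OF x2 np]
  have "big_Omega (lpf x * (x div lpf x)) = Suc (big_Omega (x div lpf x))"
    by (rule big_Omega_mult_prime[OF lpf_props(1)[OF x2]]) (use d in linarith)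
  then have "big_Omega (x div lpf x) = 1" unfolding d(2) using x by simp
  then have q: "prime (x div lpf x)" by (rule big_Omega_eq_1D)
  have "lpf x \<le> x div lpf x" using d(3) lpf_prime[OF q] by simp
  then show "x \<in> (\<lambda>(p, q). p * q) ` {(p, q). prime p \<and> prime q \<and> p \<le> q \<and> p * q \<le> n}"
    using d(2) q x lpf_props(1)[OF x2] by (intro image_eqI[of _ _ "(lpf x, x div lpf x)"]) auto
next
  fix x assume "x \<in> (\<lambda>(p, q). p * q) ` {(p, q). prime p \<and> prime q \<and> p \<le> q \<and> p * q \<le> n}"
  then obtain p q where pq: "x = p * q" "prime p" "prime q" "p * q \<le> n" by auto
  then have "big_Omega x = 2" using big_Omega_mult_prime[of p q] big_Omega_prime[of q] prime_gt_0_nat[of q] by simp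
  then show "x \<in> {x \<in> {1..n}. big_Omega x = 2}"
    using pq prime_gt_0_nat[of p] prime_gt_0_nat[of q] by (simp add: Suc_le_eq)
qed

lemma prime_pi_real_div: "prime p \<Longrightarrow> {q::nat. prime q \<and> p * q \<le> n} = {q. prime q \<and> real q \<le> real n / real p}"
proof -
  assume p: "prime p"
  have "p * q \<le> n \<longleftrightarrow> real q \<le> real n / real p" for q
  proof -
    have "p * q \<le> n \<longleftrightarrow> real (p * q) \<le> real n" by (simp only: of_nat_le_iff)
    also have "\<dots> \<longleftrightarrow> real q \<le> real n / real p" using prime_gt_0_nat[OF p] by (simp add: le_divide_eq mult.commute)
    finally show ?thesis .
  qed
  then show ?thesis by simp
qed

text \<open>For \<open>x = p * q\<close> with \<open>p \<le> q\<close> the summand depends on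
  \<open>p\<close> only, and \<open>p \<le> sqrt n\<close>. The number of primes \<open>q\<close>
  from \<open>p\<close> to \<open>n / p\<close> is
  \<open>prime_pi (n / p) - (prime_pi p - 1)\<close>, since \<open>q = p\<close> is allowed.\<close>

lemma S2_fun_eq:
  "real_of_int (S2_fun n) = (\<Sum>p | prime p \<and> real p \<le> sqrt (real n).
    (real (prime_pi (real p)) - 1) * (real (prime_pi (real n / real p)) - real (prime_pi (real p)) + 1))"
proof -
  let ?T = "{(p, q). prime p \<and> prime q \<and> p \<le> q \<and> p * q \<le> n}"
  let ?U = "SIGMA p:{p. prime p \<and> real p \<le> sqrt (real n)}. {q. prime q \<and> p \<le> q \<and> p * q \<le> n}"
  have sq: "real p \<le> sqrt (real n)" if a: "p \<le> q" "p * q \<le> n" for p q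
  proof -
    have "p * p \<le> p * q" using a(1) by (intro mult_le_mono) auto
    then have "real (p * p) \<le> real n" using a(2) unfolding of_nat_le_iff by linarith
    then show ?thesis by (intro real_le_rsqrt) (simp add: power2_eq_square)
  qed
  have TU: "?T = ?U" using sq by blast
  have inj: "inj_on (\<lambda>(p, q). p * q) ?T"
    by (rule inj_on_subset[OF inj_on_mult_lpf]) (auto simp: lpf_prime prime_ge_2_nat)
  have lp: "lpf (p * q) = p" if "prime p" "prime q" "p \<le> q" for p q
    by (rule lpf_mult) (use that in \<open>simp_all add: lpf_prime prime_ge_2_nat\<close>)
  have "S2_fun n = (\<Sum>(p, q)\<in>?T. int (prime_pi (real p)) - 1)"
    unfolding S2_fun_def big_Omega_2_image
    by (subst sum.reindex[OF inj]) (intro sum.cong refl, clarsimp simp: lp)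
  also have "\<dots> = (\<Sum>p | prime p \<and> real p \<le> sqrt (real n). \<Sum>q | prime q \<and> p \<le> q \<and> p * q \<le> n. int (prime_pi (real p)) - 1)"
    unfolding TU
  proof (rule sum.Sigma[symmetric, OF prime_pi_finite ballI])
    fix p assume "p \<in> {p. prime p \<and> real p \<le> sqrt (real n)}"
    then have "finite {q. prime q \<and> p * q \<le> n}" using prime_pi_finite[of "real n / real p"] prime_pi_real_div[of p n] by simp
    then show "finite {q. prime q \<and> p \<le> q \<and> p * q \<le> n}" by (rule rev_finite_subset) auto
  qed
  finally have e: "S2_fun n = (\<Sum>p | prime p \<and> real p \<le> sqrt (real n). \<Sum>q | prime q \<and> p \<le> q \<and> p * q \<le> n. int (prime_pi (real p)) - 1)" .
  have inner: "real_of_int (\<Sum>q | prime q \<and> p \<le> q \<and> p * q \<le> n. int (prime_pi (real p)) - 1) =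
      (real (prime_pi (real p)) - 1) * (real (prime_pi (real n / real p)) - real (prime_pi (real p)) + 1)"
    if p: "prime p" "real p \<le> sqrt (real n)" for p
  proof -
    let ?A = "{q. prime q \<and> p * q \<le> n}" and ?B = "{q. prime q \<and> q < p}"
    have fA: "finite ?A" unfolding prime_pi_real_div[OF p(1)] by (rule prime_pi_finite)
    have "(real p)\<^sup>2 \<le> (sqrt (real n))\<^sup>2" using p(2) by (intro power_mono) auto
    then have "real (p * p) \<le> real n" by (simp add: power2_eq_square)
    then have pp: "p * p \<le> n" by (simp only: of_nat_le_iff)
    have sub: "?B \<subseteq> ?A"
    proof
      fix q assume q: "q \<in> ?B"
      then have le: "p * q \<le> p * p" by (intro mult_le_mono) auto
      show "q \<in> ?A" using order.trans[OF le pp] q by blast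
    qed
    have "{q. prime q \<and> p \<le> q \<and> p * q \<le> n} = ?A - ?B" by auto
    then have "card {q. prime q \<and> p \<le> q \<and> p * q \<le> n} = card ?A - card ?B"
      using card_Diff_subset[OF finite_subset[OF sub fA] sub] by simp
    moreover have cB: "card ?B = prime_pi (real p) - 1"
    proof -
      have "{q. prime q \<and> q \<le> p} = insert p ?B" using p(1) by auto
      then have "prime_pi (real p) = card (insert p ?B)" unfolding prime_pi_nat by simp
      also have "\<dots> = Suc (card ?B)" using finite_subset[OF sub fA] by simp
      finally show ?thesis by simp
    qed
    moreover have "card ?A = prime_pi (real n / real p)"
      unfolding prime_pi_real_div[OF p(1)] prime_pi_def ..
    moreover have "card ?B \<le> card ?A" by (rule card_mono[OF fA sub])
    moreover have "prime_pi (real p) \<ge> 1"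
    proof -
      have "p \<in> {q. prime q \<and> q \<le> p}" using p(1) by simp
      moreover have "finite {q::nat. prime q \<and> q \<le> p}" by (rule finite_subset[of _ "{..p}"]) auto
      ultimately have "card {q. prime q \<and> q \<le> p} > 0" using card_gt_0_iff by blast
      then show ?thesis unfolding prime_pi_nat by linarith
    qed
    ultimately have "real (card {q. prime q \<and> p \<le> q \<and> p * q \<le> n}) = real (prime_pi (real n / real p)) - real (prime_pi (real p)) + 1"
      by (simp add: of_nat_diff)
    then show ?thesis by (simp add: mult.commute)
  qed
  show ?thesis unfolding e of_int_sum[of _ "{p. prime p \<and> real p \<le> sqrt (real n)}"]
    by (rule sum.cong[OF refl]) (use inner in auto)
qed

text \<open>A composite \<open>m \<le> n\<close> with more than two prime factors satisfies
  \<open>lpf m ^ 3 \<le> m\<close>, so its summand is at most \<open>n powr (1 / 3)\<close>, and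
  there are at most \<open>n\<close> of them.\<close>

lemma S_fun_S2_fun_diff:
  assumes "n \<ge> 1"
  shows "\<bar>real_of_int (S_fun K n) - real_of_int (S2_fun n)\<bar> \<le> real n * real n powr (1 / 3)"
proof -
  let ?f = "\<lambda>m. int (prime_pi (real (lpf m))) - 1"
  let ?A = "{x \<in> {1..n}. big_Omega x = 2}"
  have sub: "?A \<subseteq> composites n"
  proof
    fix x assume x: "x \<in> ?A"
    then have "x \<noteq> 1" "\<not> prime x" using big_Omega_prime[of x] by (auto simp: big_Omega_def)
    then show "x \<in> composites n" using x by (auto simp: composites_def)
  qed
  have "S_fun K n - S2_fun n = (\<Sum>m\<in>composites n - ?A. ?f m)"
    unfolding S_fun_eq[OF assms] S2_fun_def using sum_diff[OF finite_composites sub, of ?f] by simp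
  then have e: "real_of_int (S_fun K n) - real_of_int (S2_fun n) = (\<Sum>m\<in>composites n - ?A. real_of_int (?f m))"
    by (simp only: of_int_diff[symmetric] of_int_sum[symmetric])
  have bd: "\<bar>real_of_int (?f m)\<bar> \<le> real n powr (1 / 3)" if m: "m \<in> composites n - ?A" for m
  proof -
    have m2: "m \<ge> 2" "\<not> prime m" "m \<le> n" "big_Omega m \<noteq> 2" using m by (auto simp: composites_def)
    define x where "x = m div lpf m"
    note d = composite_decomp[OF m2(1,2), folded x_def]
    have np: "\<not> prime x"
    proof
      assume "prime x"
      then have "big_Omega (lpf m * x) = 2"
        using big_Omega_mult_prime[OF lpf_props(1)[OF m2(1)], of x] big_Omega_prime[of x] d(1) by simp
      then show False using d(2) m2(4) by simp
    qed
    note d' = composite_decomp[OF d(1) np]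
    have "lpf x \<le> x div lpf x" using d'(3) lpf_le[OF d'(1)] by linarith
    then have "lpf m \<le> x div lpf x" using d(3) by linarith
    then have "lpf m * (lpf m * lpf m) \<le> lpf m * (lpf x * (x div lpf x))"
      using d(3) by (intro mult_le_mono order_refl)
    then have "lpf m ^ 3 \<le> n" using d'(2) d(2) m2(3) by (simp add: power3_eq_cube mult.assoc)
    then have "real (lpf m ^ 3) \<le> real n" by (simp only: of_nat_le_iff)
    then have "(real (lpf m) ^ 3) powr (1 / 3) \<le> real n powr (1 / 3)" by (intro powr_mono2) auto
    moreover have "(real (lpf m) ^ 3) powr (1 / 3) = real (lpf m)"
    proof -
      have pos: "real (lpf m) > 0" using prime_gt_0_nat[OF lpf_props(1)[OF m2(1)]] by simp
      then have "(real (lpf m) ^ 3) powr (1 / 3) = (real (lpf m) powr 3) powr (1 / 3)" by simp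
      also have "\<dots> = real (lpf m)" unfolding powr_powr using pos by simp
      finally show ?thesis .
    qed
    ultimately have b: "real (lpf m) \<le> real n powr (1 / 3)" by simp
    have p1: "real (prime_pi (real (lpf m))) \<le> real (lpf m)" by (rule prime_pi_le) simp
    have p2: "real (lpf m) \<ge> 1" using prime_gt_0_nat[OF lpf_props(1)[OF m2(1)]] by simp
    have "\<bar>real_of_int (int k - 1)\<bar> \<le> l" if "real k \<le> l" "l \<ge> 1" for k :: nat and l :: real
      using that by (simp add: abs_le_iff)
    from this[OF p1 p2] b show ?thesis by (rule order.trans)
  qed
  have "\<bar>\<Sum>m\<in>composites n - ?A. real_of_int (?f m)\<bar> \<le> (\<Sum>m\<in>composites n - ?A. real n powr (1 / 3))"
    by (rule order.trans[OF sum_abs sum_mono[OF bd]])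
  also have "\<dots> = real (card (composites n - ?A)) * real n powr (1 / 3)" by simp
  also have "\<dots> \<le> real n * real n powr (1 / 3)"
  proof (intro mult_right_mono)
    have "card (composites n - ?A) \<le> card {1..n}" by (rule card_mono) (auto simp: composites_def)
    then show "real (card (composites n - ?A)) \<le> real n" by simp
  qed simp
  finally show ?thesis unfolding e .
qed

subsection \<open>The contribution of the products of two primes\<close>

lemma primes_floor:
  assumes "x \<ge> 0"
  shows "{p::nat. prime p \<and> real p \<le> x} = {p. prime p \<and> p \<le> nat \<lfloor>x\<rfloor>}"
proof -
  have "real p \<le> x \<longleftrightarrow> p \<le> nat \<lfloor>x\<rfloor>" for p
  proof
    assume "p \<le> nat \<lfloor>x\<rfloor>"
    then have "real p \<le> real (nat \<lfloor>x\<rfloor>)" by simp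
    also have "\<dots> \<le> x" using assms by (simp add: of_nat_nat)
    finally show "real p \<le> x" .
  qed (simp add: le_nat_floor)
  then show ?thesis by simp
qed

lemma sum_over_primes_real:
  fixes f :: "nat \<Rightarrow> 'a :: comm_monoid_add"
  assumes "x \<ge> 0"
  shows "(\<Sum>p | prime p \<and> real p \<le> x. f (prime_pi (real p))) = (\<Sum>k=1..prime_pi x. f k)"
proof -
  have "prime_pi x = prime_pi (real (nat \<lfloor>x\<rfloor>))"
    unfolding prime_pi_nat unfolding prime_pi_def primes_floor[OF assms] ..
  then show ?thesis unfolding primes_floor[OF assms] by (simp only: sum_over_primes)
qed

lemma sum_squares_real: "(\<Sum>k=1..m. real k ^ 2) = real m * (real m + 1) * (2 * real m + 1) / 6"
  by (induction m) (simp_all add: field_simps power2_eq_square)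

lemma sum_linear_real: "(\<Sum>k=1..m. real k) = real m * (real m + 1) / 2"
  by (induction m) (simp_all add: field_simps)

text \<open>In the application \<open>x = p\<close>, \<open>a = \<pi>(p)\<close>,
  \<open>b = \<pi>(n / p)\<close>, \<open>M = \<pi>(N)\<close>, and \<open>lx\<close>,
  \<open>lz\<close>, \<open>L\<close> are the logarithms of \<open>p\<close>, \<open>n / p\<close>,
  \<open>N\<close>. The normalized quantities satisfy
  \<open>u * v / w^2 = (a * b / M^2) * (lx * lz / L^2)\<close> with \<open>u\<close>,
  \<open>v\<close>, \<open>w\<close> and the last quotient close to \<open>1\<close>;
  \<open>up\<close> and \<open>lo\<close> linearize the resulting rational functions of
  \<open>e\<close>.\<close>

lemma prime_pair_product_estimate:
  fixes C D e L N x :: real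
  assumes C: "C > 0" and e: "0 < e" "e < 1" "C * e \<le> 1 / 8" and L: "L > 0" "N > 0"
    and a: "\<bar>a * lx / x - 1\<bar> \<le> 2 * (C * e)" and b: "\<bar>b * lz / (N\<^sup>2 / x) - 1\<bar> \<le> C * e"
    and M: "\<bar>M * L / N - 1\<bar> \<le> C * e"
    and x: "x > 0" and Pd: "L\<^sup>2 * (1 - e) \<le> lx * lz" "lx * lz \<le> L\<^sup>2" and ab0: "a \<ge> 0" "b \<ge> 0" "M \<ge> 0"
    and up: "(1 + 2 * (C * e)) * (1 + C * e) / ((1 - e) * (1 - C * e)\<^sup>2) \<le> 1 + D * e"
    and lo: "1 - D * e \<le> (1 - 2 * (C * e)) * (1 - C * e) / (1 + C * e)\<^sup>2"
  shows "a * b \<le> M\<^sup>2 * (1 + D * e)" "M\<^sup>2 * (1 - D * e) \<le> a * b"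
proof -
  define c where "c = C * e"
  have c: "0 < c" "c \<le> 1 / 8" using C e by (simp_all add: c_def)
  define u where "u = a * lx / x"
  define v where "v = b * lz / (N\<^sup>2 / x)"
  define w where "w = M * L / N"
  have uvw: "1 - 2 * c \<le> u" "u \<le> 1 + 2 * c" "1 - c \<le> v" "v \<le> 1 + c" "1 - c \<le> w" "w \<le> 1 + c"
    using a b M unfolding u_def v_def w_def c_def by (simp_all add: abs_le_iff)
  have N2: "N\<^sup>2 > 0" using L by simp
  have uv: "u * v = a * b * (lx * lz) / N\<^sup>2" unfolding u_def v_def using x N2 by simp
  have w2: "w\<^sup>2 = M\<^sup>2 * L\<^sup>2 / N\<^sup>2" unfolding w_def by (simp add: power_divide power_mult_distrib)
  have L2: "L\<^sup>2 > 0" using L by simp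
  have lb: "(1 - 2 * c) * (1 - c) \<le> u * v" using uvw c by (intro mult_mono) auto
  have ub: "u * v \<le> (1 + 2 * c) * (1 + c)" using uvw c by (intro mult_mono) auto
  have wl: "(1 - c)\<^sup>2 \<le> w\<^sup>2" using uvw c by (intro power_mono) auto
  have wu: "w\<^sup>2 \<le> (1 + c)\<^sup>2" using uvw c by (intro power_mono) auto
  have ab: "a * b \<ge> 0" using ab0 by simp
  have 1: "a * b * L\<^sup>2 * (1 - e) / N\<^sup>2 \<le> u * v"
  proof -
    have "a * b * (L\<^sup>2 * (1 - e)) \<le> a * b * (lx * lz)" using ab Pd(1) by (intro mult_left_mono)
    then have "a * b * (L\<^sup>2 * (1 - e)) / N\<^sup>2 \<le> a * b * (lx * lz) / N\<^sup>2" using N2 by (intro divide_right_mono) auto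
    then show ?thesis unfolding uv by (simp only: mult.assoc)
  qed
  have 2: "u * v \<le> a * b * L\<^sup>2 / N\<^sup>2"
    unfolding uv using ab Pd(2) N2 by (intro divide_right_mono mult_left_mono) auto
  define Q where "Q = L\<^sup>2 / N\<^sup>2"
  have Q: "Q > 0" unfolding Q_def using L2 N2 by simp
  have w2Q: "w\<^sup>2 = M\<^sup>2 * Q" unfolding w2 Q_def by simp
  have f1: "a * b * Q * (1 - e) \<le> (1 + 2 * c) * (1 + c)" using 1 ub unfolding Q_def by simp
  have f2: "(1 - 2 * c) * (1 - c) \<le> a * b * Q" using 2 lb unfolding Q_def by simp
  have e1: "1 - e > 0" using e by simp
  have cc: "(1 - c)\<^sup>2 > 0" "(1 + c)\<^sup>2 > 0" using c by simp_all
  have "(1 + 2 * c) * (1 + c) \<le> (1 + D * e) * ((1 - e) * (1 - c)\<^sup>2)"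
    using up e1 cc unfolding c_def[symmetric] by (subst (asm) pos_divide_le_eq) auto
  also have "\<dots> = (1 + D * e) * (1 - e) * (1 - c)\<^sup>2" by simp
  also have "\<dots> \<le> (1 + D * e) * (1 - e) * (M\<^sup>2 * Q)"
  proof (intro mult_left_mono mult_nonneg_nonneg)
    have "0 \<le> (1 + 2 * c) * (1 + c) / ((1 - e) * (1 - c)\<^sup>2)" using c e1 cc by (intro divide_nonneg_nonneg mult_nonneg_nonneg) auto
    then show "0 \<le> 1 + D * e" using up unfolding c_def[symmetric] by linarith
  qed (use wl w2Q e1 in auto)
  finally have "a * b * Q * (1 - e) \<le> (1 + D * e) * (1 - e) * (M\<^sup>2 * Q)" using f1 by linarith
  then have "a * b * (Q * (1 - e)) \<le> (M\<^sup>2 * (1 + D * e)) * (Q * (1 - e))" by (simp add: mult_ac)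
  then show "a * b \<le> M\<^sup>2 * (1 + D * e)" using Q e1 by (simp add: mult_le_cancel_right)
  have "(1 - D * e) * (M\<^sup>2 * Q) \<le> a * b * Q"
  \<comment> \<open>For a negative factor the claim is trivial, as the right-hand side is
    nonnegative; otherwise the upper bound for \<open>w^2\<close> may be multiplied in.\<close>
  proof (cases "1 - D * e \<ge> 0")
    case True
    have "(1 - D * e) * (M\<^sup>2 * Q) \<le> (1 - D * e) * (1 + c)\<^sup>2"
      using True wu w2Q by (intro mult_left_mono) auto
    also have "\<dots> \<le> (1 - 2 * c) * (1 - c)"
      using lo cc unfolding c_def[symmetric] by (subst (asm) pos_le_divide_eq) auto
    finally show ?thesis using f2 by linarith
  next
    case False
    then have "(1 - D * e) * (M\<^sup>2 * Q) \<le> 0" using Q by (intro mult_nonpos_nonneg) auto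
    also have "0 \<le> a * b * Q" using ab Q by simp
    finally show ?thesis .
  qed
  then have "(M\<^sup>2 * (1 - D * e)) * Q \<le> (a * b) * Q" by (simp add: mult_ac)
  then show "M\<^sup>2 * (1 - D * e) \<le> a * b" using Q by (simp add: mult_le_cancel_right)
qed

text \<open>
  For \<open>p\<close> between \<open>y = N / L\<^sup>2\<close> and \<open>N = sqrt n\<close> one has \<open>ln p = L - \<delta>\<close> and \<open>ln (n / p) = L + \<delta>\<close> with
  \<open>0 \<le> \<delta> \<le> 2 ln L\<close>, so \<open>\<pi>(p) \<pi>(n / p)\<close> is close to \<open>M\<^sup>2\<close>; the primes below \<open>y\<close> are negligible. With \<open>k = \<pi>(p)\<close>
  the sum becomes the sum of \<open>M\<^sup>2 - k\<^sup>2\<close> over \<open>k \<le> M\<close>, which is about \<open>2/3 M\<^sup>3\<close>.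
\<close>

lemma S2_fun_estimate:
  fixes C D e L N M :: real and n :: nat
  defines "N \<equiv> sqrt (real n)" and "L \<equiv> ln N" and "e \<equiv> 1 / sqrt L" and "M \<equiv> real (prime_pi N)"
  assumes C: "C > 0" and D: "D > 0"
    and pnt: "\<And>x. x \<ge> N / L\<^sup>2 \<Longrightarrow> \<bar>real (prime_pi x) * ln x / x - 1\<bar> \<le> C / sqrt (ln x)"
    and N: "N \<ge> 4" and L: "L \<ge> 4" and y1: "N / L\<^sup>2 > 1" and lnL: "2 * ln L \<le> L / 2" and eta: "(2 * ln L / L)\<^sup>2 \<le> e"
    and Ce: "C * e \<le> 1 / 8"
    and up: "(1 + 2 * (C * e)) * (1 + C * e) / ((1 - e) * (1 - C * e)\<^sup>2) \<le> 1 + D * e"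
    and lo: "1 - D * e \<le> (1 - 2 * (C * e)) * (1 - C * e) / (1 + C * e)\<^sup>2"
    and big1: "2 * (N\<^sup>2 * sqrt N) \<le> e * (N / (2 * L)) ^ 3" and big2: "1 \<le> e * (N / (2 * L))"
    and small1: "8 / L\<^sup>2 \<le> e" and small2: "64 / L \<le> 64 * e"
  shows "\<bar>real_of_int (S2_fun n) - 2 / 3 * M ^ 3\<bar> \<le> (D + 70) * e * M ^ 3"
proof -
  define y where "y = N / L\<^sup>2"
  define P where "P = {p::nat. prime p \<and> real p \<le> N}"
  define a where "a = (\<lambda>p::nat. real (prime_pi (real p)))"
  define b where "b = (\<lambda>p::nat. real (prime_pi (real n / real p)))"
  have N0: "N > 0" using N by linarith
  have L0: "L > 0" using L by linarith
  have nN: "real n = N\<^sup>2" unfolding N_def by simp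
  have sL: "sqrt L \<ge> 2" using L real_sqrt_le_mono[of 4 L] by simp
  have e0: "e > 0" unfolding e_def using L0 by simp
  have e1: "e \<le> 1 / 2" unfolding e_def using sL L0 by (intro divide_left_mono mult_pos_pos) auto
  have finP: "finite P" unfolding P_def by (rule prime_pi_finite)
  have cardP: "real (card P) = M" unfolding P_def M_def prime_pi_def ..
  have M0: "M \<ge> 0" by (simp add: M_def)
  have yN: "y \<le> N"
  proof -
    have "1 \<le> L\<^sup>2" using L by (simp add: one_le_power)
    then have "N / L\<^sup>2 \<le> N / 1" using N0 by (intro divide_left_mono) auto
    then show ?thesis by (simp add: y_def)
  qed
  have y0: "y > 1" using y1 by (simp add: y_def)
  have ly: "ln y = L - 2 * ln L" unfolding y_def L_def[symmetric]
    using N0 L0 by (subst ln_div) (auto simp: ln_realpow L_def[symmetric])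
  have ly2: "ln y \<ge> L / 2" using ly lnL by linarith
  \<comment> \<open>Down to \<open>y\<close> the logarithm is still at least \<open>L / 4\<close>,
    so the relative error at most doubles.\<close>
  have err: "C / sqrt (ln x) \<le> 2 * (C * e)" if "x \<ge> y" for x
  proof -
    have "ln y \<le> ln x" using that y0 by simp
    then have "L / 4 \<le> ln x" using ly2 L0 by linarith
    then have "sqrt (L / 4) \<le> sqrt (ln x)" by (rule real_sqrt_le_mono)
    then have h: "sqrt L / 2 \<le> sqrt (ln x)" by (simp add: real_sqrt_divide)
    then have "C / sqrt (ln x) \<le> C / (sqrt L / 2)" using C sL by (intro divide_left_mono mult_pos_pos) linarith+
    then show ?thesis by (simp add: e_def mult.commute)
  qed
  have errN: "C / sqrt (ln x) \<le> C * e" if "x \<ge> N" for x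
  proof -
    have "L \<le> ln x" unfolding L_def using that N0 by simp
    then have h: "sqrt L \<le> sqrt (ln x)" by (rule real_sqrt_le_mono)
    then have "C / sqrt (ln x) \<le> C / sqrt L" using C sL by (intro divide_left_mono mult_pos_pos) linarith+
    then show ?thesis by (simp add: e_def)
  qed
  have pi_up: "real (prime_pi x) \<le> 2 * x / ln x" if "x \<ge> y" for x
  proof -
    have x0: "x > 1" using that y0 by linarith
    have "real (prime_pi x) * ln x / x - 1 \<le> 1"
      using pnt[of x] err[OF that] Ce that unfolding y_def by (simp add: abs_le_iff)
    then have "real (prime_pi x) * ln x / x \<le> 2" by simp
    then show ?thesis using x0 by (simp add: field_simps)
  qed
  have Mest: "\<bar>M * L / N - 1\<bar> \<le> C * e"
    unfolding M_def L_def using pnt[of N] errN[of N] yN unfolding y_def L_def[symmetric] by simp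
  have Mlow: "N / (2 * L) \<le> M"
  proof -
    have "1 / 2 \<le> M * L / N" using Mest Ce by (simp add: abs_le_iff)
    then show ?thesis using N0 L0 by (simp add: field_simps)
  qed
  have NL0: "N / (2 * L) > 0" using N0 L0 by simp
  have M3: "(N / (2 * L)) ^ 3 \<le> M ^ 3" using Mlow NL0 by (intro power_mono) auto
  have Meb: "1 \<le> e * M" using big2 Mlow e0 mult_left_mono[OF Mlow, of e] by linarith
  have M2: "M\<^sup>2 \<le> e * M ^ 3"
  proof -
    have "M\<^sup>2 * 1 \<le> M\<^sup>2 * (e * M)" using Meb by (intro mult_left_mono) auto
    then show ?thesis by (simp add: power2_eq_square power3_eq_cube mult_ac)
  qed
  have M1: "1 \<le> M"
  proof -
    have "e * M \<le> 1 * M" using e1 M0 by (intro mult_right_mono) auto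
    then show ?thesis using Meb by linarith
  qed
  have ndiv: "real n / real p \<ge> N" if "real p \<le> N" "p > 0" for p
  proof -
    have "N * real p \<le> N * N" using that N0 by (intro mult_left_mono) auto
    then show ?thesis using that unfolding nN power2_eq_square by (simp add: le_divide_eq)
  qed
  \<comment> \<open>small primes\<close>
  define P1 where "P1 = {p::nat. prime p \<and> real p \<le> y}"
  define P2 where "P2 = P - P1"
  have P1P: "P1 \<subseteq> P" unfolding P1_def P_def using yN by auto
  define K where "K = real (card P1)"
  have K: "K \<le> 4 * y / L"
  proof -
    have "K = real (prime_pi y)" unfolding K_def P1_def prime_pi_def ..
    also have "\<dots> \<le> 2 * y / ln y" by (rule pi_up) simp
    also have "\<dots> \<le> 2 * y / (L / 2)" using ly2 L0 y0 by (intro divide_left_mono mult_pos_pos) linarith+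
    finally show ?thesis by simp
  qed
  have KeM: "K \<le> e * M"
  proof -
    have "4 * y / L = 8 / L\<^sup>2 * (N / (2 * L))" unfolding y_def using L0 by (simp add: field_simps)
    also have "\<dots> \<le> e * M" using small1 Mlow e0 NL0 by (intro mult_mono) linarith+
    finally show ?thesis using K by linarith
  qed
  have bup: "b p \<le> 2 * (real n / real p) / L" if "p \<in> P" for p
  proof -
    have p: "p > 0" "real p \<le> N" using that prime_gt_0_nat by (auto simp: P_def)
    have z: "real n / real p \<ge> N" by (rule ndiv[OF p(2,1)])
    have "b p \<le> 2 * (real n / real p) / ln (real n / real p)"
      unfolding b_def by (rule pi_up) (use z yN in linarith)
    also have "\<dots> \<le> 2 * (real n / real p) / L"
      using z N0 L0 unfolding L_def by (intro divide_left_mono mult_pos_pos) auto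
    finally show ?thesis .
  qed
  have ale: "a p \<le> real p" for p unfolding a_def by (rule prime_pi_le) simp
  have ab0: "a p \<ge> 0" "b p \<ge> 0" for p by (simp_all add: a_def b_def)
  \<comment> \<open>The bound \<open>a p \<le> p\<close> cancels the \<open>p\<close> in
    \<open>n / p\<close>, so each product is at most \<open>2 * N^2 / L\<close>. With at most
    \<open>4 * y / L\<close> primes this gives \<open>8 * N^3 / L^4\<close>, smaller than
    \<open>M^3\<close> by a factor of order \<open>L\<close>.\<close>
  have s1: "(\<Sum>p\<in>P1. a p * b p) \<le> 64 * e * M ^ 3"
  proof -
    have "(\<Sum>p\<in>P1. a p * b p) \<le> (\<Sum>p\<in>P1. 2 * N\<^sup>2 / L)"
    proof (rule sum_mono)
      fix p assume p: "p \<in> P1"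
      then have pp: "p \<in> P" "p > 0" using P1P prime_gt_0_nat by (auto simp: P1_def)
      have "a p * b p \<le> real p * (2 * (real n / real p) / L)"
        using ale bup[OF pp(1)] ab0 by (intro mult_mono) auto
      also have "\<dots> = 2 * N\<^sup>2 / L" using pp(2) unfolding nN by simp
      finally show "a p * b p \<le> 2 * N\<^sup>2 / L" .
    qed
    also have "\<dots> = K * (2 * N\<^sup>2 / L)" by (simp add: K_def)
    also have "\<dots> \<le> (4 * y / L) * (2 * N\<^sup>2 / L)" using K N0 L0 by (intro mult_right_mono) auto
    also have "\<dots> = 64 / L * (N / (2 * L)) ^ 3" unfolding y_def using L0 by (simp add: field_simps power2_eq_square power3_eq_cube)
    also have "\<dots> \<le> 64 * e * M ^ 3" using small2 M3 e0 NL0 L0 by (intro mult_mono) auto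
    finally show ?thesis .
  qed
  have s1': "0 \<le> (\<Sum>p\<in>P1. a p * b p)" using ab0 by (intro sum_nonneg) simp
  \<comment> \<open>large primes\<close>
  have s2: "a p * b p \<le> M\<^sup>2 * (1 + D * e) \<and> M\<^sup>2 * (1 - D * e) \<le> a p * b p" if "p \<in> P2" for p
  proof -
    define x where "x = real p"
    have x: "y < x" "x \<le> N" using that by (auto simp: P2_def P_def P1_def x_def)
    have x0: "x > 1" using x y0 by linarith
    have p0: "p > 0" using x0 by (simp add: x_def)
    have z: "N\<^sup>2 / x \<ge> N" using ndiv[of p] x p0 unfolding nN x_def by simp
    have lz: "ln (N\<^sup>2 / x) = 2 * L - ln x" using x0 N0 by (subst ln_div) (auto simp: ln_realpow L_def)
    define \<delta> where "\<delta> = L - ln x"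
    have d0: "\<delta> \<ge> 0" unfolding \<delta>_def L_def using x x0 by simp
    have d1: "\<delta> \<le> 2 * ln L"
    proof -
      have "ln y \<le> ln x" using x y0 by simp
      then show ?thesis unfolding \<delta>_def ly by linarith
    qed
    have prod: "ln x * ln (N\<^sup>2 / x) = L\<^sup>2 - \<delta>\<^sup>2" unfolding lz \<delta>_def by (simp add: power2_eq_square algebra_simps)
    have dd: "\<delta>\<^sup>2 \<le> L\<^sup>2 * e"
    proof -
      have "\<delta>\<^sup>2 \<le> (2 * ln L)\<^sup>2" using d0 d1 by (intro power_mono)
      also have "\<dots> = L\<^sup>2 * (2 * ln L / L)\<^sup>2" using L0 by (simp add: power_divide)
      also have "\<dots> \<le> L\<^sup>2 * e" using eta by (intro mult_left_mono) auto
      finally show ?thesis .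
    qed
    have h1: "\<bar>a p * ln x / x - 1\<bar> \<le> 2 * (C * e)"
    proof -
      have "\<bar>real (prime_pi x) * ln x / x - 1\<bar> \<le> C / sqrt (ln x)" by (rule pnt) (use x in \<open>simp add: y_def\<close>)
      also have "\<dots> \<le> 2 * (C * e)" by (rule err) (use x in simp)
      finally show ?thesis by (simp add: a_def x_def)
    qed
    have h2: "\<bar>b p * ln (N\<^sup>2 / x) / (N\<^sup>2 / x) - 1\<bar> \<le> C * e"
    proof -
      have "\<bar>real (prime_pi (N\<^sup>2 / x)) * ln (N\<^sup>2 / x) / (N\<^sup>2 / x) - 1\<bar> \<le> C / sqrt (ln (N\<^sup>2 / x))"
        by (rule pnt) (use z yN in \<open>simp add: y_def\<close>)
      also have "\<dots> \<le> C * e" by (rule errN[OF z])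
      finally show ?thesis by (simp only: b_def x_def nN)
    qed
    have "e < 1" using e1 by linarith
    have pl: "L\<^sup>2 * (1 - e) \<le> ln x * ln (N\<^sup>2 / x)" unfolding prod using dd by (simp add: algebra_simps)
    have pu: "ln x * ln (N\<^sup>2 / x) \<le> L\<^sup>2" unfolding prod by simp
    have x00: "x > 0" using x0 by linarith
    note est = prime_pair_product_estimate[OF C e0 \<open>e < 1\<close> Ce L0 N0 h1 h2 Mest x00 pl pu ab0 M0 up lo]
    show ?thesis using est by (rule conjI)
  qed
  have fin2: "finite P2" unfolding P2_def using finP by simp
  have cardP2: "real (card P2) = M - K"
    unfolding P2_def K_def cardP[symmetric] using card_Diff_subset[OF finite_subset[OF P1P finP] P1P] card_mono[OF finP P1P]
    by (simp add: of_nat_diff)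
  have K0: "K \<ge> 0" by (simp add: K_def)
  have MK: "M - K \<ge> 0" using cardP2 by (metis of_nat_0_le_iff)
  have De0: "D * e > 0" using D e0 by simp
  have s2u: "(\<Sum>p\<in>P2. a p * b p) \<le> M ^ 3 * (1 + D * e)"
  proof -
    have "(\<Sum>p\<in>P2. a p * b p) \<le> (\<Sum>p\<in>P2. M\<^sup>2 * (1 + D * e))" by (rule sum_mono) (use s2 in blast)
    also have "\<dots> = (M - K) * (M\<^sup>2 * (1 + D * e))" by (simp add: cardP2)
    also have "\<dots> \<le> M * (M\<^sup>2 * (1 + D * e))" using K0 De0 by (intro mult_right_mono mult_nonneg_nonneg) auto
    also have "\<dots> = M ^ 3 * (1 + D * e)" by (simp add: power2_eq_square power3_eq_cube)
    finally show ?thesis .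
  qed
  \<comment> \<open>Removing the \<open>K \<le> e * M\<close> small primes costs one more
    \<open>e\<close>, through \<open>(1 - e) * (1 - D * e) \<ge> 1 - (D + 1) * e\<close>.\<close>
  have s2l: "M ^ 3 * (1 - (D + 1) * e) \<le> (\<Sum>p\<in>P2. a p * b p)"
  proof (cases "1 - D * e \<ge> 0")
    case True
    have "M ^ 3 * (1 - (D + 1) * e) \<le> M ^ 3 * ((1 - e) * (1 - D * e))"
      using mult_pos_pos[OF De0 e0] M0 by (intro mult_left_mono) (auto simp: algebra_simps)
    also have "\<dots> = (M - e * M) * (M\<^sup>2 * (1 - D * e))" by (simp add: power2_eq_square power3_eq_cube algebra_simps)
    also have "\<dots> \<le> (M - K) * (M\<^sup>2 * (1 - D * e))" using KeM True by (intro mult_right_mono mult_nonneg_nonneg) auto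
    also have "\<dots> = (\<Sum>p\<in>P2. M\<^sup>2 * (1 - D * e))" by (simp add: cardP2)
    also have "\<dots> \<le> (\<Sum>p\<in>P2. a p * b p)" by (rule sum_mono) (use s2 in blast)
    finally show ?thesis .
  next
    case False
    have "(D + 1) * e = D * e + e" by (simp add: distrib_right)
    then have "1 - (D + 1) * e \<le> 0" using False e0 by linarith
    then have "M ^ 3 * (1 - (D + 1) * e) \<le> 0" using M0 by (intro mult_nonneg_nonpos) auto
    also have "0 \<le> (\<Sum>p\<in>P2. a p * b p)" using ab0 by (intro sum_nonneg) simp
    finally show ?thesis .
  qed
  have split: "(\<Sum>p\<in>P. a p * b p) = (\<Sum>p\<in>P1. a p * b p) + (\<Sum>p\<in>P2. a p * b p)"
    unfolding P2_def using sum.subset_diff[OF P1P finP, of "\<lambda>p. a p * b p"] by simp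
  have sab: "\<bar>(\<Sum>p\<in>P. a p * b p) - M ^ 3\<bar> \<le> (D + 65) * e * M ^ 3"
  proof -
    have u: "(\<Sum>p\<in>P. a p * b p) \<le> M ^ 3 + D * (e * M ^ 3) + 64 * (e * M ^ 3)"
      unfolding split using s1 s2u by (simp add: algebra_simps)
    have l: "M ^ 3 - D * (e * M ^ 3) - e * M ^ 3 \<le> (\<Sum>p\<in>P. a p * b p)"
      unfolding split using s1' s2l by (simp add: algebra_simps)
    have r: "(D + 65) * e * M ^ 3 = D * (e * M ^ 3) + 65 * (e * M ^ 3)" by (simp add: algebra_simps)
    have "e * M ^ 3 \<ge> 0" using e0 M0 by simp
    moreover have "\<bar>s - m\<bar> \<le> d + 65 * t" if "s \<le> m + d + 64 * t" "m - d - t \<le> s" "t \<ge> 0" for s m d t :: real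
      using that by linarith
    ultimately show ?thesis unfolding r using u l by blast
  qed
  have sa: "(\<Sum>p\<in>P. a p) = M * (M + 1) / 2"
    unfolding P_def a_def M_def sum_over_primes_real[OF less_imp_le[OF N0], of "\<lambda>k. real k"] by (rule sum_linear_real)
  have sa2: "(\<Sum>p\<in>P. a p ^ 2) = M * (M + 1) * (2 * M + 1) / 6"
    unfolding P_def a_def M_def sum_over_primes_real[OF less_imp_le[OF N0], of "\<lambda>k. real k ^ 2"] by (rule sum_squares_real)
  have sb: "(\<Sum>p\<in>P. b p) \<le> 2 * (N\<^sup>2 * sqrt N)"
  proof -
    \<comment> \<open>Splitting at \<open>sqrt N\<close> with \<open>b p \<le> N^2 / p\<close>: at
      most \<open>sqrt N\<close> primes with \<open>b p \<le> N^2\<close>, and at most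
      \<open>N\<close> primes with \<open>b p \<le> N^2 / sqrt N\<close>.\<close>
    define R where "R = {p::nat. prime p \<and> real p \<le> sqrt N}"
    have sN: "sqrt N \<ge> 1" "sqrt N \<le> N" using N by (auto simp: real_le_lsqrt power2_eq_square)
    have sNN: "sqrt N * sqrt N = N" using N0 by simp
    have RP: "R \<subseteq> P" unfolding R_def P_def using sN by auto
    have ble: "b p \<le> N\<^sup>2 / real p" for p unfolding b_def nN[symmetric] by (rule prime_pi_le) simp
    have "(\<Sum>p\<in>R. b p) \<le> (\<Sum>p\<in>R. N\<^sup>2)"
    proof (rule sum_mono)
      fix p assume "p \<in> R"
      then have "real p \<ge> 1" using prime_gt_0_nat[of p] by (auto simp: R_def)
      then have "N\<^sup>2 / real p \<le> N\<^sup>2 / 1" by (intro divide_left_mono) auto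
      then show "b p \<le> N\<^sup>2" using ble[of p] by simp
    qed
    also have "\<dots> = real (prime_pi (sqrt N)) * N\<^sup>2" by (simp add: R_def prime_pi_def)
    also have "\<dots> \<le> sqrt N * N\<^sup>2" using N0 by (intro mult_right_mono prime_pi_le) auto
    finally have r1: "(\<Sum>p\<in>R. b p) \<le> N\<^sup>2 * sqrt N" by (simp add: mult.commute)
    have "(\<Sum>p\<in>P - R. b p) \<le> (\<Sum>p\<in>P - R. N\<^sup>2 / sqrt N)"
    proof (rule sum_mono)
      fix p assume "p \<in> P - R"
      then have "real p \<ge> sqrt N" by (auto simp: P_def R_def)
      then have "N\<^sup>2 / real p \<le> N\<^sup>2 / sqrt N" using sN by (intro divide_left_mono mult_pos_pos) (linarith | simp)+
      then show "b p \<le> N\<^sup>2 / sqrt N" using ble[of p] by linarith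
    qed
    also have "\<dots> = real (card (P - R)) * (N\<^sup>2 / sqrt N)" by simp
    also have "\<dots> \<le> N * (N\<^sup>2 / sqrt N)"
    proof (intro mult_right_mono)
      have "card (P - R) \<le> card P" using finP by (intro card_mono) auto
      then have "real (card (P - R)) \<le> M" unfolding cardP[symmetric] by simp
      also have "M \<le> N" unfolding M_def using N0 by (intro prime_pi_le) simp
      finally show "real (card (P - R)) \<le> N" .
    qed (use N0 in auto)
    also have "\<dots> = N\<^sup>2 * (N / sqrt N)" by simp
    also have "N / sqrt N = sqrt N" using N0 by (simp add: real_div_sqrt)
    finally have r2: "(\<Sum>p\<in>P - R. b p) \<le> N\<^sup>2 * sqrt N" .
    show ?thesis using r1 r2 sum.subset_diff[OF RP finP, of b] by linarith
  qed
  have sb': "(\<Sum>p\<in>P. b p) \<le> e * M ^ 3"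
    using sb big1 mult_left_mono[OF M3, of e] e0 by linarith
  have sb0: "(\<Sum>p\<in>P. b p) \<ge> 0" using ab0 by (intro sum_nonneg) simp
  have "real_of_int (S2_fun n) = (\<Sum>p\<in>P. (a p - 1) * (b p - a p + 1))"
    unfolding S2_fun_eq P_def a_def b_def N_def ..
  \<comment> \<open>The main terms are \<open>a p * b p\<close>, of total about \<open>M^3\<close>,
    and \<open>a p ^ 2\<close>, of total about \<open>M^3 / 3\<close>; together they leave
    \<open>2/3 * M^3\<close>.\<close>
  also have "\<dots> = (\<Sum>p\<in>P. a p * b p - a p ^ 2 + 2 * a p - b p - 1)"
    by (rule sum.cong) (simp_all add: power2_eq_square algebra_simps)
  also have "\<dots> = (\<Sum>p\<in>P. a p * b p) - (\<Sum>p\<in>P. a p ^ 2) + 2 * (\<Sum>p\<in>P. a p) - (\<Sum>p\<in>P. b p) - M"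
    by (simp add: sum.distrib sum_subtractf sum_distrib_left[symmetric] cardP)
  finally have S: "real_of_int (S2_fun n) = (\<Sum>p\<in>P. a p * b p) - M * (M + 1) * (2 * M + 1) / 6 + M * (M + 1) - (\<Sum>p\<in>P. b p) - M"
    unfolding sa sa2 by simp
  have poly: "M * (M + 1) * (2 * M + 1) / 6 = M ^ 3 / 3 + M\<^sup>2 / 2 + M / 6" "M * (M + 1) = M\<^sup>2 + M"
    by (simp_all add: field_simps power2_eq_square power3_eq_cube)
  have MM: "M \<le> M\<^sup>2" using M1 by (simp add: power2_eq_square)
  have "\<bar>s - 2 / 3 * m3\<bar> \<le> d + 5 * t"
    if "s = ab - (m3 / 3 + m2 / 2 + m / 6) + (m2 + m) - bb - m" "\<bar>ab - m3\<bar> \<le> d" "0 \<le> bb" "bb \<le> t" "0 \<le> m" "m \<le> m2" "m2 \<le> t"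
    for s ab m3 m2 m bb d t :: real using that by linarith
  from this[OF S[unfolded poly(1), unfolded poly(2)] sab sb0 sb' M0 MM M2]
  have "\<bar>real_of_int (S2_fun n) - 2 / 3 * M ^ 3\<bar> \<le> (D + 65) * e * M ^ 3 + 5 * (e * M ^ 3)" .
  also have "\<dots> = (D + 70) * e * M ^ 3" by (simp add: algebra_simps)
  finally show ?thesis .
qed

text \<open>\<open>D\<close> comes from expanding the two rational functions of \<open>e\<close> at
  \<open>0\<close>, where both equal \<open>1\<close>. All other conditions of the estimate hold for
  large \<open>N\<close>.\<close>

lemma S2_fun_error:
  "\<exists>D>0. eventually (\<lambda>n. \<bar>real_of_int (S2_fun n) - 2 / 3 * real (prime_pi (sqrt (real n))) ^ 3\<bar>
    \<le> D * (1 / sqrt (ln (sqrt (real n)))) * real (prime_pi (sqrt (real n))) ^ 3) at_top"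
proof -
  obtain C where C: "C > 0" and ev: "eventually (\<lambda>x. \<bar>real (prime_pi x) * ln x / x - 1\<bar> \<le> C / sqrt (ln x)) at_top"
    using prime_number_theorem_sqrt by blast
  obtain X where X: "\<forall>x\<ge>X. \<bar>real (prime_pi x) * ln x / x - 1\<bar> \<le> C / sqrt (ln x)"
    using ev unfolding eventually_at_top_linorder by blast
  define f where "f = (\<lambda>e. (1 + 2 * (C * e)) * (1 + C * e) / ((1 - e) * (1 - C * e)\<^sup>2))"
  define g where "g = (\<lambda>e. (1 - 2 * (C * e)) * (1 - C * e) / (1 + C * e)\<^sup>2)"
  have "(\<lambda>N. f (1 / sqrt (ln N)) - 1) \<in> O(\<lambda>N. 1 / sqrt (ln N))"
    unfolding f_def using C by real_asymp
  then obtain D1 where D1: "D1 > 0" and ev1: "eventually (\<lambda>N. norm (f (1 / sqrt (ln N)) - 1) \<le> D1 * norm (1 / sqrt (ln N))) at_top"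
    by (rule landau_o.bigE)
  have "(\<lambda>N. g (1 / sqrt (ln N)) - 1) \<in> O(\<lambda>N. 1 / sqrt (ln N))"
    unfolding g_def using C by real_asymp
  then obtain D2 where D2: "D2 > 0" and ev2: "eventually (\<lambda>N. norm (g (1 / sqrt (ln N)) - 1) \<le> D2 * norm (1 / sqrt (ln N))) at_top"
    by (rule landau_o.bigE)
  define D where "D = D1 + D2"
  have D: "D > 0" using D1 D2 by (simp add: D_def)
  have "filterlim (\<lambda>N::real. N / (ln N)\<^sup>2) at_top at_top" by real_asymp
  then have evX: "eventually (\<lambda>N::real. N / (ln N)\<^sup>2 \<ge> X) at_top" by (simp add: filterlim_at_top)
  have evs: "eventually (\<lambda>N::real. N \<ge> 4) at_top" "eventually (\<lambda>N::real. ln N \<ge> 4) at_top"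
    "eventually (\<lambda>N::real. N / (ln N)\<^sup>2 > 1) at_top" "eventually (\<lambda>N::real. 2 * ln (ln N) \<le> ln N / 2) at_top"
    "eventually (\<lambda>N::real. (2 * ln (ln N) / ln N)\<^sup>2 \<le> 1 / sqrt (ln N)) at_top"
    "eventually (\<lambda>N::real. C * (1 / sqrt (ln N)) \<le> 1 / 8) at_top"
    "eventually (\<lambda>N::real. 2 * (N\<^sup>2 * sqrt N) \<le> 1 / sqrt (ln N) * (N / (2 * ln N)) ^ 3) at_top"
    "eventually (\<lambda>N::real. 1 \<le> 1 / sqrt (ln N) * (N / (2 * ln N))) at_top"
    "eventually (\<lambda>N::real. 8 / (ln N)\<^sup>2 \<le> 1 / sqrt (ln N)) at_top"
    "eventually (\<lambda>N::real. 64 / ln N \<le> 64 * (1 / sqrt (ln N))) at_top"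
    using C by real_asymp+
  \<comment> \<open>The conditions are collected for a real variable \<open>N\<close> tending to
    infinity and pulled back along \<open>n \<mapsto> sqrt n\<close> afterwards.\<close>
  have "eventually (\<lambda>N. \<forall>n. N = sqrt (real n) \<longrightarrow> \<bar>real_of_int (S2_fun n) - 2 / 3 * real (prime_pi (sqrt (real n))) ^ 3\<bar>
    \<le> (D + 70) * (1 / sqrt (ln (sqrt (real n)))) * real (prime_pi (sqrt (real n))) ^ 3) at_top"
    using evX evs ev1 ev2
  proof eventually_elim
    case (elim N)
    show ?case
    proof (intro allI impI)
      fix n assume N: "N = sqrt (real n)"
      note el = elim[unfolded N]
      have s0: "1 / sqrt (ln (sqrt (real n))) > 0" using el(3) by simp
      have nrm: "norm (1 / sqrt (ln (sqrt (real n)))) = 1 / sqrt (ln (sqrt (real n)))"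
        using s0 by (simp only: real_norm_def abs_of_pos)
      have dd: "D * e = D1 * e + D2 * e" for e by (simp add: D_def distrib_right)
      have pos: "D1 * (1 / sqrt (ln (sqrt (real n)))) \<ge> 0" "D2 * (1 / sqrt (ln (sqrt (real n)))) \<ge> 0"
        using D1 D2 s0 by (intro mult_nonneg_nonneg; linarith)+
      have up: "f (1 / sqrt (ln (sqrt (real n)))) \<le> 1 + D * (1 / sqrt (ln (sqrt (real n))))"
        using el(12) pos unfolding nrm dd real_norm_def abs_le_iff by linarith
      have lo: "1 - D * (1 / sqrt (ln (sqrt (real n)))) \<le> g (1 / sqrt (ln (sqrt (real n))))"
        using el(13) pos unfolding nrm dd real_norm_def abs_le_iff by linarith
      have pnt: "\<bar>real (prime_pi x) * ln x / x - 1\<bar> \<le> C / sqrt (ln x)" if "x \<ge> sqrt (real n) / (ln (sqrt (real n)))\<^sup>2" for x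
        using X that el(1) by simp
      show "\<bar>real_of_int (S2_fun n) - 2 / 3 * real (prime_pi (sqrt (real n))) ^ 3\<bar>
        \<le> (D + 70) * (1 / sqrt (ln (sqrt (real n)))) * real (prime_pi (sqrt (real n))) ^ 3"
        by (rule S2_fun_estimate[OF C D pnt el(2,3,4,5,6,7) up[unfolded f_def] lo[unfolded g_def] el(8,9,10,11)])
    qed
  qed
  moreover have "filterlim (\<lambda>n::nat. sqrt (real n)) at_top at_top" by real_asymp
  ultimately have "eventually (\<lambda>n. \<forall>m. sqrt (real n) = sqrt (real m) \<longrightarrow> \<bar>real_of_int (S2_fun m) - 2 / 3 * real (prime_pi (sqrt (real m))) ^ 3\<bar>
    \<le> (D + 70) * (1 / sqrt (ln (sqrt (real m)))) * real (prime_pi (sqrt (real m))) ^ 3) at_top"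
    by (rule eventually_compose_filterlim)
  then have "eventually (\<lambda>n. \<bar>real_of_int (S2_fun n) - 2 / 3 * real (prime_pi (sqrt (real n))) ^ 3\<bar>
    \<le> (D + 70) * (1 / sqrt (ln (sqrt (real n)))) * real (prime_pi (sqrt (real n))) ^ 3) at_top"
    by (rule eventually_mono) blast
  moreover have "D + 70 > 0" using D by simp
  ultimately show ?thesis by blast
qed

lemma prime_pi_sqrt_tendsto:
  "(\<lambda>n::nat. real (prime_pi (sqrt (real n))) * ln (sqrt (real n)) / sqrt (real n)) \<longlonglongrightarrow> 1"
proof -
  obtain C where C: "C > 0" and ev: "eventually (\<lambda>x. \<bar>real (prime_pi x) * ln x / x - 1\<bar> \<le> C / sqrt (ln x)) at_top"
    using prime_number_theorem_sqrt by blast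
  have lim: "((\<lambda>x. C / sqrt (ln x)) \<longlongrightarrow> 0) at_top" by real_asymp
  have "((\<lambda>x. real (prime_pi x) * ln x / x - 1) \<longlongrightarrow> 0) at_top"
    by (rule Lim_null_comparison[OF _ lim]) (use ev in simp)
  then have "((\<lambda>x. real (prime_pi x) * ln x / x) \<longlongrightarrow> 1) at_top" by (rule LIM_zero_cancel)
  moreover have "filterlim (\<lambda>n::nat. sqrt (real n)) at_top at_top" by real_asymp
  ultimately show ?thesis by (rule filterlim_compose)
qed

theorem theorem26:
  fixes K :: "'k :: field_char_0 itself"
  shows
    "(\<exists>(C :: real) (n0 :: nat). \<forall>n \<ge> n0.
        \<bar>real_of_int (S2_fun n) / real (prime_pi (sqrt (real n))) ^ 3 - 2 / 3\<bar>
          \<le> C * (ln (ln (real n)) / sqrt (ln (real n)))) \<and>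
     (\<lambda>n. real_of_int (S_fun K n)) \<sim>[at_top] (\<lambda>n. 2 / 3 * real (prime_pi (sqrt (real n))) ^ 3) \<and>
     (\<lambda>n :: nat. 2 / 3 * real (prime_pi (sqrt (real n))) ^ 3)
       \<sim>[at_top] (\<lambda>n. 16 / 3 * (real n powr (3 / 2) / ln (real n) ^ 3)) \<and>
     (\<exists>\<epsilon> :: nat \<Rightarrow> real. \<epsilon> \<longlonglongrightarrow> 0 \<and>
        (\<forall>\<^sub>F n in at_top. real (num_gens K n) =
           real ((prime_pi (real n) + 1) choose 2)
             + (16 / 3 + \<epsilon> n) * (real n powr (3 / 2) / ln (real n) ^ 3))) \<and>
     (\<lambda>n. real n * (real (prime_pi (sqrt (real n))) - 1) / real_of_int (S_fun K n))
       \<in> \<Theta>[at_top](\<lambda>n. ln (real n) ^ 2)"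
proof -
  define M where "M = (\<lambda>n::nat. real (prime_pi (sqrt (real n))))"
  define G where "G = (\<lambda>n::nat. real n powr (3 / 2) / ln (real n) ^ 3)"
  define S where "S = (\<lambda>n. real_of_int (S_fun K n))"
  obtain D where D: "D > 0" and ev0: "eventually (\<lambda>n. \<bar>real_of_int (S2_fun n) - 2 / 3 * real (prime_pi (sqrt (real n))) ^ 3\<bar>
    \<le> D * (1 / sqrt (ln (sqrt (real n)))) * real (prime_pi (sqrt (real n))) ^ 3) at_top"
    using S2_fun_error by blast
  then have ev: "eventually (\<lambda>n. \<bar>real_of_int (S2_fun n) - 2 / 3 * M n ^ 3\<bar> \<le> D * (1 / sqrt (ln (sqrt (real n)))) * M n ^ 3) at_top"
    by (simp only: M_def)
  have Mlim: "(\<lambda>n. M n * ln (sqrt (real n)) / sqrt (real n)) \<longlonglongrightarrow> 1"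
    unfolding M_def by (rule prime_pi_sqrt_tendsto)
  have large: "eventually (\<lambda>n::nat. ln (ln (real n)) \<ge> 1) at_top" "eventually (\<lambda>n::nat. real n \<ge> 2) at_top"
    by real_asymp+
  have "eventually (\<lambda>n. M n * ln (sqrt (real n)) / sqrt (real n) > 1 / 2) at_top"
    by (rule order_tendstoD(1)[OF Mlim]) simp
  then have Mpos: "eventually (\<lambda>n. M n > 0) at_top"
    by (rule eventually_mono) (auto simp: M_def intro!: gr0I)
  have S2bound: "eventually (\<lambda>n. \<bar>real_of_int (S2_fun n) / M n ^ 3 - 2 / 3\<bar> \<le> 2 * D * (ln (ln (real n)) / sqrt (ln (real n)))) at_top"
    using ev Mpos large
  proof eventually_elim
    case (elim n)
    have M3: "M n ^ 3 > 0" using elim(2) by simp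
    have n0: "real n > 0" using elim(4) by simp
    have l0: "ln (real n) > 0" using elim(4) by simp
    have "\<bar>real_of_int (S2_fun n) / M n ^ 3 - 2 / 3\<bar> = \<bar>real_of_int (S2_fun n) - 2 / 3 * M n ^ 3\<bar> / M n ^ 3"
    proof -
      have "real_of_int (S2_fun n) / M n ^ 3 - 2 / 3 = (real_of_int (S2_fun n) - 2 / 3 * M n ^ 3) / M n ^ 3"
        using M3 by (simp add: diff_divide_distrib)
      then show ?thesis using M3 by (simp only: abs_divide abs_of_pos)
    qed
    also have "\<dots> \<le> D * (1 / sqrt (ln (sqrt (real n))))"
      using elim(1) M3 by (subst pos_divide_le_eq) auto
    also have "ln (sqrt (real n)) = ln (real n) / 2" using n0 by (simp add: ln_sqrt)
    also have "1 / sqrt (ln (real n) / 2) = sqrt 2 * (1 / sqrt (ln (real n)))" by (simp add: real_sqrt_divide)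
    \<comment> \<open>The factor \<open>ln (ln n)\<close> may be inserted here because it is
      eventually at least \<open>1\<close>; \<open>sqrt 2\<close> comes from
      \<open>ln (sqrt n) = ln n / 2\<close>.\<close>
    also have "D * (sqrt 2 * (1 / sqrt (ln (real n)))) \<le> D * (2 * (ln (ln (real n)) / sqrt (ln (real n))))"
    proof (intro mult_left_mono mult_mono divide_right_mono)
      show "sqrt 2 \<le> (2::real)" by (rule real_le_lsqrt) auto
    qed (use elim(3) l0 D in auto)
    finally show ?case by (simp add: mult_ac)
  qed
  have part1: "\<exists>(C :: real) (n0 :: nat). \<forall>n \<ge> n0.
        \<bar>real_of_int (S2_fun n) / real (prime_pi (sqrt (real n))) ^ 3 - 2 / 3\<bar>
          \<le> C * (ln (ln (real n)) / sqrt (ln (real n)))"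
    using S2bound unfolding M_def eventually_at_top_linorder by blast
  have G0: "eventually (\<lambda>n. G n > 0) at_top"
    using large(2) by eventually_elim (simp add: G_def)
  \<comment> \<open>The limit is \<open>2 ^ 3\<close>, from the cube of
    \<open>ln n = 2 * ln (sqrt n)\<close>; with the factor \<open>2 / 3\<close> it produces
    \<open>16 / 3\<close>.\<close>
  have M3lim: "(\<lambda>n. M n ^ 3 / G n) \<longlonglongrightarrow> 8"
  proof -
    have "(\<lambda>n. 8 * (M n * ln (sqrt (real n)) / sqrt (real n)) ^ 3) \<longlonglongrightarrow> 8 * 1 ^ 3"
      by (intro tendsto_intros Mlim)
    then have "(\<lambda>n. 8 * (M n * ln (sqrt (real n)) / sqrt (real n)) ^ 3) \<longlonglongrightarrow> 8" by simp
    moreover have "eventually (\<lambda>n. 8 * (M n * ln (sqrt (real n)) / sqrt (real n)) ^ 3 = M n ^ 3 / G n) at_top"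
      using large(2)
    proof eventually_elim
      case (elim n)
      have n0: "real n > 0" using elim by simp
      have "real n powr (3 / 2) = sqrt (real n) ^ 3"
      proof -
        have "sqrt (real n) ^ 3 = (real n powr (1 / 2)) powr 3" using n0 by (simp add: powr_half_sqrt)
        then show ?thesis by (simp add: powr_powr)
      qed
      moreover have "ln (real n) = 2 * ln (sqrt (real n))" using n0 by (simp add: ln_sqrt)
      ultimately have "G n = sqrt (real n) ^ 3 / (2 * ln (sqrt (real n))) ^ 3" unfolding G_def by (simp only:)
      then show ?case by (simp add: power_divide power_mult_distrib)
    qed
    ultimately show ?thesis by (rule Lim_transform_eventually)
  qed
  have S2lim: "(\<lambda>n. real_of_int (S2_fun n) / M n ^ 3) \<longlonglongrightarrow> 2 / 3"
  proof (rule LIM_zero_cancel, rule Lim_null_comparison)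
    show "eventually (\<lambda>n. norm (real_of_int (S2_fun n) / M n ^ 3 - 2 / 3) \<le> 2 * D * (ln (ln (real n)) / sqrt (ln (real n)))) at_top"
      using S2bound by (simp only: real_norm_def)
    show "(\<lambda>n. 2 * D * (ln (ln (real n)) / sqrt (ln (real n)))) \<longlonglongrightarrow> 0" using D by real_asymp
  qed
  \<comment> \<open>The numbers with more than two prime factors contribute at most
    \<open>n powr (4 / 3)\<close>, a smaller power of \<open>n\<close> than the \<open>3 / 2\<close>
    in \<open>G\<close>.\<close>
  have diff: "(\<lambda>n. (S n - real_of_int (S2_fun n)) / G n) \<longlonglongrightarrow> 0"
  proof (rule Lim_null_comparison)
    show "eventually (\<lambda>n. norm ((S n - real_of_int (S2_fun n)) / G n) \<le> real n * real n powr (1 / 3) / G n) at_top"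
      using large(2) G0
    proof eventually_elim
      case (elim n)
      have n1: "n \<ge> 1" using elim(1) by simp
      have "norm ((S n - real_of_int (S2_fun n)) / G n) = \<bar>S n - real_of_int (S2_fun n)\<bar> / G n"
        using elim(2) by (simp add: abs_divide)
      also have "\<dots> \<le> real n * real n powr (1 / 3) / G n"
        unfolding S_def using elim(2) by (intro divide_right_mono S_fun_S2_fun_diff[OF n1]) simp
      finally show ?case .
    qed
    show "(\<lambda>n. real n * real n powr (1 / 3) / G n) \<longlonglongrightarrow> 0" unfolding G_def by real_asymp
  qed
  have SG: "(\<lambda>n. S n / G n) \<longlonglongrightarrow> 16 / 3"
  proof -
    have "(\<lambda>n. real_of_int (S2_fun n) / M n ^ 3 * (M n ^ 3 / G n) + (S n - real_of_int (S2_fun n)) / G n) \<longlonglongrightarrow> 2 / 3 * 8 + 0"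
      by (intro tendsto_intros S2lim M3lim diff)
    then have "(\<lambda>n. real_of_int (S2_fun n) / M n ^ 3 * (M n ^ 3 / G n) + (S n - real_of_int (S2_fun n)) / G n) \<longlonglongrightarrow> 16 / 3" by simp
    moreover have "eventually (\<lambda>n. real_of_int (S2_fun n) / M n ^ 3 * (M n ^ 3 / G n) + (S n - real_of_int (S2_fun n)) / G n = S n / G n) at_top"
      using Mpos by eventually_elim (simp add: diff_divide_distrib)
    ultimately show ?thesis by (rule Lim_transform_eventually)
  qed
  have SM: "S \<sim>[at_top] (\<lambda>n. 2 / 3 * M n ^ 3)"
  proof (rule asymp_equivI')
    have "(\<lambda>n. S n / G n / (2 / 3 * (M n ^ 3 / G n))) \<longlonglongrightarrow> 16 / 3 / (2 / 3 * 8)"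
      by (intro tendsto_intros SG M3lim) simp
    then have "(\<lambda>n. S n / G n / (2 / 3 * (M n ^ 3 / G n))) \<longlonglongrightarrow> 1" by simp
    moreover have "eventually (\<lambda>n. S n / G n / (2 / 3 * (M n ^ 3 / G n)) = S n / (2 / 3 * M n ^ 3)) at_top"
      using G0 by eventually_elim simp
    ultimately show "(\<lambda>n. S n / (2 / 3 * M n ^ 3)) \<longlonglongrightarrow> 1" by (rule Lim_transform_eventually)
  qed
  have MG: "(\<lambda>n. 2 / 3 * M n ^ 3) \<sim>[at_top] (\<lambda>n. 16 / 3 * G n)"
  proof (rule asymp_equivI')
    have "(\<lambda>n. 1 / 8 * (M n ^ 3 / G n)) \<longlonglongrightarrow> 1 / 8 * 8" by (intro tendsto_intros M3lim)
    then show "(\<lambda>n. 2 / 3 * M n ^ 3 / (16 / 3 * G n)) \<longlonglongrightarrow> 1" by simp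
  qed
  have part4: "\<exists>\<epsilon> :: nat \<Rightarrow> real. \<epsilon> \<longlonglongrightarrow> 0 \<and>
        (\<forall>\<^sub>F n in at_top. real (num_gens K n) = real ((prime_pi (real n) + 1) choose 2) + (16 / 3 + \<epsilon> n) * G n)"
  proof (intro exI[of _ "\<lambda>n. S n / G n - 16 / 3"] conjI)
    show "(\<lambda>n. S n / G n - 16 / 3) \<longlonglongrightarrow> 0" using SG by (rule LIM_zero)
    show "\<forall>\<^sub>F n in at_top. real (num_gens K n) = real ((prime_pi (real n) + 1) choose 2) + (16 / 3 + (S n / G n - 16 / 3)) * G n"
      using G0
    proof eventually_elim
      case (elim n)
      have "(16 / 3 + (S n / G n - 16 / 3)) * G n = S n" using elim by simp
      moreover have "S n = real (num_gens K n) - real ((prime_pi (real n) + 1) choose 2)"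
        unfolding S_def S_fun_def by simp
      ultimately show ?case by linarith
    qed
  qed
  have part5: "(\<lambda>n. real n * (M n - 1) / S n) \<in> \<Theta>[at_top](\<lambda>n. ln (real n) ^ 2)"
  proof -
    \<comment> \<open>The \<open>- 1\<close> in the trivial upper bound does not affect the
      asymptotics; the quotient then has order
      \<open>(n * sqrt n / ln n) / (n powr (3 / 2) / ln n ^ 3)\<close>, that is
      \<open>ln n ^ 2\<close>.\<close>
    have Mn: "(\<lambda>n. (M n - 1) * ln (sqrt (real n)) / sqrt (real n)) \<longlonglongrightarrow> 1"
    proof -
      have "(\<lambda>n::nat. ln (sqrt (real n)) / sqrt (real n)) \<longlonglongrightarrow> 0" by real_asymp
      from tendsto_diff[OF Mlim this] show ?thesis by (simp add: left_diff_distrib diff_divide_distrib)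
    qed
    have "(\<lambda>n. M n - 1) \<sim>[at_top] (\<lambda>n. sqrt (real n) / ln (sqrt (real n)))"
    proof (rule asymp_equivI')
      show "(\<lambda>n. (M n - 1) / (sqrt (real n) / ln (sqrt (real n)))) \<longlonglongrightarrow> 1" using Mn by simp
    qed
    then have num: "(\<lambda>n. real n * (M n - 1)) \<sim>[at_top] (\<lambda>n. real n * (sqrt (real n) / ln (sqrt (real n))))"
      by (intro asymp_equiv_intros)
    have "(\<lambda>n. real n * (M n - 1) / S n) \<sim>[at_top] (\<lambda>n. real n * (sqrt (real n) / ln (sqrt (real n))) / (16 / 3 * G n))"
      by (intro asymp_equiv_divide num asymp_equiv_trans[OF SM MG])
    then have "(\<lambda>n. real n * (M n - 1) / S n) \<in> \<Theta>[at_top](\<lambda>n. real n * (sqrt (real n) / ln (sqrt (real n))) / (16 / 3 * G n))"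
      by (rule asymp_equiv_imp_bigtheta)
    also have "(\<lambda>n. real n * (sqrt (real n) / ln (sqrt (real n))) / (16 / 3 * G n)) \<in> \<Theta>[at_top](\<lambda>n. ln (real n) ^ 2)"
      unfolding G_def by real_asymp
    finally show ?thesis .
  qed
  show ?thesis
    using part1 SM MG part4 part5 unfolding S_def M_def G_def by blast
qed

end
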